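(* Let $k$ be a field, $V$ a finite dimensional $k$-vector space and $A=T(V)/(R)$ a quadratic algebra with $R\subseteq V\otimes V$. Let $A^!=T(V^{\ast})/(R^\perp)$ be the Koszul dual of $A$. There is an isomorphism $$HK_\bullet(A)\cong\widetilde{HK}^\bullet(A^!,A^{!\ast})$$ from the $(HK^\bullet(A),\smile_K)$-bimodule $HK_\bullet(A)$ with actions $\frown_K$, $\mathbb{N}\times\mathbb{N}$-graded by the biweight, to the $(\widetilde{HK}^\bullet(A^!),\widetilde\smile_K)$-bimodule $\widetilde{HK}^\bullet(A^!,A^{!\ast})$ with actions $\widetilde\smile_K$, $\mathbb{N}\times\mathbb{N}$-graded by the inverse biweight (the two actions being compared through the algebra isomorphism $H(\varphi_A):HK^\bullet(A)\to\widetilde{HK}^\bullet(A^!)$). In particular, for any $p\ge0$ and $m\ge0$, there is a $k$-linear isomorphism $$HK_p(A)_m\cong\widetilde{HK}^m(A^!,A^{!\ast})_p .$$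
   Context: $\otimes=\otimes_k$, $Hom=Hom_k$. For a quadratic algebra $A=T(V)/(R)$, $A_m$ is the weight $m$ component; $W_0=k$, $W_1=V$, $W_p=\bigcap_{i+2+j=p}V^{\otimes i}\otimes R\otimes V^{\otimes j}$ for $p\ge2$. Elements of $W_p$ are written $x_1\ldots x_p$ (a sum of such tensors, $x_i\in V$), with the same notation when $W_p$ is viewed inside $V^{\otimes q}\otimes W_r\otimes V^{\otimes s}$. Koszul cohomology algebra $HK^\bullet(A)$: cohomology of $(Hom(W_\bullet,A),b_K)$, $b_K(f)(x_1\ldots x_{p+1})=f(x_1\ldots x_p)x_{p+1}-(-1)^px_1f(x_2\ldots x_{p+1})$ for $f:W_p\to A$, with product induced by $(f\smile_Kg)(x_1\ldots x_{p+q})=(-1)^{pq}f(x_1\ldots x_p)g(x_{p+1}\ldots x_{p+q})$. Koszul homology $HK_\bullet(A)$: homology of $(A\otimes W_\bullet,b_K)$, $b_K(a\otimes x_1\ldots x_q)=ax_1\otimes x_2\ldots x_q+(-1)^qx_qa\otimes x_1\ldots x_{q-1}$. $A_n\otimes W_q$ has biweight $(q,n)$; $HK_q(A)_n$ is the corresponding component. The bimodule actions are induced, for $f:W_p\to A$ and $z=a\otimes x_1\ldots x_q$, by $f\frown_Kz=(-1)^{(q-p)p}f(x_{q-p+1}\ldots x_q)a\otimes x_1\ldots x_{q-p}$ and $z\frown_Kf=(-1)^{pq}af(x_1\ldots x_p)\otimes x_{p+1}\ldots x_q$ ($0$ if $q<p$). Modified cohomology: for a quadratic algebra $B$ (with its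 own spaces $W_p$) and a weight-graded $B$-bimodule $M$, set for $f:W_p\to M_m$: $\tilde b_K(f)(x_1\ldots x_{p+1})=f(x_1\ldots x_p).x_{p+1}-(-1)^mx_1.f(x_2\ldots x_{p+1})$. $\widetilde{HK}^\bullet(B,M)$ is the cohomology of $(Hom(W_\bullet,M),\tilde b_K)$, $\widetilde{HK}^p(B,M)_m$ is the part coming from maps $W_p\to M_m$ and has inverse biweight $(m,p)$; $\widetilde{HK}^\bullet(B)=\widetilde{HK}^\bullet(B,B)$. Products and actions are induced by $(f\,\widetilde\smile_K\,g)(x_1\ldots x_{p+q})=(-1)^{mn}f(x_1\ldots x_p).g(x_{p+1}\ldots x_{p+q})$ for $f$, $g$ of homological weights $p,q$ and coefficient weights $m,n$, where one of $f,g$ takes values in $B$ and the other in $B$ or in $M$. Graded dual: $B^{\ast}=\bigoplus_{m\ge0}B_m^{\ast}$, where $B_m^{\ast}$ is given weight $m$, with bimodule actions: for $u\in B_m^{\ast}$, $a\in B_n$, the elements $a.u,u.a\in B_{m-n}^{\ast}$ are $(a.u)(a')=(-1)^nu(a'a)$ and $(u.a)(a')=u(aa')$ for $a'\in B_{m-n}$. Here $B=A^!$, $M=A^{!\ast}$. Koszul dual: $R^\perp\subseteq V^{\ast}\otimes V^{\ast}\cong(V\otimes V)^{\ast}$ (no sign) is the orthogonal of $R$. $W^!_p$ denotes the space $W_p$ for $A^!$. There are natural isomorphisms $W^!_m\cong A_m^{\ast}$ ($W_m^!\subseteq (V^{\otimes m})^{\ast}$ being the space of forms vanishing on the relations of weight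 $m$) and $A^!_p\cong W_p^{\ast}$ (induced by restricting forms on $V^{\otimes p}$ to $W_p$). For $f:W_p\to A_m$, $\varphi_A(f):W^!_m\to A^!_p$ corresponds under these isomorphisms to the transpose $f^{\ast}:A_m^{\ast}\to W_p^{\ast}$. The map $\varphi_A$ induces an isomorphism of algebras $H(\varphi_A):(HK^\bullet(A),\smile_K)\to(\widetilde{HK}^\bullet(A^!),\widetilde\smile_K)$, sending $HK^p(A)_m$ onto $\widetilde{HK}^m(A^!)_p$. *)

theory Defs
  imports Complex_Main "HOL-Library.Function_Algebras" "HOL-Library.FuncSet"
begin

section \<open>Vector spaces with explicit carrier\<close>

text \<open>
  Quotients, spaces of linear maps and tensor products have to be formed from spaces that depend on
  term parameters.  They are therefore records over a fixed field \<open>'k\<close>; the scalars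
  come from a type class, so that the library's \<open>module.span\<close> is available.
\<close>

record ('k, 'a) vspace =
  vcar :: "'a set"
  vadd :: "'a \<Rightarrow> 'a \<Rightarrow> 'a"
  vzero :: "'a"
  vscale :: "'k \<Rightarrow> 'a \<Rightarrow> 'a"

definition vfield :: "('k::field, 'k) vspace" where
  "vfield = \<lparr>vcar = UNIV, vadd = (+), vzero = 0, vscale = (*)\<rparr>"

definition vtype :: "('k::field \<Rightarrow> 'v \<Rightarrow> 'v) \<Rightarrow> ('k, 'v::ab_group_add) vspace" where
  "vtype scale = \<lparr>vcar = UNIV, vadd = (+), vzero = 0, vscale = scale\<rparr>"

definition fscale :: "'k::field \<Rightarrow> ('i \<Rightarrow> 'k) \<Rightarrow> ('i \<Rightarrow> 'k)" where
  "fscale c f = (\<lambda>i. c * f i)"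

definition fspan :: "('i \<Rightarrow> 'k::field) set \<Rightarrow> ('i \<Rightarrow> 'k) set" where
  "fspan S = module.span fscale S"

definition fsub :: "('i \<Rightarrow> 'k::field) set \<Rightarrow> ('k, 'i \<Rightarrow> 'k) vspace" where
  "fsub S = \<lparr>vcar = S, vadd = (+), vzero = 0, vscale = fscale\<rparr>"

definition vsub :: "('k, 'a) vspace \<Rightarrow> 'a set \<Rightarrow> ('k, 'a) vspace" where
  "vsub U S = U\<lparr>vcar := S\<rparr>"

definition vclass :: "('k, 'a) vspace \<Rightarrow> 'a set \<Rightarrow> 'a \<Rightarrow> 'a set" where
  "vclass U N x = vadd U x ` N"

definition vquot :: "('k, 'a) vspace \<Rightarrow> 'a set \<Rightarrow> ('k, 'a set) vspace" where
  "vquot U N =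
    \<lparr>vcar = vclass U N ` vcar U,
     vadd = (\<lambda>X Y. \<Union>x\<in>X. \<Union>y\<in>Y. vclass U N (vadd U x y)),
     vzero = vclass U N (vzero U),
     vscale = (\<lambda>c X. \<Union>x\<in>X. vclass U N (vscale U c x))\<rparr>"

definition vlinear :: "('k, 'a) vspace \<Rightarrow> ('k, 'b) vspace \<Rightarrow> ('a \<Rightarrow> 'b) \<Rightarrow> bool" where
  "vlinear U W f \<longleftrightarrow>
    (\<forall>x\<in>vcar U. \<forall>y\<in>vcar U. f (vadd U x y) = vadd W (f x) (f y)) \<and>
    (\<forall>c. \<forall>x\<in>vcar U. f (vscale U c x) = vscale W c (f x))"

definition vhom :: "('k, 'a) vspace \<Rightarrow> ('k, 'b) vspace \<Rightarrow> ('k, 'a \<Rightarrow> 'b) vspace" where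
  "vhom U W =
    \<lparr>vcar = {f \<in> vcar U \<rightarrow>\<^sub>E vcar W. vlinear U W f},
     vadd = (\<lambda>f g. \<lambda>x\<in>vcar U. vadd W (f x) (g x)),
     vzero = (\<lambda>x\<in>vcar U. vzero W),
     vscale = (\<lambda>c f. \<lambda>x\<in>vcar U. vscale W c (f x))\<rparr>"

definition vdual :: "('k::field, 'a) vspace \<Rightarrow> ('k, 'a \<Rightarrow> 'k) vspace" where
  "vdual U = vhom U vfield"

definition viso :: "('k, 'a) vspace \<Rightarrow> ('k, 'b) vspace \<Rightarrow> ('a \<Rightarrow> 'b) set" where
  "viso U W = {h \<in> vcar (vhom U W). bij_betw h (vcar U) (vcar W)}"

text \<open>
  Over a field the bilinear forms on \<open>U \<times> W\<close> separate the elements of the tensor product, so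
  the latter is the span of the evaluations \<open>\<beta> \<mapsto> \<beta> u w\<close> on bilinear forms.
\<close>

definition bforms :: "('k::field, 'a) vspace \<Rightarrow> ('k, 'b) vspace \<Rightarrow> ('a \<Rightarrow> 'b \<Rightarrow> 'k) set" where
  "bforms U W = {\<beta>. (\<forall>u\<in>vcar U. vlinear W vfield (\<beta> u)) \<and>
                    (\<forall>w\<in>vcar W. vlinear U vfield (\<lambda>u. \<beta> u w))}"

definition ptens ::
  "('k::field, 'a) vspace \<Rightarrow> ('k, 'b) vspace \<Rightarrow> 'a \<Rightarrow> 'b \<Rightarrow> ('a \<Rightarrow> 'b \<Rightarrow> 'k) \<Rightarrow> 'k" where
  "ptens U W u w = (\<lambda>\<beta>. if \<beta> \<in> bforms U W then \<beta> u w else 0)"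

definition vtens ::
  "('k::field, 'a) vspace \<Rightarrow> ('k, 'b) vspace \<Rightarrow> ('k, ('a \<Rightarrow> 'b \<Rightarrow> 'k) \<Rightarrow> 'k) vspace" where
  "vtens U W = fsub (fspan {ptens U W u w | u w. u \<in> vcar U \<and> w \<in> vcar W})"

text \<open>
  The linear map \<open>D \<rightarrow> Y\<close> with \<open>p u w \<mapsto> \<beta> u w\<close>, where \<open>D\<close> is a tensor product of \<open>U\<close> and
  \<open>W\<close> with universal bilinear map \<open>p\<close>.  It is unique as the maps in \<open>vhom\<close> are extensional.
\<close>

definition blift ::
  "('k, 'd) vspace \<Rightarrow> ('a \<Rightarrow> 'b \<Rightarrow> 'd) \<Rightarrow> ('k, 'a) vspace \<Rightarrow> ('k, 'b) vspace \<Rightarrow>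
   ('k, 'c) vspace \<Rightarrow> ('a \<Rightarrow> 'b \<Rightarrow> 'c) \<Rightarrow> ('d \<Rightarrow> 'c)" where
  "blift D p U W Y \<beta> =
    (THE h. h \<in> vcar (vhom D Y) \<and> (\<forall>u\<in>vcar U. \<forall>w\<in>vcar W. h (p u w) = \<beta> u w))"


section \<open>Tensor algebra and quadratic algebras\<close>

type_synonym ('k, 'a) tensor = "('a list \<Rightarrow> 'k) \<Rightarrow> 'k"

text \<open>
  As for \<open>vtens\<close>, the tensor \<open>x\<^sub>1 \<dots> x\<^sub>m\<close> is the evaluation at the list
  \<open>[x\<^sub>1, \<dots>, x\<^sub>m]\<close> of forms that are multilinear on the lists of every given length.
\<close>

definition mforms :: "('k::field, 'a) vspace \<Rightarrow> ('a list \<Rightarrow> 'k) set" where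
  "mforms V = {\<phi>. \<forall>ys\<in>lists (vcar V). \<forall>zs\<in>lists (vcar V). vlinear V vfield (\<lambda>x. \<phi> (ys @ x # zs))}"

definition pure :: "('k::field, 'a) vspace \<Rightarrow> 'a list \<Rightarrow> ('k, 'a) tensor" where
  "pure V xs = (\<lambda>\<phi>. if \<phi> \<in> mforms V then \<phi> xs else 0)"

definition tpow :: "('k::field, 'a) vspace \<Rightarrow> nat \<Rightarrow> ('k, ('k, 'a) tensor) vspace" where
  "tpow V m = fsub (fspan {pure V xs | xs. xs \<in> lists (vcar V) \<and> length xs = m})"

text \<open>Concatenation of tensors: \<open>tmul V (pure V xs) (pure V ys) = pure V (xs @ ys)\<close>.\<close>

definition tmul ::
  "('k::field, 'a) vspace \<Rightarrow> ('k, 'a) tensor \<Rightarrow> ('k, 'a) tensor \<Rightarrow> ('k, 'a) tensor" where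
  "tmul V s t = (\<lambda>\<phi>. if \<phi> \<in> mforms V then s (\<lambda>xs. t (\<lambda>ys. \<phi> (xs @ ys))) else 0)"

definition tprod :: "('k::field, 'a) vspace \<Rightarrow> ('k, ('k, 'a) tensor) vspace \<Rightarrow>
    ('k, ('k, 'a) tensor) vspace \<Rightarrow> ('k, ('k, 'a) tensor) vspace" where
  "tprod V S S' = fsub (fspan {tmul V s t | s t. s \<in> vcar S \<and> t \<in> vcar S'})"

text \<open>
  \<open>tsplit V S S' Y \<beta>\<close> sends \<open>s t\<close> in \<open>S \<otimes> S' \<subseteq> T(V)\<close> to \<open>\<beta> s t\<close>.  Applied to an element of
  \<open>W\<^sub>p\<^sub>+\<^sub>q \<subseteq> W\<^sub>p \<otimes> W\<^sub>q\<close> this is what is meant by expressions such as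
  \<open>f(x\<^sub>1 \<dots> x\<^sub>p) g(x\<^sub>p\<^sub>+\<^sub>1 \<dots> x\<^sub>p\<^sub>+\<^sub>q)\<close>.
\<close>

definition tsplit ::
  "('k::field, 'a) vspace \<Rightarrow> ('k, ('k, 'a) tensor) vspace \<Rightarrow> ('k, ('k, 'a) tensor) vspace \<Rightarrow>
   ('k, 'c) vspace \<Rightarrow> (('k, 'a) tensor \<Rightarrow> ('k, 'a) tensor \<Rightarrow> 'c) \<Rightarrow> ('k, 'a) tensor \<Rightarrow> 'c" where
  "tsplit V S S' Y \<beta> = blift (tprod V S S') (tmul V) S S' Y \<beta>"

text \<open>The tensors \<open>V\<^sup>i R V\<^sup>j\<close> (all products, not yet their span).\<close>

definition rels ::
  "('k::field, 'a) vspace \<Rightarrow> ('k, 'a) tensor set \<Rightarrow> nat \<Rightarrow> nat \<Rightarrow> ('k, 'a) tensor set" where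
  "rels V R i j = {tmul V s (tmul V r t) | s r t. s \<in> vcar (tpow V i) \<and> r \<in> R \<and> t \<in> vcar (tpow V j)}"

definition qideal ::
  "('k::field, 'a) vspace \<Rightarrow> ('k, 'a) tensor set \<Rightarrow> nat \<Rightarrow> ('k, 'a) tensor set" where
  "qideal V R m = fspan (\<Union>{rels V R i j | i j. i + 2 + j = m})"

definition qalg ::
  "('k::field, 'a) vspace \<Rightarrow> ('k, 'a) tensor set \<Rightarrow> nat \<Rightarrow> ('k, ('k, 'a) tensor set) vspace" where
  "qalg V R m = vquot (tpow V m) (qideal V R m)"

definition qmul :: "('k::field, 'a) vspace \<Rightarrow> ('k, 'a) tensor set \<Rightarrow> nat \<Rightarrow> nat \<Rightarrow>
    ('k, 'a) tensor set \<Rightarrow> ('k, 'a) tensor set \<Rightarrow> ('k, 'a) tensor set" where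
  "qmul V R m n X Y =
    (\<Union>x\<in>X. \<Union>y\<in>Y. vclass (tpow V (m + n)) (qideal V R (m + n)) (tmul V x y))"

text \<open>The image in \<open>A\<^sub>1\<close> of a tensor of weight 1, that is, of an element of \<open>V\<close>.\<close>

definition qgen ::
  "('k::field, 'a) vspace \<Rightarrow> ('k, 'a) tensor set \<Rightarrow> ('k, 'a) tensor \<Rightarrow> ('k, 'a) tensor set" where
  "qgen V R x = vclass (tpow V 1) (qideal V R 1) x"

text \<open>For \<open>p < 2\<close> the intersection is over no condition, so that \<open>W\<^sub>0 = k\<close> and \<open>W\<^sub>1 = V\<close>.\<close>

definition qW ::
  "('k::field, 'a) vspace \<Rightarrow> ('k, 'a) tensor set \<Rightarrow> nat \<Rightarrow> ('k, ('k, 'a) tensor) vspace" where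
  "qW V R p = fsub {w \<in> vcar (tpow V p). \<forall>i j. i + 2 + j = p \<longrightarrow> w \<in> fspan (rels V R i j)}"


section \<open>Koszul cohomology and homology\<close>

text \<open>
  Everything is given by its bihomogeneous components.  As \<open>W\<^sub>p\<close> is finite dimensional,
  \<open>Hom(W\<^sub>p, A)\<close> is the direct sum of the components \<open>Hom(W\<^sub>p, A\<^sub>m)\<close>.
\<close>

definition Kcoch :: "('k::field, 'a) vspace \<Rightarrow> ('k, 'a) tensor set \<Rightarrow> nat \<Rightarrow> nat \<Rightarrow>
    ('k, ('k, 'a) tensor \<Rightarrow> ('k, 'a) tensor set) vspace" where
  "Kcoch V R p m = vhom (qW V R p) (qalg V R m)"

definition bKc :: "('k::field, 'a) vspace \<Rightarrow> ('k, 'a) tensor set \<Rightarrow> nat \<Rightarrow> nat \<Rightarrow>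
    (('k, 'a) tensor \<Rightarrow> ('k, 'a) tensor set) \<Rightarrow> (('k, 'a) tensor \<Rightarrow> ('k, 'a) tensor set)" where
  "bKc V R p m f = (\<lambda>w\<in>vcar (qW V R (p + 1)).
     vadd (qalg V R (m + 1))
      (tsplit V (qW V R p) (qW V R 1) (qalg V R (m + 1)) (\<lambda>u x. qmul V R m 1 (f u) (qgen V R x)) w)
      (vscale (qalg V R (m + 1)) (- ((-1) ^ p))
        (tsplit V (qW V R 1) (qW V R p) (qalg V R (m + 1)) (\<lambda>x u. qmul V R 1 m (qgen V R x) (f u)) w)))"

definition Kcocyc where
  "Kcocyc V R p m = {f \<in> vcar (Kcoch V R p m). bKc V R p m f = vzero (Kcoch V R (p + 1) (m + 1))}"

definition Kcobd where
  "Kcobd V R p m = insert (vzero (Kcoch V R p m))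
     {bKc V R p' m' f | p' m' f. p = p' + 1 \<and> m = m' + 1 \<and> f \<in> vcar (Kcoch V R p' m')}"

text \<open>\<open>HK\<^sup>p(A)\<^sub>m\<close>\<close>

definition HKcoh :: "('k::field, 'a) vspace \<Rightarrow> ('k, 'a) tensor set \<Rightarrow> nat \<Rightarrow> nat \<Rightarrow>
    ('k, (('k, 'a) tensor \<Rightarrow> ('k, 'a) tensor set) set) vspace" where
  "HKcoh V R p m = vquot (vsub (Kcoch V R p m) (Kcocyc V R p m)) (Kcobd V R p m)"

type_synonym ('k, 'a) kchain =
  "(('k, 'a) tensor set \<Rightarrow> ('k, 'a) tensor \<Rightarrow> 'k) \<Rightarrow> 'k"

definition Kch :: "('k::field, 'a) vspace \<Rightarrow> ('k, 'a) tensor set \<Rightarrow> nat \<Rightarrow> nat \<Rightarrow>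
    ('k, ('k, 'a) kchain) vspace" where
  "Kch V R q n = vtens (qalg V R n) (qW V R q)"

definition Kpure :: "('k::field, 'a) vspace \<Rightarrow> ('k, 'a) tensor set \<Rightarrow> nat \<Rightarrow> nat \<Rightarrow>
    ('k, 'a) tensor set \<Rightarrow> ('k, 'a) tensor \<Rightarrow> ('k, 'a) kchain" where
  "Kpure V R q n a w = ptens (qalg V R n) (qW V R q) a w"

text \<open>The linear map on \<open>A\<^sub>n \<otimes> W\<^sub>q\<close> with \<open>a \<otimes> w \<mapsto> \<beta> a w\<close>.\<close>

definition Klift :: "('k::field, 'a) vspace \<Rightarrow> ('k, 'a) tensor set \<Rightarrow> nat \<Rightarrow> nat \<Rightarrow>
    ('k, 'c) vspace \<Rightarrow> (('k, 'a) tensor set \<Rightarrow> ('k, 'a) tensor \<Rightarrow> 'c) \<Rightarrow> ('k, 'a) kchain \<Rightarrow> 'c" where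
  "Klift V R q n Y \<beta> = blift (Kch V R q n) (Kpure V R q n) (qalg V R n) (qW V R q) Y \<beta>"

definition bKh :: "('k::field, 'a) vspace \<Rightarrow> ('k, 'a) tensor set \<Rightarrow> nat \<Rightarrow> nat \<Rightarrow>
    ('k, 'a) kchain \<Rightarrow> ('k, 'a) kchain" where
  "bKh V R q n z =
    (let Y = Kch V R (q - 1) (n + 1) in
     if q = 0 then vzero Y
     else Klift V R q n Y (\<lambda>a w.
       vadd Y
        (tsplit V (qW V R 1) (qW V R (q - 1)) Y
          (\<lambda>x u. Kpure V R (q - 1) (n + 1) (qmul V R n 1 a (qgen V R x)) u) w)
        (vscale Y ((-1) ^ q)
          (tsplit V (qW V R (q - 1)) (qW V R 1) Y
            (\<lambda>u x. Kpure V R (q - 1) (n + 1) (qmul V R 1 n (qgen V R x) a) u) w))) z)"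

definition Kcyc where
  "Kcyc V R q n = {z \<in> vcar (Kch V R q n). bKh V R q n z = vzero (Kch V R (q - 1) (n + 1))}"

definition Kbd where
  "Kbd V R q n = insert (vzero (Kch V R q n))
     {bKh V R (q + 1) n' z | n' z. n = n' + 1 \<and> z \<in> vcar (Kch V R (q + 1) n')}"

text \<open>\<open>HK\<^sub>q(A)\<^sub>n\<close>\<close>

definition HKhom :: "('k::field, 'a) vspace \<Rightarrow> ('k, 'a) tensor set \<Rightarrow> nat \<Rightarrow> nat \<Rightarrow>
    ('k, ('k, 'a) kchain set) vspace" where
  "HKhom V R q n = vquot (vsub (Kch V R q n) (Kcyc V R q n)) (Kbd V R q n)"

text \<open>
  In the actions \<open>f : W\<^sub>p \<rightarrow> A\<^sub>m\<close> and \<open>z \<in> A\<^sub>n \<otimes> W\<^sub>q\<close>; the result has biweight \<open>(q - p, m + n)\<close>.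
\<close>

definition capl :: "('k::field, 'a) vspace \<Rightarrow> ('k, 'a) tensor set \<Rightarrow> nat \<Rightarrow> nat \<Rightarrow> nat \<Rightarrow> nat \<Rightarrow>
    (('k, 'a) tensor \<Rightarrow> ('k, 'a) tensor set) \<Rightarrow> ('k, 'a) kchain \<Rightarrow> ('k, 'a) kchain" where
  "capl V R p m q n f z =
    (let Y = Kch V R (q - p) (m + n) in
     if q < p then vzero Y
     else Klift V R q n Y (\<lambda>a w. vscale Y ((-1) ^ ((q - p) * p))
       (tsplit V (qW V R (q - p)) (qW V R p) Y
         (\<lambda>u v. Kpure V R (q - p) (m + n) (qmul V R m n (f v) a) u) w)) z)"

definition capr :: "('k::field, 'a) vspace \<Rightarrow> ('k, 'a) tensor set \<Rightarrow> nat \<Rightarrow> nat \<Rightarrow> nat \<Rightarrow> nat \<Rightarrow>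
    ('k, 'a) kchain \<Rightarrow> (('k, 'a) tensor \<Rightarrow> ('k, 'a) tensor set) \<Rightarrow> ('k, 'a) kchain" where
  "capr V R p m q n z f =
    (let Y = Kch V R (q - p) (m + n) in
     if q < p then vzero Y
     else Klift V R q n Y (\<lambda>a w. vscale Y ((-1) ^ (p * q))
       (tsplit V (qW V R p) (qW V R (q - p)) Y
         (\<lambda>u v. Kpure V R (q - p) (m + n) (qmul V R n m a (f u)) v) w)) z)"

definition HKcapl where
  "HKcapl V R p m q n \<alpha> \<zeta> =
    (\<Union>f\<in>\<alpha>. \<Union>z\<in>\<zeta>. vclass (Kch V R (q - p) (m + n)) (Kbd V R (q - p) (m + n)) (capl V R p m q n f z))"

definition HKcapr where
  "HKcapr V R p m q n \<zeta> \<alpha> =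
    (\<Union>z\<in>\<zeta>. \<Union>f\<in>\<alpha>. vclass (Kch V R (q - p) (m + n)) (Kbd V R (q - p) (m + n)) (capr V R p m q n z f))"


section \<open>Modified Koszul cohomology with coefficients in a graded bimodule\<close>

text \<open>
  \<open>blmul M n m a u\<close> is \<open>a.u\<close> and \<open>brmul M m n u a\<close> is \<open>u.a\<close> for \<open>a\<close> of weight \<open>n\<close> and \<open>u\<close> of weight
  \<open>m\<close>; both have weight \<open>bwt M m n\<close>, which is \<open>m + n\<close> for the algebra itself and \<open>m - n\<close> for its
  graded dual.
\<close>

record ('k, 'b, 'u) gbimod =
  bcomp :: "nat \<Rightarrow> ('k, 'u) vspace"
  bwt :: "nat \<Rightarrow> nat \<Rightarrow> nat"
  blmul :: "nat \<Rightarrow> nat \<Rightarrow> 'b \<Rightarrow> 'u \<Rightarrow> 'u"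
  brmul :: "nat \<Rightarrow> nat \<Rightarrow> 'u \<Rightarrow> 'b \<Rightarrow> 'u"

definition regular_bimod :: "('k::field, 'a) vspace \<Rightarrow> ('k, 'a) tensor set \<Rightarrow>
    ('k, ('k, 'a) tensor set, ('k, 'a) tensor set) gbimod" where
  "regular_bimod V R =
    \<lparr>bcomp = qalg V R, bwt = (+), blmul = (\<lambda>n m a u. qmul V R n m a u),
     brmul = (\<lambda>m n u a. qmul V R m n u a)\<rparr>"

text \<open>
  For \<open>n > m\<close> the products in the graded dual vanish; then \<open>m - n\<close> is truncated and they
  are the zero of the component of weight 0.
\<close>

definition dual_bimod :: "('k::field, 'a) vspace \<Rightarrow> ('k, 'a) tensor set \<Rightarrow>
    ('k, ('k, 'a) tensor set, ('k, 'a) tensor set \<Rightarrow> 'k) gbimod" where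
  "dual_bimod V R =
    \<lparr>bcomp = (\<lambda>m. vdual (qalg V R m)),
     bwt = (\<lambda>m n. m - n),
     blmul = (\<lambda>n m a u. \<lambda>a'\<in>vcar (qalg V R (m - n)).
       if n \<le> m then (-1) ^ n * u (qmul V R (m - n) n a' a) else 0),
     brmul = (\<lambda>m n u a. \<lambda>a'\<in>vcar (qalg V R (m - n)).
       if n \<le> m then u (qmul V R n (m - n) a a') else 0)\<rparr>"

definition Mcoch :: "('k::field, 'a) vspace \<Rightarrow> ('k, 'a) tensor set \<Rightarrow>
    ('k, ('k, 'a) tensor set, 'u) gbimod \<Rightarrow> nat \<Rightarrow> nat \<Rightarrow> ('k, ('k, 'a) tensor \<Rightarrow> 'u) vspace" where
  "Mcoch V R M p m = vhom (qW V R p) (bcomp M m)"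

definition bKm :: "('k::field, 'a) vspace \<Rightarrow> ('k, 'a) tensor set \<Rightarrow>
    ('k, ('k, 'a) tensor set, 'u) gbimod \<Rightarrow> nat \<Rightarrow> nat \<Rightarrow>
    (('k, 'a) tensor \<Rightarrow> 'u) \<Rightarrow> (('k, 'a) tensor \<Rightarrow> 'u)" where
  "bKm V R M p m f =
    (let Y = bcomp M (bwt M m 1) in
     (\<lambda>w\<in>vcar (qW V R (p + 1)).
       vadd Y
        (tsplit V (qW V R p) (qW V R 1) Y (\<lambda>u x. brmul M m 1 (f u) (qgen V R x)) w)
        (vscale Y (- ((-1) ^ m))
          (tsplit V (qW V R 1) (qW V R p) Y (\<lambda>x u. blmul M 1 m (qgen V R x) (f u)) w))))"

definition Mcocyc where
  "Mcocyc V R M p m = {f \<in> vcar (Mcoch V R M p m).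
     bKm V R M p m f = vzero (Mcoch V R M (p + 1) (bwt M m 1))}"

definition Mcobd where
  "Mcobd V R M p m = insert (vzero (Mcoch V R M p m))
     {bKm V R M p' m' f | p' m' f. p = p' + 1 \<and> m = bwt M m' 1 \<and> f \<in> vcar (Mcoch V R M p' m')}"

text \<open>The part of degree \<open>p\<close> and coefficient weight \<open>m\<close>; it has inverse biweight \<open>(m, p)\<close>.\<close>

definition MHK :: "('k::field, 'a) vspace \<Rightarrow> ('k, 'a) tensor set \<Rightarrow>
    ('k, ('k, 'a) tensor set, 'u) gbimod \<Rightarrow> nat \<Rightarrow> nat \<Rightarrow>
    ('k, (('k, 'a) tensor \<Rightarrow> 'u) set) vspace" where
  "MHK V R M p m = vquot (vsub (Mcoch V R M p m) (Mcocyc V R M p m)) (Mcobd V R M p m)"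

text \<open>
  In the actions \<open>f : W\<^sub>p \<rightarrow> B\<^sub>m\<close> and \<open>g : W\<^sub>q \<rightarrow> M\<^sub>n\<close>.
\<close>

definition mcupl :: "('k::field, 'a) vspace \<Rightarrow> ('k, 'a) tensor set \<Rightarrow>
    ('k, ('k, 'a) tensor set, 'u) gbimod \<Rightarrow> nat \<Rightarrow> nat \<Rightarrow> nat \<Rightarrow> nat \<Rightarrow>
    (('k, 'a) tensor \<Rightarrow> ('k, 'a) tensor set) \<Rightarrow> (('k, 'a) tensor \<Rightarrow> 'u) \<Rightarrow>
    (('k, 'a) tensor \<Rightarrow> 'u)" where
  "mcupl V R M p m q n f g =
    (let Y = bcomp M (bwt M n m) in
     (\<lambda>w\<in>vcar (qW V R (p + q)). vscale Y ((-1) ^ (m * n))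
       (tsplit V (qW V R p) (qW V R q) Y (\<lambda>u v. blmul M m n (f u) (g v)) w)))"

definition mcupr :: "('k::field, 'a) vspace \<Rightarrow> ('k, 'a) tensor set \<Rightarrow>
    ('k, ('k, 'a) tensor set, 'u) gbimod \<Rightarrow> nat \<Rightarrow> nat \<Rightarrow> nat \<Rightarrow> nat \<Rightarrow>
    (('k, 'a) tensor \<Rightarrow> 'u) \<Rightarrow> (('k, 'a) tensor \<Rightarrow> ('k, 'a) tensor set) \<Rightarrow>
    (('k, 'a) tensor \<Rightarrow> 'u)" where
  "mcupr V R M p m q n g f =
    (let Y = bcomp M (bwt M n m) in
     (\<lambda>w\<in>vcar (qW V R (q + p)). vscale Y ((-1) ^ (n * m))
       (tsplit V (qW V R q) (qW V R p) Y (\<lambda>u v. brmul M n m (g u) (f v)) w)))"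

definition MHKcupl where
  "MHKcupl V R M p m q n \<alpha> \<zeta> =
    (\<Union>f\<in>\<alpha>. \<Union>g\<in>\<zeta>. vclass (Mcoch V R M (p + q) (bwt M n m)) (Mcobd V R M (p + q) (bwt M n m))
       (mcupl V R M p m q n f g))"

definition MHKcupr where
  "MHKcupr V R M p m q n \<zeta> \<alpha> =
    (\<Union>g\<in>\<zeta>. \<Union>f\<in>\<alpha>. vclass (Mcoch V R M (q + p) (bwt M n m)) (Mcobd V R M (q + p) (bwt M n m))
       (mcupr V R M p m q n g f))"


section \<open>Koszul dual and the comparison map\<close>

text \<open>
  The pairing of \<open>T(V\<^sup>*)\<close> with \<open>T(V)\<close>, without signs:
  \<open>\<xi>\<^sub>1 \<dots> \<xi>\<^sub>m\<close> and \<open>x\<^sub>1 \<dots> x\<^sub>m\<close> are sent to \<open>\<xi>\<^sub>1(x\<^sub>1) \<dots> \<xi>\<^sub>m(x\<^sub>m)\<close>.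
\<close>

definition tpair :: "('k::field, 'a \<Rightarrow> 'k) tensor \<Rightarrow> ('k, 'a) tensor \<Rightarrow> 'k" where
  "tpair t s = t (\<lambda>\<xi>s. s (\<lambda>xs.
     if length \<xi>s = length xs then prod_list (map2 (\<lambda>\<xi> x. \<xi> x) \<xi>s xs) else 0))"

definition rperp ::
  "('k::field, 'a) vspace \<Rightarrow> ('k, 'a) tensor set \<Rightarrow> ('k, 'a \<Rightarrow> 'k) tensor set" where
  "rperp V R = {t \<in> vcar (tpow (vdual V) 2). \<forall>r\<in>R. tpair t r = 0}"

text \<open>
  Elements \<open>b \<in> A\<^sup>!\<^sub>p\<close> are viewed as forms on \<open>W\<^sub>p\<close> and elements \<open>\<omega> \<in> W\<^sup>!\<^sub>m\<close> as forms on \<open>A\<^sub>m\<close>, in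
  both cases by \<open>tpair\<close> on representatives; the condition says that \<open>b = \<omega> \<circ> f\<close> as forms on \<open>W\<^sub>p\<close>.
\<close>

definition phiA :: "('k::field, 'a) vspace \<Rightarrow> ('k, 'a) tensor set \<Rightarrow> nat \<Rightarrow> nat \<Rightarrow>
    (('k, 'a) tensor \<Rightarrow> ('k, 'a) tensor set) \<Rightarrow>
    (('k, 'a \<Rightarrow> 'k) tensor \<Rightarrow> ('k, 'a \<Rightarrow> 'k) tensor set)" where
  "phiA V R p m f = (\<lambda>\<omega>\<in>vcar (qW (vdual V) (rperp V R) m).
     THE b. b \<in> vcar (qalg (vdual V) (rperp V R) p) \<and>
       (\<forall>w\<in>vcar (qW V R p). \<forall>t\<in>b. \<forall>s\<in>f w. tpair t w = tpair \<omega> s))"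

text \<open>\<open>H(\<phi>\<^sub>A)\<close> on \<open>HK\<^sup>p(A)\<^sub>m\<close>\<close>

definition HphiA where
  "HphiA V R p m \<alpha> =
    (\<Union>f\<in>\<alpha>. vclass
       (Mcoch (vdual V) (rperp V R) (regular_bimod (vdual V) (rperp V R)) m p)
       (Mcobd (vdual V) (rperp V R) (regular_bimod (vdual V) (rperp V R)) m p)
       (phiA V R p m f))"

end

(* The complex computing HK(A) with chain groups A_n (x) W_q is compared with the modified complex
of the Koszul dual by the map theta, theta(a (x) w)(omega)(b) = omega(a) b(w), for omega in W^!_n,
viewed as a form on A_n, and b in A^!_q, viewed as a form on W_q. The pairings of W^!_n with A_n and of
A^!_q with W_q are perfect because the annihilator of V^i R V^j is V*^i R^perp V*^j, which is seen
by contracting with basis tensors on both sides; hence theta is bijective. Splitting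
omega in W^!_{n+1} along W^!_n (x) V* and V* (x) W^!_n, and w in W_q along V (x) W_{q-1} and W_{q-1} (x) V,
theta commutes with the differentials, and in the same way it turns the cap actions of f into
the cup actions of the transpose phi_A(f), with matching signs. That the actions descend to homology follows from
the Leibniz rule, which is proved on the side of the Koszul dual. *)

theory Submission
  imports Defs
begin

section \<open>Vector spaces separated by linear forms\<close>

text \<open>Carriers are arbitrary sets and the bilinear constructions (\<open>blift\<close>,
  \<open>tsplit\<close>, \<open>Klift\<close>) are definite descriptions, so elements can hardly be
  computed with directly. Equations are therefore tested on enough linear forms, and a form applied
  to a split is the explicit finite sum \<open>Lam\<close>. It rests on contracting elements of
  W_(p+q) by words, which gives the inclusion into W_p (x) W_q. As W_q has no chosen basis, a linear
  retraction onto it supplies a spanning family with coefficient forms. The map theta exchanges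
  homological and coefficient weight and needs no sign of its own: the left action on the graded
  dual contributes (-1)^n, which turns the -(-1)^q of the modified differential into the (-1)^q of
  homology, and (-1)^(pq) into (-1)^(pq+p) = (-1)^((q-p)p) for the left cap action. On the dual side
  cochains are functions, so d d = 0 and both Leibniz rules are identities between triple
  splittings; chains inherit them because theta is injective. Negative weights are encoded by
  truncated subtraction as the zero of weight 0.\<close>

interpretation fv: vector_space "fscale :: 'k::field \<Rightarrow> ('i \<Rightarrow> 'k) \<Rightarrow> ('i \<Rightarrow> 'k)"
  by unfold_locales (auto simp: fscale_def fun_eq_iff algebra_simps)

lemma vfield_simps [simp]:
  "vcar vfield = UNIV" "vadd vfield = (+)" "vzero vfield = 0" "vscale vfield = (*)"
  by (simp_all add: vfield_def)

lemma vtype_simps [simp]: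
  "vcar (vtype sc) = UNIV" "vadd (vtype sc) = (+)" "vzero (vtype sc) = 0" "vscale (vtype sc) = sc"
  by (simp_all add: vtype_def)

lemma fsub_simps [simp]:
  "vcar (fsub S) = S" "vadd (fsub S) = (+)" "vzero (fsub S) = 0" "vscale (fsub S) = fscale"
  by (simp_all add: fsub_def)

lemma vsub_simps [simp]:
  "vcar (vsub U S) = S" "vadd (vsub U S) = vadd U" "vzero (vsub U S) = vzero U"
  "vscale (vsub U S) = vscale U" "vclass (vsub U S) = vclass U"
  by (simp_all add: vsub_def vclass_def fun_eq_iff)

lemma vhom_simps [simp]:
  "vzero (vhom U W) = (\<lambda>x\<in>vcar U. vzero W)"
  "vadd (vhom U W) f g = (\<lambda>x\<in>vcar U. vadd W (f x) (g x))"
  "vscale (vhom U W) a f = (\<lambda>x\<in>vcar U. vscale W a (f x))"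
  by (simp_all add: vhom_def)

lemma vcar_vhom: "f \<in> vcar (vhom U W) \<longleftrightarrow> f \<in> vcar U \<rightarrow>\<^sub>E vcar W \<and> vlinear U W f"
  by (simp add: vhom_def)

lemma vhomI:
  assumes "\<And>x. x \<in> vcar U \<Longrightarrow> f x \<in> vcar W" "\<And>x. x \<notin> vcar U \<Longrightarrow> f x = undefined" "vlinear U W f"
  shows "f \<in> vcar (vhom U W)"
  using assms by (auto simp: vcar_vhom PiE_iff extensional_def)

lemma vhom_in: "f \<in> vcar (vhom U W) \<Longrightarrow> x \<in> vcar U \<Longrightarrow> f x \<in> vcar W"
  by (auto simp: vcar_vhom)

lemma vhom_ext:
  assumes "f \<in> vcar (vhom U W)" "g \<in> vcar (vhom U W)" "\<And>x. x \<in> vcar U \<Longrightarrow> f x = g x"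
  shows "f = g"
  using assms by (auto simp: vcar_vhom intro: PiE_ext)

lemma vhom_add: "f \<in> vcar (vhom U W) \<Longrightarrow> x \<in> vcar U \<Longrightarrow> y \<in> vcar U \<Longrightarrow>
    f (vadd U x y) = vadd W (f x) (f y)"
  by (auto simp: vcar_vhom vlinear_def)

lemma vhom_scale: "f \<in> vcar (vhom U W) \<Longrightarrow> x \<in> vcar U \<Longrightarrow> f (vscale U a x) = vscale W a (f x)"
  by (auto simp: vcar_vhom vlinear_def)

lemma vlinear_formI:
  assumes "\<And>x y. x \<in> vcar U \<Longrightarrow> y \<in> vcar U \<Longrightarrow> l (vadd U x y) = l x + l y"
    and "\<And>a x. x \<in> vcar U \<Longrightarrow> l (vscale U a x) = a * l x"
  shows "vlinear U vfield l"
  using assms by (simp add: vlinear_def)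

lemma vform_add: "vlinear U vfield l \<Longrightarrow> x \<in> vcar U \<Longrightarrow> y \<in> vcar U \<Longrightarrow> l (vadd U x y) = l x + l y"
  and vform_scale: "vlinear U vfield l \<Longrightarrow> x \<in> vcar U \<Longrightarrow> l (vscale U a x) = a * l x"
  by (simp_all add: vlinear_def)

lemma vform_comb:
  assumes "\<And>i. i \<in> A \<Longrightarrow> vlinear U vfield (l i)"
  shows "vlinear U vfield (\<lambda>x. \<Sum>i\<in>A. k i * l i x)"
  using assms by (intro vlinear_formI)
    (auto simp: vform_add vform_scale sum_distrib_left algebra_simps simp flip: sum.distrib intro!: sum.cong)

lemma vform_scaled: "vlinear U vfield l \<Longrightarrow> vlinear U vfield (\<lambda>x. a * l x)"
  by (intro vlinear_formI) (auto simp: vform_add vform_scale algebra_simps)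

lemma vform_scaled': "vlinear U vfield l \<Longrightarrow> vlinear U vfield (\<lambda>x. l x * a)"
  by (intro vlinear_formI) (auto simp: vform_add vform_scale algebra_simps)

lemma vform_plus: "vlinear U vfield l \<Longrightarrow> vlinear U vfield l' \<Longrightarrow> vlinear U vfield (\<lambda>x. l x + l' x)"
  by (intro vlinear_formI) (auto simp: vform_add vform_scale algebra_simps)

text \<open>\<open>vlinear\<close> inspects a function only on the carrier, but also at sums and
  multiples, hence the closure assumptions. This is how a formula valid on the carrier is exchanged
  for a restricted function.\<close>

lemma vform_cong:
  assumes "vlinear U vfield l" "\<And>x. x \<in> vcar U \<Longrightarrow> l x = l' x"
    "\<And>x y. x \<in> vcar U \<Longrightarrow> y \<in> vcar U \<Longrightarrow> vadd U x y \<in> vcar U"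
    "\<And>a x. x \<in> vcar U \<Longrightarrow> vscale U a x \<in> vcar U"
  shows "vlinear U vfield l'"
  using assms by (auto simp: vlinear_def)

text \<open>The last clause implies all vector space axioms, since they hold after applying any linear form.\<close>

definition vsp :: "('k::field, 'a) vspace \<Rightarrow> bool" where
  "vsp U \<longleftrightarrow> vzero U \<in> vcar U \<and> vadd U (vzero U) (vzero U) = vzero U \<and>
    (\<forall>x\<in>vcar U. \<forall>y\<in>vcar U. vadd U x y \<in> vcar U) \<and>
    (\<forall>a. \<forall>x\<in>vcar U. vscale U a x \<in> vcar U) \<and>
    (\<forall>x\<in>vcar U. \<forall>y\<in>vcar U. (\<forall>l. vlinear U vfield l \<longrightarrow> l x = l y) \<longrightarrow> x = y)"

lemma vspI:
  assumes "vzero U \<in> vcar U" "vadd U (vzero U) (vzero U) = vzero U"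
    "\<And>x y. x \<in> vcar U \<Longrightarrow> y \<in> vcar U \<Longrightarrow> vadd U x y \<in> vcar U"
    "\<And>a x. x \<in> vcar U \<Longrightarrow> vscale U a x \<in> vcar U"
    "\<And>x y. x \<in> vcar U \<Longrightarrow> y \<in> vcar U \<Longrightarrow> (\<And>l. vlinear U vfield l \<Longrightarrow> l x = l y) \<Longrightarrow> x = y"
  shows "vsp U"
  using assms unfolding vsp_def by blast

lemma vsp_zero [simp]: "vsp U \<Longrightarrow> vzero U \<in> vcar U"
  and vsp_add [simp]: "vsp U \<Longrightarrow> x \<in> vcar U \<Longrightarrow> y \<in> vcar U \<Longrightarrow> vadd U x y \<in> vcar U"
  and vsp_scale [simp]: "vsp U \<Longrightarrow> x \<in> vcar U \<Longrightarrow> vscale U a x \<in> vcar U"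
  by (auto simp: vsp_def)

lemma vsp_eqI:
  "vsp U \<Longrightarrow> x \<in> vcar U \<Longrightarrow> y \<in> vcar U \<Longrightarrow> (\<And>l. vlinear U vfield l \<Longrightarrow> l x = l y) \<Longrightarrow> x = y"
  unfolding vsp_def by (elim conjE) simp

text \<open>The idempotence of zero in \<open>vsp\<close> is there for this: it gives
  \<open>l 0 = l 0 + l 0\<close>.\<close>

lemma vform_zero: "vsp U \<Longrightarrow> vlinear U vfield l \<Longrightarrow> l (vzero U) = 0"
  using vform_add[of U l "vzero U" "vzero U"] unfolding vsp_def
  by (metis add_cancel_left_left)

lemma vsp_zero_add: "vsp U \<Longrightarrow> x \<in> vcar U \<Longrightarrow> vadd U (vzero U) x = x"
  and vsp_add_zero: "vsp U \<Longrightarrow> x \<in> vcar U \<Longrightarrow> vadd U x (vzero U) = x"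
  and vsp_scale_zero: "vsp U \<Longrightarrow> vscale U a (vzero U) = vzero U"
  and vsp_scale_0: "vsp U \<Longrightarrow> x \<in> vcar U \<Longrightarrow> vscale U 0 x = vzero U"
  subgoal by (rule vsp_eqI) (auto simp: vform_add vform_zero)
  subgoal by (rule vsp_eqI) (auto simp: vform_add vform_zero)
  subgoal by (rule vsp_eqI) (auto simp: vform_scale vform_zero)
  subgoal by (rule vsp_eqI) (auto simp: vform_scale vform_zero)
  done

lemma vsp_assoc: "vsp U \<Longrightarrow> x \<in> vcar U \<Longrightarrow> y \<in> vcar U \<Longrightarrow> z \<in> vcar U \<Longrightarrow>
    vadd U (vadd U x y) z = vadd U x (vadd U y z)"
  and vsp_scale_add: "vsp U \<Longrightarrow> x \<in> vcar U \<Longrightarrow> y \<in> vcar U \<Longrightarrow>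
    vscale U a (vadd U x y) = vadd U (vscale U a x) (vscale U a y)"
  subgoal by (rule vsp_eqI) (auto simp: vform_add)
  subgoal by (rule vsp_eqI) (auto simp: vform_add vform_scale algebra_simps)
  done

text \<open>\<open>vlinear\<close> does not mention zero; it is reached as the multiple by the
  scalar 0.\<close>

lemma vhom_zero:
  assumes "vsp U" "vsp W" "f \<in> vcar (vhom U W)"
  shows "f (vzero U) = vzero W"
proof -
  have "f (vscale U 0 (vzero U)) = vscale W 0 (f (vzero U))"
    using assms by (simp add: vhom_scale)
  then show ?thesis
    using assms by (simp add: vsp_scale_0 vhom_in)
qed

lemma vform_vhom: "vlinear W vfield l \<Longrightarrow> f \<in> vcar (vhom U W) \<Longrightarrow> vlinear U vfield (\<lambda>x. l (f x))"
  by (intro vlinear_formI) (auto simp: vform_add vform_scale vhom_add vhom_scale vhom_in)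

text \<open>The evaluations at the indices are linear forms, and they separate functions.\<close>

lemma vsp_fsub:
  assumes "fv.subspace S"
  shows "vsp (fsub S)"
proof (rule vspI)
  fix x y assume "\<And>l. vlinear (fsub S) vfield l \<Longrightarrow> l x = l y"
  then have "x i = y i" for i
    by (elim meta_allE[where x = "\<lambda>x. x i"]) (auto simp: vlinear_def fscale_def)
  then show "x = y" by auto
qed (use assms in \<open>auto simp: fv.subspace_def\<close>)

text \<open>Maps are separated by the forms \<open>\<lambda>h. l (h x)\<close> with \<open>l\<close>
  a form on the target, so separation passes from the target to the space of maps.\<close>

lemma vsp_vhom:
  assumes U: "vsp U" and W: "vsp W"
  shows "vsp (vhom U W)"
proof (rule vspI)
  show "vzero (vhom U W) \<in> vcar (vhom U W)"
    using U W by (intro vhomI) (auto simp: vlinear_def vsp_zero_add vsp_scale_zero)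
  show "vadd (vhom U W) (vzero (vhom U W)) (vzero (vhom U W)) = vzero (vhom U W)"
    using W by (auto simp: vsp_zero_add)
  fix f g assume f: "f \<in> vcar (vhom U W)" and g: "g \<in> vcar (vhom U W)"
  have "vlinear U W (\<lambda>x\<in>vcar U. vadd W (f x) (g x))"
    unfolding vlinear_def using U W f g
    by (auto simp: vhom_add vhom_scale vhom_in vsp_scale_add intro!: vsp_eqI[OF W])
       (auto simp: vform_add vhom_in)
  then show "vadd (vhom U W) f g \<in> vcar (vhom U W)"
    using f g W by (intro vhomI) (auto simp: vhom_in)
  assume eq: "\<And>l. vlinear (vhom U W) vfield l \<Longrightarrow> l f = l g"
  show "f = g"
  proof (rule vhom_ext[OF f g])
    fix x assume x: "x \<in> vcar U"
    show "f x = g x"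
    proof (rule vsp_eqI[OF W])
      fix l :: "_ \<Rightarrow> 'a" assume "vlinear W vfield l"
      then show "l (f x) = l (g x)"
        using x by (intro eq[of "\<lambda>h. l (h x)"] vlinear_formI) (auto simp: vhom_in vform_add vform_scale)
    qed (use f g x in \<open>auto simp: vhom_in\<close>)
  qed
next
  fix a f assume f: "f \<in> vcar (vhom U W)"
  have "vlinear U W (\<lambda>x\<in>vcar U. vscale W a (f x))"
    unfolding vlinear_def using U W f
    by (auto simp: vhom_add vhom_scale vhom_in vsp_scale_add intro!: vsp_eqI[OF W])
       (auto simp: vform_scale vhom_in)
  then show "vscale (vhom U W) a f \<in> vcar (vhom U W)"
    using f W by (intro vhomI) (auto simp: vhom_in)
qed

lemma vsp_vfield: "vsp (vfield :: ('k::field, 'k) vspace)"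
proof (rule vspI)
  fix x y :: 'k assume "\<And>l. vlinear vfield vfield l \<Longrightarrow> l x = (l y :: 'k)"
  from this[of "\<lambda>x. x"] show "x = y" by (simp add: vlinear_def)
qed auto

lemma vsp_vdual: "vsp U \<Longrightarrow> vsp (vdual U)"
  by (simp add: vdual_def vsp_vhom vsp_vfield)

lemma vcar_vdual: "f \<in> vcar (vdual U) \<longleftrightarrow> f \<in> extensional (vcar U) \<and> vlinear U vfield f"
  by (auto simp: vdual_def vcar_vhom PiE_iff)

lemma vdual_eval: "x \<in> vcar U \<Longrightarrow> vlinear (vdual U) vfield (\<lambda>f. f x)"
  by (simp add: vdual_def vlinear_def)

lemma vdual_ext:
  assumes "f \<in> vcar (vdual U)" "g \<in> vcar (vdual U)" "\<And>x. x \<in> vcar U \<Longrightarrow> f x = g x"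
  shows "f = g"
  using assms unfolding vdual_def by (rule vhom_ext)

text \<open>The step may assume that the tail lies in the span. This matters because the functions
  treated by this rule are additive only there.\<close>

lemma fspan_induct:
  assumes x: "x \<in> fspan G" and 0: "P 0"
    and step: "\<And>a x y. x \<in> G \<Longrightarrow> y \<in> fspan G \<Longrightarrow> P y \<Longrightarrow> P (fscale a x + y)"
  shows "P x"
proof -
  have "x \<in> fspan G \<and> P x"
  proof (rule fv.span_induct_alt[of x G "\<lambda>x. x \<in> fspan G \<and> P x"])
    show "x \<in> fv.span G" using x by (simp add: fspan_def)
    fix a x y assume "x \<in> G" "y \<in> fspan G \<and> P y"
    then show "fscale a x + y \<in> fspan G \<and> P (fscale a x + y)"
      using step unfolding fspan_def by (simp add: fv.span_add fv.span_scale fv.span_base)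
  qed (use 0 in \<open>simp add: fspan_def fv.span_zero\<close>)
  then show ?thesis by simp
qed

lemma fspan_base: "x \<in> G \<Longrightarrow> x \<in> fspan G"
  and subspace_fspan [simp]: "fv.subspace (fspan G)"
  and fspan_minimal: "G \<subseteq> S \<Longrightarrow> fv.subspace S \<Longrightarrow> fspan G \<subseteq> S"
  by (simp_all add: fspan_def fv.span_base fv.span_minimal)

text \<open>All later expansions in words pass through a form by this rule. For an infinite index
  set both sums are 0.\<close>

lemma vform_fsub_sum:
  assumes S: "fv.subspace S" and l: "vlinear (fsub S) vfield l"
    and x: "\<And>i. i \<in> A \<Longrightarrow> x i \<in> S"
  shows "l (\<Sum>i\<in>A. fscale (k i) (x i)) = (\<Sum>i\<in>A. k i * l (x i))"
proof -
  have l0: "l 0 = 0" using vform_zero[OF vsp_fsub[OF S] l] by simp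
  have sum: "l (sum y B) = (\<Sum>i\<in>B. l (y i))" if "finite B" "\<And>i. i \<in> B \<Longrightarrow> y i \<in> S" for y B
    using that
  proof (induction B)
    case (insert j B)
    have "sum y B \<in> S" using insert by (intro fv.subspace_sum[OF S]) auto
    moreover have "sum y (insert j B) = y j + sum y B" using insert.hyps by (rule sum.insert)
    ultimately have "l (sum y (insert j B)) = (\<Sum>i\<in>insert j B. l (y i))"
      using insert vform_add[OF l, of "y j" "sum y B"] by simp
    then show ?case .
  qed (simp only: l0 sum.empty)
  show ?thesis
    using sum[of A "\<lambda>i. fscale (k i) (x i)"] x S vform_scale[OF l]
    by (cases "finite A") (auto simp: l0 fv.subspace_def)
qed

lemma vform_span_eq:
  assumes "\<And>g. g \<in> G \<Longrightarrow> l g = l' g" "vlinear (fsub (fspan G)) vfield l"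
    "vlinear (fsub (fspan G)) vfield l'" "x \<in> fspan G"
  shows "l x = l' x"
  using assms(4)
proof (rule fspan_induct)
  show "l 0 = l' 0"
    using assms vform_zero[OF vsp_fsub[OF subspace_fspan]] by (metis fsub_simps(3))
  fix a x y assume *: "x \<in> G" "y \<in> fspan G" "l y = l' y"
  then have "fscale a x \<in> fspan G" "x \<in> fspan G"
    by (auto simp: fspan_base fv.subspace_scale)
  with * assms show "l (fscale a x + y) = l' (fscale a x + y)"
    by (auto simp: vlinear_def)
qed

text \<open>The description \<open>blift\<close> denotes something only once the linear map is known
  to exist. \<open>L l\<close> is a formula, given in advance, for the composite of \<open>l\<close>
  with the wanted map. As \<open>D\<close> is spanned by the elements \<open>p u w\<close>, some
  element of \<open>Y\<close> has the values \<open>L l x\<close> for all \<open>l\<close>;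
  separation by forms makes it unique and its dependence on \<open>x\<close> linear.\<close>

lemma blift_form:
  fixes Y :: "('k::field, 'c) vspace" and p :: "'a \<Rightarrow> 'b \<Rightarrow> 'i \<Rightarrow> 'k"
  defines "G \<equiv> \<lambda>U W. {p u w | u w. u \<in> vcar U \<and> w \<in> vcar W}"
  assumes Y: "vsp Y" and D: "D = fsub (fspan (G U W))"
    and b: "\<And>u w. u \<in> vcar U \<Longrightarrow> w \<in> vcar W \<Longrightarrow> \<beta> u w \<in> vcar Y"
    and L: "\<And>l. vlinear Y vfield l \<Longrightarrow> vlinear D vfield (L l)"
    and Lp: "\<And>l u w. vlinear Y vfield l \<Longrightarrow> u \<in> vcar U \<Longrightarrow> w \<in> vcar W \<Longrightarrow> L l (p u w) = l (\<beta> u w)"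
  shows "blift D p U W Y \<beta> \<in> vcar (vhom D Y)"
    and "\<And>u w. u \<in> vcar U \<Longrightarrow> w \<in> vcar W \<Longrightarrow> blift D p U W Y \<beta> (p u w) = \<beta> u w"
    and "\<And>l x. vlinear Y vfield l \<Longrightarrow> x \<in> vcar D \<Longrightarrow> l (blift D p U W Y \<beta> x) = L l x"
proof -
  have D': "vsp D" unfolding D fspan_def by (intro vsp_fsub fv.subspace_span)
  have cD: "vcar D = fspan (G U W)" and aD: "vadd D = (+)" and sD: "vscale D = fscale" and zD: "vzero D = 0"
    by (simp_all add: D)
  have ex: "\<exists>y\<in>vcar Y. \<forall>l. vlinear Y vfield l \<longrightarrow> l y = L l x" if "x \<in> vcar D" for x
    using that unfolding cD
  proof (rule fspan_induct)
    have "L l 0 = 0" if "vlinear Y vfield l" for l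
      using vform_zero[OF D' L[OF that]] by (simp add: zD)
    then show "\<exists>y\<in>vcar Y. \<forall>l. vlinear Y vfield l \<longrightarrow> l y = L l 0"
      using vform_zero[OF Y] Y by (metis vsp_zero)
  next
    fix a x z
    assume step: "x \<in> G U W" "z \<in> fspan (G U W)" "\<exists>y\<in>vcar Y. \<forall>l. vlinear Y vfield l \<longrightarrow> l y = L l z"
    then obtain u w where uw: "u \<in> vcar U" "w \<in> vcar W" "x = p u w" by (auto simp: G_def)
    from step obtain y where y: "y \<in> vcar Y" "\<And>l. vlinear Y vfield l \<Longrightarrow> l y = L l z" by blast
    have x: "x \<in> vcar D" and z: "z \<in> vcar D" using step by (simp_all add: cD fspan_base)
    have "vlinear Y vfield l \<Longrightarrow> l (vadd Y (vscale Y a (\<beta> u w)) y) = L l (fscale a x + z)" for l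
      using vform_add[OF L, of l "fscale a x" z] vform_scale[OF L, of l x a] x z Y D' y b[of u w] uw
        vsp_scale[OF D' x, of a]
      by (simp add: aD sD vform_add vform_scale Lp)
    moreover have "vadd Y (vscale Y a (\<beta> u w)) y \<in> vcar Y" using Y uw b y by simp
    ultimately show "\<exists>y\<in>vcar Y. \<forall>l. vlinear Y vfield l \<longrightarrow> l y = L l (fscale a x + z)" by blast
  qed
  \<comment> \<open>The choice is harmless: the values of all forms determine the element of
    \<open>Y\<close>.\<close>
  define h where "h = (\<lambda>x\<in>vcar D. SOME y. y \<in> vcar Y \<and> (\<forall>l. vlinear Y vfield l \<longrightarrow> l y = L l x))"
  have "h x \<in> vcar Y \<and> (\<forall>l. vlinear Y vfield l \<longrightarrow> l (h x) = L l x)" if "x \<in> vcar D" for x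
    unfolding h_def restrict_apply'[OF that] using someI_ex[OF ex[OF that, unfolded Bex_def]] .
  then have h: "h x \<in> vcar Y" "\<And>l. vlinear Y vfield l \<Longrightarrow> l (h x) = L l x" if "x \<in> vcar D" for x
    using that by simp_all
  have hom: "h \<in> vcar (vhom D Y)"
  proof (rule vhomI)
    show "vlinear D Y h" unfolding vlinear_def
      using D' Y L by (auto intro!: vsp_eqI[OF Y] simp: h vform_add vform_scale)
  qed (auto simp: h, simp add: h_def)
  have hp: "h (p u w) = \<beta> u w" if "u \<in> vcar U" "w \<in> vcar W" for u w
  proof -
    have "p u w \<in> vcar D" using that by (auto simp: cD fspan_def G_def intro!: fv.span_base)
    then show ?thesis using that by (intro vsp_eqI[OF Y]) (auto simp: h b Lp)
  qed
  have "blift D p U W Y \<beta> = h" unfolding blift_def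
  proof (rule the_equality)
    fix g assume g: "g \<in> vcar (vhom D Y) \<and> (\<forall>u\<in>vcar U. \<forall>w\<in>vcar W. g (p u w) = \<beta> u w)"
    show "g = h"
    proof (rule vhom_ext[OF conjunct1[OF g] hom])
      fix x assume x: "x \<in> vcar D"
      show "g x = h x"
      proof (rule vsp_eqI[OF Y])
        fix l :: "'c \<Rightarrow> 'k" assume l: "vlinear Y vfield l"
        show "l (g x) = l (h x)"
          by (rule vform_span_eq[where G = "G U W" and l = "\<lambda>x. l (g x)" and l' = "\<lambda>x. l (h x)"])
             (use g hp x hom vform_vhom[OF l] in \<open>auto simp: D G_def\<close>)
      qed (use g x hom in \<open>auto simp: vhom_in\<close>)
    qed
  qed (use hom hp in blast)
  with hom hp h show "blift D p U W Y \<beta> \<in> vcar (vhom D Y)"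
    "\<And>u w. u \<in> vcar U \<Longrightarrow> w \<in> vcar W \<Longrightarrow> blift D p U W Y \<beta> (p u w) = \<beta> u w"
    "\<And>l x. vlinear Y vfield l \<Longrightarrow> x \<in> vcar D \<Longrightarrow> l (blift D p U W Y \<beta> x) = L l x"
    by simp_all
qed

section \<open>Subspaces, cosets and isomorphisms of subquotients\<close>

definition vsubsp :: "('k::field, 'a) vspace \<Rightarrow> 'a set \<Rightarrow> bool" where
  "vsubsp U N \<longleftrightarrow> N \<subseteq> vcar U \<and> vzero U \<in> N \<and> (\<forall>x\<in>N. \<forall>y\<in>N. vadd U x y \<in> N) \<and>
    (\<forall>a. \<forall>x\<in>N. vscale U a x \<in> N)"

lemma vclass_self: "vsp U \<Longrightarrow> vsubsp U N \<Longrightarrow> x \<in> vcar U \<Longrightarrow> x \<in> vclass U N x"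
  unfolding vclass_def vsubsp_def by (metis imageI vsp_add_zero)

lemma vclass_sub: "vsp U \<Longrightarrow> vsubsp U N \<Longrightarrow> x \<in> vcar U \<Longrightarrow> vclass U N x \<subseteq> vcar U"
  by (auto simp: vclass_def vsubsp_def)

lemma vclass_add:
  assumes U: "vsp U" and N: "vsubsp U N" and x: "x \<in> vcar U" and n: "n \<in> N"
  shows "vclass U N (vadd U x n) = vclass U N x"
proof -
  have N': "\<And>m. m \<in> N \<Longrightarrow> m \<in> vcar U" using N by (auto simp: vsubsp_def)
  have 1: "vadd U (vadd U x n) m = vadd U x (vadd U n m)" if "m \<in> N" for m
    using U x n that N' by (simp add: vsp_assoc)
  \<comment> \<open>The records have no subtraction, so \<open>vscale U (- 1) n\<close> takes the
    place of the negative.\<close>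
  have 2: "vadd U x m = vadd U (vadd U x n) (vadd U m (vscale U (- 1) n))" if "m \<in> N" for m
    using U x n that N' by (intro vsp_eqI[OF U]) (auto simp: vform_add vform_scale)
  have 3: "vadd U n m \<in> N" "vadd U m (vscale U (- 1) n) \<in> N" if "m \<in> N" for m
    using N n that by (auto simp: vsubsp_def)
  show ?thesis unfolding vclass_def using 1 2 3 by (fastforce simp: image_iff)
qed

lemma vclassE:
  assumes "y \<in> vclass U N x"
  obtains n where "n \<in> N" "y = vadd U x n"
  using assms by (auto simp: vclass_def)

text \<open>The operations of \<open>vquot\<close> are unions over all representatives. Cosets are
  nonempty and every pair of representatives yields the same coset, so the union is that
  coset.\<close>

lemma vquot_ops:
  assumes U: "vsp U" and N: "vsubsp U N"
  shows "vcar (vquot U N) = vclass U N ` vcar U"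
    and "vzero (vquot U N) = vclass U N (vzero U)"
    and "x \<in> vcar U \<Longrightarrow> y \<in> vcar U \<Longrightarrow>
      vadd (vquot U N) (vclass U N x) (vclass U N y) = vclass U N (vadd U x y)"
    and "x \<in> vcar U \<Longrightarrow> vscale (vquot U N) a (vclass U N x) = vclass U N (vscale U a x)"
proof -
  show "vcar (vquot U N) = vclass U N ` vcar U" "vzero (vquot U N) = vclass U N (vzero U)"
    by (simp_all add: vquot_def)
  have N': "\<And>m. m \<in> N \<Longrightarrow> m \<in> vcar U" using N by (auto simp: vsubsp_def)
  have ne: "z \<in> vcar U \<Longrightarrow> vclass U N z \<noteq> {}" for z using vclass_self[OF U N] by auto
  { assume x: "x \<in> vcar U" and y: "y \<in> vcar U"
    have "vclass U N (vadd U x' y') = vclass U N (vadd U x y)"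
      if "x' \<in> vclass U N x" "y' \<in> vclass U N y" for x' y'
    proof -
      from that obtain m n where m: "m \<in> N" "x' = vadd U x m" and n: "n \<in> N" "y' = vadd U y n"
        by (auto elim!: vclassE)
      have "vadd U x' y' = vadd U (vadd U x y) (vadd U m n)"
        using m n x y N' U by (intro vsp_eqI[OF U]) (auto simp: vform_add)
      then show ?thesis using m n N x y U by (auto simp: vsubsp_def intro!: vclass_add[OF U N])
    qed
    then show "vadd (vquot U N) (vclass U N x) (vclass U N y) = vclass U N (vadd U x y)"
      using ne[OF x] ne[OF y] by (simp add: vquot_def) }
  { assume x: "x \<in> vcar U"
    have "vclass U N (vscale U a x') = vclass U N (vscale U a x)" if "x' \<in> vclass U N x" for x'
    proof -
      from that obtain m where m: "m \<in> N" "x' = vadd U x m" by (auto elim!: vclassE)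
      have "vscale U a x' = vadd U (vscale U a x) (vscale U a m)"
        using m x N' U by (simp add: vsp_scale_add)
      then show ?thesis using m N x U by (auto simp: vsubsp_def intro!: vclass_add[OF U N])
    qed
    then show "vscale (vquot U N) a (vclass U N x) = vclass U N (vscale U a x)"
      using ne[OF x] by (simp add: vquot_def) }
qed

lemma vsp_vsub: "vsp U \<Longrightarrow> vsubsp U Z \<Longrightarrow> vsp (vsub U Z)"
proof (rule vspI)
  fix x y assume U: "vsp U" and Z: "vsubsp U Z" and x: "x \<in> vcar (vsub U Z)" and y: "y \<in> vcar (vsub U Z)"
    and eq: "\<And>l. vlinear (vsub U Z) vfield l \<Longrightarrow> l x = l y"
  show "x = y"
  proof (rule vsp_eqI[OF U])
    fix l :: "_ \<Rightarrow> 'a" assume "vlinear U vfield l"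
    with Z show "l x = l y" by (intro eq) (auto simp: vform_add vform_scale vsubsp_def subset_iff intro!: vlinear_formI)
  qed (use x y Z in \<open>auto simp: vsubsp_def\<close>)
qed (auto simp: vsubsp_def vsp_zero_add)

text \<open>Cosets are sets of elements, so the induced map on Z/N is the direct image under
  \<open>t\<close>. Injectivity of \<open>t\<close> on all of \<open>U\<close>, not only on
  \<open>Z\<close>, lets a coset be recovered from its image.\<close>

lemma vquot_viso:
  assumes U: "vsp U" and W: "vsp W" and Z: "vsubsp U Z" and N: "vsubsp U N" "N \<subseteq> Z"
    and Z': "vsubsp W Z'" and N': "vsubsp W N'" "N' \<subseteq> Z'"
    and t: "t \<in> vcar (vhom U W)" "inj_on t (vcar U)" "t ` Z = Z'" "t ` N = N'"
  shows "(\<lambda>X\<in>vcar (vquot (vsub U Z) N). t ` X) \<in> viso (vquot (vsub U Z) N) (vquot (vsub W Z') N')"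
    and "\<And>x. x \<in> vcar U \<Longrightarrow> t ` vclass U N x = vclass W N' (t x)"
proof -
  have UZ: "vsp (vsub U Z)" "vsubsp (vsub U Z) N" and WZ: "vsp (vsub W Z')" "vsubsp (vsub W Z') N'"
    using U W Z Z' N N' by (auto simp: vsp_vsub) (auto simp: vsubsp_def)
  note q = vquot_ops[OF UZ, simplified] vquot_ops[OF WZ, simplified]
  have cl: "t ` vclass U N x = vclass W N' (t x)" if "x \<in> vcar U" for x
  proof -
    have "t ` vclass U N x = (\<lambda>n. t (vadd U x n)) ` N" by (simp add: vclass_def image_image)
    also have "\<dots> = (\<lambda>n. vadd W (t x) (t n)) ` N"
      using that N(1) vhom_add[OF t(1)] by (auto simp: vsubsp_def intro!: image_cong)
    also have "\<dots> = vclass W N' (t x)" by (simp add: vclass_def image_image flip: t(4))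
    finally show ?thesis .
  qed
  then show "\<And>x. x \<in> vcar U \<Longrightarrow> t ` vclass U N x = vclass W N' (t x)" .
  have ZU: "\<And>x. x \<in> Z \<Longrightarrow> x \<in> vcar U" using Z by (auto simp: vsubsp_def)
  have Zc: "vadd U x y \<in> Z" "vscale U a x \<in> Z" if "x \<in> Z" "y \<in> Z" for x y a
    using Z that by (auto simp: vsubsp_def)
  have tZ: "t x \<in> Z'" if "x \<in> Z" for x using that t(3) by auto
  let ?h = "\<lambda>X\<in>vcar (vquot (vsub U Z) N). t ` X"
  have hc: "?h (vclass U N x) = vclass W N' (t x)" if "x \<in> Z" for x
    using that by (simp add: q cl ZU)
  have sub: "vclass U N x \<subseteq> vcar U" if "x \<in> Z" for x
    using that vclass_sub[OF U N(1)] ZU by blast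
  have "?h \<in> vcar (vhom (vquot (vsub U Z) N) (vquot (vsub W Z') N'))"
  proof (rule vhomI)
    show "vlinear (vquot (vsub U Z) N) (vquot (vsub W Z') N') ?h"
      unfolding vlinear_def
    proof (intro conjI ballI allI)
      fix X Y assume "X \<in> vcar (vquot (vsub U Z) N)" "Y \<in> vcar (vquot (vsub U Z) N)"
      then obtain x y where xy: "x \<in> Z" "X = vclass U N x" "y \<in> Z" "Y = vclass U N y" by (auto simp: q)
      have "?h (vadd (vquot (vsub U Z) N) X Y) = ?h (vclass U N (vadd U x y))"
        using xy by (simp add: q)
      also have "\<dots> = vclass W N' (vadd W (t x) (t y))"
        using xy Zc by (subst hc) (auto simp: vhom_add[OF t(1)] ZU)
      also have "\<dots> = vadd (vquot (vsub W Z') N') (?h X) (?h Y)"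
        unfolding xy hc[OF xy(1)] hc[OF xy(3)] using xy tZ by (simp add: q)
      finally show "?h (vadd (vquot (vsub U Z) N) X Y) = vadd (vquot (vsub W Z') N') (?h X) (?h Y)" .
    next
      fix a X assume "X \<in> vcar (vquot (vsub U Z) N)"
      then obtain x where xy: "x \<in> Z" "X = vclass U N x" by (auto simp: q)
      have "?h (vscale (vquot (vsub U Z) N) a X) = ?h (vclass U N (vscale U a x))"
        using xy by (simp add: q)
      also have "\<dots> = vclass W N' (vscale W a (t x))"
        using xy Zc by (subst hc) (auto simp: vhom_scale[OF t(1)] ZU)
      also have "\<dots> = vscale (vquot (vsub W Z') N') a (?h X)"
        unfolding xy hc[OF xy(1)] using xy tZ by (simp add: q)
      finally show "?h (vscale (vquot (vsub U Z) N) a X) = vscale (vquot (vsub W Z') N') a (?h X)" .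
    qed
  next
    fix X assume "X \<in> vcar (vquot (vsub U Z) N)"
    then obtain x where x: "x \<in> Z" "X = vclass U N x" by (auto simp: q)
    show "?h X \<in> vcar (vquot (vsub W Z') N')"
      unfolding x(2) hc[OF x(1)] using x tZ by (auto simp: q)
  qed auto
  moreover have "inj_on ?h (vcar (vquot (vsub U Z) N))"
  proof (rule inj_onI)
    fix X Y assume XY: "X \<in> vcar (vquot (vsub U Z) N)" "Y \<in> vcar (vquot (vsub U Z) N)" "?h X = ?h Y"
    then have "X \<subseteq> vcar U" "Y \<subseteq> vcar U" using sub by (auto simp: q)
    with XY t(2) show "X = Y" by (simp add: inj_on_image_eq_iff)
  qed
  moreover have "?h ` vcar (vquot (vsub U Z) N) = vcar (vquot (vsub W Z') N')"
  proof -
    have "?h ` vcar (vquot (vsub U Z) N) = (\<lambda>x. ?h (vclass U N x)) ` Z"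
      unfolding q(1) image_image ..
    also have "\<dots> = (\<lambda>x. vclass W N' (t x)) ` Z" by (intro image_cong refl hc)
    also have "\<dots> = vclass W N' ` Z'" unfolding t(3)[symmetric] image_image ..
    also have "\<dots> = vcar (vquot (vsub W Z') N')" by (simp add: q)
    finally show ?thesis .
  qed
  ultimately show "?h \<in> viso (vquot (vsub U Z) N) (vquot (vsub W Z') N')"
    by (simp add: viso_def bij_betw_def)
qed

section \<open>Tensors in coordinates\<close>

definition words :: "nat \<Rightarrow> nat \<Rightarrow> nat list set" where
  "words d m = {I. set I \<subseteq> {..<d} \<and> length I = m}"

lemma finite_words [simp]: "finite (words d m)"
  unfolding words_def by (rule finite_lists_length_eq) simp

lemma words_0 [simp]: "words d 0 = {[]}"
  by (auto simp: words_def)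

lemma words_append [simp]: "I \<in> words d p \<Longrightarrow> J \<in> words d q \<Longrightarrow> I @ J \<in> words d (p + q)"
  by (auto simp: words_def)

lemma words_length: "I \<in> words d m \<Longrightarrow> length I = m"
  by (simp add: words_def)

lemma words_nth: "I \<in> words d m \<Longrightarrow> n < m \<Longrightarrow> I ! n < d"
  by (auto simp: words_def subset_iff)

lemma words_take: "L \<in> words d (p + q) \<Longrightarrow> take p L \<in> words d p"
  and words_drop: "L \<in> words d (p + q) \<Longrightarrow> drop p L \<in> words d q"
  by (auto simp: words_def dest: in_set_takeD in_set_dropD)

lemma sum_words_add: "(\<Sum>L\<in>words d (p + q). g L) = (\<Sum>I\<in>words d p. \<Sum>J\<in>words d q. g (I @ J))"
proof -
  have "(\<Sum>L\<in>words d (p + q). g L) = (\<Sum>(I, J)\<in>words d p \<times> words d q. g (I @ J))"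
    by (rule sum.reindex_bij_witness[of _ "\<lambda>(I, J). I @ J" "\<lambda>L. (take p L, drop p L)"])
       (auto simp: words_take words_drop words_length)
  then show ?thesis by (simp add: sum.cartesian_product)
qed

lemma sum_words_Suc: "(\<Sum>L\<in>words d (Suc n). g L) = (\<Sum>i<d. \<Sum>I\<in>words d n. g (i # I))"
proof -
  have "(\<Sum>L\<in>words d (Suc n). g L) = (\<Sum>(i, I)\<in>{..<d} \<times> words d n. g (i # I))"
    by (rule sum.reindex_bij_witness[of _ "\<lambda>(i, I). i # I" "\<lambda>L. (hd L, tl L)"])
       (auto simp: words_def length_Suc_conv)
  then show ?thesis by (simp add: sum.cartesian_product)
qed

lemma mforms_vlinear: "\<phi> \<in> mforms V \<Longrightarrow> ys \<in> lists (vcar V) \<Longrightarrow> zs \<in> lists (vcar V) \<Longrightarrow>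
    vlinear V vfield (\<lambda>x. \<phi> (ys @ x # zs))"
  by (simp add: mforms_def)

lemma subspace_tpow [simp]: "fv.subspace (vcar (tpow V m))"
  by (simp add: tpow_def)

lemma fsub_tpow [simp]: "fsub (vcar (tpow V m)) = tpow V m"
  by (simp add: tpow_def)

lemma tpow_ops [simp]: "vadd (tpow V m) = (+)" "vzero (tpow V m) = 0" "vscale (tpow V m) = fscale"
  by (simp_all add: tpow_def)

lemma vsp_tpow [simp]: "vsp (tpow V m)"
  by (simp add: tpow_def vsp_fsub)

text \<open>A left inverse of the identity on \<open>S\<close>. The ambient function space may be
  infinite dimensional; what is used later is that the retraction is linear, with values in
  \<open>S\<close>.\<close>

lemma projection_exists:
  fixes S :: "('i \<Rightarrow> 'k::field) set"
  assumes "fv.subspace S"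
  shows "\<exists>Q. module_hom fscale fscale Q \<and> range Q \<subseteq> S \<and> (\<forall>x\<in>S. Q x = x)"
proof -
  interpret fp: vector_space_pair "fscale :: 'k \<Rightarrow> ('i \<Rightarrow> 'k) \<Rightarrow> _" "fscale :: 'k \<Rightarrow> ('i \<Rightarrow> 'k) \<Rightarrow> _" ..
  have "Vector_Spaces.linear fscale fscale (\<lambda>x :: 'i \<Rightarrow> 'k. x)"
    using fv.linear_id unfolding id_def .
  from fp.linear_exists_left_inverse_on[OF this assms] obtain Q
    where "range Q \<subseteq> S" "Vector_Spaces.linear fscale fscale Q" "\<forall>x\<in>S. Q x = x" by auto
  then show ?thesis by (auto simp: Vector_Spaces.linear_def)
qed

text \<open>Expansion in the basis \<open>e\<close> with dual basis \<open>c\<close> is only required after applying a linear form,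
  as tensors are evaluated on multilinear forms.\<close>

locale fdv =
  fixes V :: "('k::field, 'a) vspace" and d :: nat and e :: "nat \<Rightarrow> 'a" and c :: "nat \<Rightarrow> 'a \<Rightarrow> 'k"
  assumes vsp_V: "vsp V"
    and e_in: "i < d \<Longrightarrow> e i \<in> vcar V"
    and c_linear: "i < d \<Longrightarrow> vlinear V vfield (c i)"
    and c_e: "i < d \<Longrightarrow> j < d \<Longrightarrow> c i (e j) = (if i = j then 1 else 0)"
    and expand: "vlinear V vfield \<phi> \<Longrightarrow> x \<in> vcar V \<Longrightarrow> \<phi> x = (\<Sum>i<d. c i x * \<phi> (e i))"
begin

abbreviation T where "T m \<equiv> vcar (tpow V m)"
abbreviation wd where "wd m \<equiv> words d m"

text \<open>The product of coordinate forms indexed by the word \<open>I\<close>. Giving it the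
  value 0 on lists of other lengths makes it multilinear on lists of every length, as
  \<open>mforms\<close> demands.\<close>

definition cform :: "nat list \<Rightarrow> 'a list \<Rightarrow> 'k" where
  "cform I xs = (if length xs = length I then prod_list (map2 c I xs) else 0)"

text \<open>Tensors are functionals on multilinear forms, so taking the coefficient at a word is an
  evaluation and is linear by definition.\<close>

definition cf :: "('k, 'a) tensor \<Rightarrow> nat list \<Rightarrow> 'k" where
  "cf t I = t (cform I)"

definition eI :: "nat list \<Rightarrow> ('k, 'a) tensor" where
  "eI I = pure V (map e I)"

definition mk :: "nat \<Rightarrow> (nat list \<Rightarrow> 'k) \<Rightarrow> ('k, 'a) tensor" where
  "mk m a = (\<Sum>I\<in>wd m. fscale (a I) (eI I))"

lemma cform_Nil: "cform [] [] = 1"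
  and cform_Cons: "cform (i # I) (x # xs) = c i x * cform I xs"
  by (simp_all add: cform_def)

lemma cform_append: "length xs = length I \<Longrightarrow> cform (I @ J) (xs @ ys) = cform I xs * cform J ys"
  by (auto simp: cform_def)

lemma e_lists: "I \<in> wd m \<Longrightarrow> map e I \<in> lists (vcar V)"
  by (auto simp: words_def subset_iff e_in)

lemma cform_e: "I \<in> wd m \<Longrightarrow> J \<in> wd m \<Longrightarrow> cform I (map e J) = (if I = J then 1 else 0)"
proof (induction m arbitrary: I J)
  case (Suc m)
  then obtain i I' j J' where "I = i # I'" "J = j # J'" "i < d" "j < d" "I' \<in> wd m" "J' \<in> wd m"
    by (auto simp: words_def length_Suc_conv)
  with Suc show ?case by (simp add: cform_Cons c_e)
qed (simp add: cform_Nil)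

lemma cform_mforms: "I \<in> wd m \<Longrightarrow> cform I \<in> mforms V"
  unfolding mforms_def
proof (safe, goal_cases)
  case (1 ys zs)
  show ?case
  proof (cases "m = length ys + Suc (length zs)")
    case True
    define n where "n = length ys"
    have n: "n < length I" using 1 True by (simp add: n_def words_length)
    have "cform I (ys @ x # zs) = cform (take n I) ys * cform (drop (Suc n) I) zs * c (I ! n) x" for x
    proof -
      have "cform (take n I @ (I ! n) # drop (Suc n) I) (ys @ x # zs)
          = cform (take n I) ys * cform (I ! n # drop (Suc n) I) (x # zs)"
        using n by (intro cform_append) (simp add: n_def)
      then show ?thesis using id_take_nth_drop[OF n] by (simp add: cform_Cons)
    qed
    moreover have "I ! n < d" using 1 n by (simp add: words_nth words_length)
    ultimately show ?thesis by (simp add: vform_scaled c_linear)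
  next
    case False
    then have "cform I (ys @ x # zs) = 0" for x using 1 by (auto simp: cform_def words_length)
    then show ?thesis by (simp add: vlinear_def)
  qed
qed

text \<open>Induction on \<open>xs\<close> expands one argument after the other; the prefix
  \<open>ys\<close> holds the arguments that have already been replaced by basis vectors.\<close>

lemma mform_expand:
  "\<phi> \<in> mforms V \<Longrightarrow> ys \<in> lists (vcar V) \<Longrightarrow> xs \<in> lists (vcar V) \<Longrightarrow>
    \<phi> (ys @ xs) = (\<Sum>I\<in>wd (length xs). cform I xs * \<phi> (ys @ map e I))"
proof (induction xs arbitrary: ys)
  case (Cons x xs)
  have "\<phi> (ys @ x # xs) = (\<Sum>i<d. c i x * \<phi> (ys @ e i # xs))"
    using expand[OF mforms_vlinear[OF Cons.prems(1), of ys xs], of x] Cons.prems by simp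
  also have "\<dots> = (\<Sum>i<d. c i x * (\<Sum>I\<in>wd (length xs). cform I xs * \<phi> (ys @ e i # map e I)))"
    using Cons.IH[of "ys @ [e i]" for i] Cons.prems e_in by (intro sum.cong refl) simp
  also have "\<dots> = (\<Sum>L\<in>wd (length (x # xs)). cform L (x # xs) * \<phi> (ys @ map e L))"
    by (simp add: sum_words_Suc cform_Cons sum_distrib_left mult.assoc)
  finally show ?case .
qed (simp add: cform_Nil)

lemma cf_simps [simp]:
  "cf 0 I = 0" "cf (s + t) I = cf s I + cf t I" "cf (fscale a t) I = a * cf t I"
  "cf (s - t) I = cf s I - cf t I"
  by (simp_all add: cf_def fscale_def)

lemma cf_sum [simp]: "cf (\<Sum>i\<in>A. f i) I = (\<Sum>i\<in>A. cf (f i) I)"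
proof (cases "finite A")
  case True then show ?thesis
    by (induction A) (simp_all only: sum.insert sum.empty cf_simps not_False_eq_True)
qed (simp add: cf_def)

lemma pure_in: "xs \<in> lists (vcar V) \<Longrightarrow> length xs = m \<Longrightarrow> pure V xs \<in> T m"
  by (auto simp: tpow_def intro!: fspan_base)

lemma eI_in [simp]: "I \<in> wd m \<Longrightarrow> eI I \<in> T m"
  unfolding eI_def by (rule pure_in[OF e_lists]) (simp_all add: words_length)

lemma tensor_induct [consumes 1]:
  assumes "t \<in> T m" "P 0"
    and "\<And>a xs y. xs \<in> lists (vcar V) \<Longrightarrow> length xs = m \<Longrightarrow> y \<in> T m \<Longrightarrow> P y \<Longrightarrow> P (fscale a (pure V xs) + y)"
  shows "P t"
proof -
  have "t \<in> fspan {pure V xs | xs. xs \<in> lists (vcar V) \<and> length xs = m}"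
    using assms(1) by (simp add: tpow_def)
  then show ?thesis
  proof (rule fspan_induct[where P = P])
    fix a x y assume "x \<in> {pure V xs | xs. xs \<in> lists (vcar V) \<and> length xs = m}"
      "y \<in> fspan {pure V xs | xs. xs \<in> lists (vcar V) \<and> length xs = m}" "P y"
    with assms(3) show "P (fscale a x + y)" by (auto simp: tpow_def)
  qed (rule assms(2))
qed

lemma tensor_off: "t \<in> T m \<Longrightarrow> \<phi> \<notin> mforms V \<Longrightarrow> t \<phi> = 0"
  by (rule tensor_induct[of t m "\<lambda>t. t \<phi> = 0"]) (auto simp: pure_def fscale_def)

lemma tensor_expand:
  assumes "t \<in> T m" "\<phi> \<in> mforms V"
  shows "t \<phi> = (\<Sum>I\<in>wd m. cf t I * \<phi> (map e I))"
  using assms(1)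
proof (rule tensor_induct)
  fix a xs y assume *: "xs \<in> lists (vcar V)" "length xs = m" "y \<phi> = (\<Sum>I\<in>wd m. cf y I * \<phi> (map e I))"
  have "pure V xs \<phi> = (\<Sum>I\<in>wd m. cf (pure V xs) I * \<phi> (map e I))"
    using mform_expand[OF assms(2), of "[]" xs] * assms(2) cform_mforms
    by (simp add: pure_def cf_def)
  with * show "(fscale a (pure V xs) + y) \<phi> = (\<Sum>I\<in>wd m. cf (fscale a (pure V xs) + y) I * \<phi> (map e I))"
    by (simp add: fscale_def[of a "pure V xs"] distrib_right sum.distrib sum_distrib_left mult.assoc)
       (simp add: cf_def fscale_def mult.assoc)
next
  show "(0 :: ('k, 'a) tensor) \<phi> = (\<Sum>I\<in>wd m. cf 0 I * \<phi> (map e I))" by simp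
qed

lemma tensor_eqI:
  assumes "s \<in> T m" "t \<in> T m" "\<And>I. I \<in> wd m \<Longrightarrow> cf s I = cf t I"
  shows "s = t"
proof
  fix \<phi> show "s \<phi> = t \<phi>"
    using assms by (cases "\<phi> \<in> mforms V") (simp_all add: tensor_expand tensor_off cong: sum.cong)
qed

lemma tensor_eqI2:
  assumes "s \<in> T (m + n)" "t \<in> T (m + n)" "\<And>I J. I \<in> wd m \<Longrightarrow> J \<in> wd n \<Longrightarrow> cf s (I @ J) = cf t (I @ J)"
  shows "s = t"
  using assms by (intro tensor_eqI[OF assms(1,2)]) (metis append_take_drop_id words_take words_drop)

lemma mk_in [simp]: "mk m a \<in> T m"
  unfolding mk_def by (intro fv.subspace_sum fv.subspace_scale subspace_tpow) simp

lemma cf_eI: "I \<in> wd m \<Longrightarrow> J \<in> wd m \<Longrightarrow> cf (eI J) I = (if I = J then 1 else 0)"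
  using cform_mforms[of I m] cform_e[of I m J] by (simp add: cf_def eI_def pure_def)

lemma cf_mk [simp]: "I \<in> wd m \<Longrightarrow> cf (mk m a) I = a I"
  by (simp add: mk_def cf_eI if_distrib[of "(*) _"] sum.delta' cong: if_cong)

lemma mk_cf [simp]: "t \<in> T m \<Longrightarrow> mk m (cf t) = t"
  by (rule tensor_eqI) auto

lemma tensor_sum: "t \<in> T m \<Longrightarrow> t = (\<Sum>I\<in>wd m. fscale (cf t I) (eI I))"
  using mk_cf[of t m] by (simp add: mk_def)

lemma tmul_mk:
  assumes s: "s \<in> T m" and t: "t \<in> T n"
  shows "tmul V s t = mk (m + n) (\<lambda>L. cf s (take m L) * cf t (drop m L))"
proof
  fix \<phi>
  show "tmul V s t \<phi> = mk (m + n) (\<lambda>L. cf s (take m L) * cf t (drop m L)) \<phi>"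
  proof (cases "\<phi> \<in> mforms V")
    case True
    define \<psi> where "\<psi> = (\<lambda>xs. t (\<lambda>ys. \<phi> (xs @ ys)))"
    have t': "\<psi> xs = (\<Sum>J\<in>wd n. cf t J * \<phi> (xs @ map e J))" if "xs \<in> lists (vcar V)" for xs
      unfolding \<psi>_def
    proof (rule tensor_expand[OF t])
      show "(\<lambda>ys. \<phi> (xs @ ys)) \<in> mforms V"
        using that mforms_vlinear[OF True] by (auto simp: mforms_def simp flip: append_assoc)
    qed
    \<comment> \<open>Tensors vanish off \<open>mforms\<close>, so \<open>s\<close> can be expanded
      at \<open>\<psi>\<close> only after multilinearity of \<open>\<psi>\<close> is known. It is
      clear for the expansion of \<open>\<psi>\<close>, and that holds on lists over the carrier
      only.\<close>
    have "\<psi> \<in> mforms V"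
      unfolding mforms_def
    proof (safe, goal_cases)
      case (1 ys zs)
      have "vlinear V vfield (\<lambda>x. \<Sum>J\<in>wd n. cf t J * \<phi> (ys @ x # zs @ map e J))"
        using 1 e_lists by (intro vform_comb mforms_vlinear[OF True]) auto
      then show ?case
      proof (rule vform_cong)
        fix x assume "x \<in> vcar V"
        then have "ys @ x # zs \<in> lists (vcar V)" using 1 by auto
        from t'[OF this] show "(\<Sum>J\<in>wd n. cf t J * \<phi> (ys @ x # zs @ map e J)) = \<psi> (ys @ x # zs)" by simp
      qed (use vsp_V in auto)
    qed
    then have "s \<psi> = (\<Sum>I\<in>wd m. cf s I * \<psi> (map e I))" by (rule tensor_expand[OF s])
    also have "\<dots> = (\<Sum>I\<in>wd m. \<Sum>J\<in>wd n. cf s I * cf t J * \<phi> (map e (I @ J)))"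
      by (intro sum.cong refl) (simp add: t' e_lists sum_distrib_left mult.assoc)
    also have "\<dots> = (\<Sum>L\<in>wd (m + n). (cf s (take m L) * cf t (drop m L)) * \<phi> (map e L))"
      by (simp add: sum_words_add words_length)
    also have "\<dots> = mk (m + n) (\<lambda>L. cf s (take m L) * cf t (drop m L)) \<phi>"
      by (simp add: tensor_expand[OF mk_in True])
    finally show ?thesis using True by (simp add: tmul_def \<psi>_def)
  next
    case False
    then show ?thesis by (simp add: tmul_def tensor_off[OF mk_in])
  qed
qed

lemma tmul_in: "s \<in> T m \<Longrightarrow> t \<in> T n \<Longrightarrow> tmul V s t \<in> T (m + n)"
  by (simp add: tmul_mk)

lemma cf_tmul: "s \<in> T m \<Longrightarrow> t \<in> T n \<Longrightarrow> I \<in> wd m \<Longrightarrow> J \<in> wd n \<Longrightarrow>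
    cf (tmul V s t) (I @ J) = cf s I * cf t J"
  by (simp add: tmul_mk words_length)

lemma tmul_add_left: "s \<in> T m \<Longrightarrow> s' \<in> T m \<Longrightarrow> t \<in> T n \<Longrightarrow> tmul V (s + s') t = tmul V s t + tmul V s' t"
  and tmul_add_right: "s \<in> T m \<Longrightarrow> t \<in> T n \<Longrightarrow> t' \<in> T n \<Longrightarrow> tmul V s (t + t') = tmul V s t + tmul V s t'"
  and tmul_scale_left: "s \<in> T m \<Longrightarrow> t \<in> T n \<Longrightarrow> tmul V (fscale a s) t = fscale a (tmul V s t)"
  and tmul_scale_right: "s \<in> T m \<Longrightarrow> t \<in> T n \<Longrightarrow> tmul V s (fscale a t) = fscale a (tmul V s t)"
  by (rule tensor_eqI2[where m = m and n = n];
      simp add: tmul_in fv.subspace_add fv.subspace_scale cf_tmul[where m = m and n = n] algebra_simps)+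

lemma tmul_assoc: "s \<in> T m \<Longrightarrow> t \<in> T n \<Longrightarrow> u \<in> T l \<Longrightarrow>
    tmul V (tmul V s t) u = tmul V s (tmul V t u)"
proof (rule tensor_eqI2[where m = "m + n" and n = l])
  fix I J assume *: "s \<in> T m" "t \<in> T n" "u \<in> T l" "I \<in> wd (m + n)" "J \<in> wd l"
  obtain I1 I2 where I: "I = I1 @ I2" "I1 \<in> wd m" "I2 \<in> wd n"
    using * by (metis append_take_drop_id words_take words_drop)
  show "cf (tmul V (tmul V s t) u) (I @ J) = cf (tmul V s (tmul V t u)) (I @ J)"
    using * I cf_tmul[OF tmul_in, of s m t n u l "I1 @ I2" J]
      cf_tmul[OF _ tmul_in, of s m t n u l I1 "I2 @ J"]
    by (simp add: cf_tmul)
qed (use tmul_in[OF tmul_in, of s m t n u l] tmul_in[OF _ tmul_in, of s m t n u l] in \<open>simp_all add: add.assoc\<close>)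

text \<open>Contraction of the last letters with the dual basis word \<open>J\<close>, leaving a
  tensor of weight \<open>p\<close>; \<open>ctl\<close> below contracts the first letters. These are
  the tools for showing that W_(p+q) lies in W_p (x) W_q.\<close>

definition ctr :: "nat \<Rightarrow> nat list \<Rightarrow> ('k, 'a) tensor \<Rightarrow> ('k, 'a) tensor" where
  "ctr p J w = mk p (\<lambda>I. cf w (I @ J))"

definition ctl :: "nat \<Rightarrow> nat list \<Rightarrow> ('k, 'a) tensor \<Rightarrow> ('k, 'a) tensor" where
  "ctl q I w = mk q (\<lambda>J. cf w (I @ J))"

lemma ctr_in [simp]: "ctr p J w \<in> T p" and ctl_in [simp]: "ctl q I w \<in> T q"
  by (simp_all add: ctr_def ctl_def)

lemma cf_ctr [simp]: "I \<in> wd p \<Longrightarrow> cf (ctr p J w) I = cf w (I @ J)"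
  and cf_ctl [simp]: "J \<in> wd q \<Longrightarrow> cf (ctl q I w) J = cf w (I @ J)"
  by (simp_all add: ctr_def ctl_def)

lemma ctr_add: "ctr p J (v + w) = ctr p J v + ctr p J w"
  and ctr_scale: "ctr p J (fscale a w) = fscale a (ctr p J w)"
  by (rule tensor_eqI[where m = p]; simp add: fv.subspace_add fv.subspace_scale)+

lemma ctr_tmul: "u \<in> T p \<Longrightarrow> v \<in> T q \<Longrightarrow> J \<in> wd q \<Longrightarrow> ctr p J (tmul V u v) = fscale (cf v J) u"
  and ctl_tmul: "u \<in> T p \<Longrightarrow> v \<in> T q \<Longrightarrow> I \<in> wd p \<Longrightarrow> ctl q I (tmul V u v) = fscale (cf u I) v"
  by (rule tensor_eqI[where m = p] tensor_eqI[where m = q]; simp add: cf_tmul fv.subspace_scale)+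

lemma ctr_ctr: "K \<in> wd r \<Longrightarrow> J \<in> wd q \<Longrightarrow> ctr p J (ctr (p + q) K w) = ctr p (J @ K) w"
  by (rule tensor_eqI[where m = p]) simp_all

text \<open>A subspace is the annihilator of its annihilator: for a projection \<open>Q\<close> onto
  \<open>N\<close> the coefficients of \<open>x - Q x\<close> are forms that vanish on
  \<open>N\<close>, hence at \<open>s\<close>, so \<open>s = Q s\<close>.\<close>

lemma separate:
  assumes N: "fv.subspace N" "N \<subseteq> T m" and s: "s \<in> T m"
    and h: "\<And>a. (\<And>x. x \<in> N \<Longrightarrow> (\<Sum>I\<in>wd m. a I * cf x I) = 0) \<Longrightarrow> (\<Sum>I\<in>wd m. a I * cf s I) = 0"
  shows "s \<in> N"
proof -
  obtain Q where Q: "module_hom fscale fscale Q" "range Q \<subseteq> N" "\<And>x. x \<in> N \<Longrightarrow> Q x = x"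
    using projection_exists[OF N(1)] by blast
  have lin: "vlinear (tpow V m) vfield (\<lambda>x. cf (x - Q x) J)" for J
    using Q(1) by (intro vlinear_formI) (simp_all add: module_hom.add module_hom.scale algebra_simps)
  have "cf s J = cf (Q s) J" if "J \<in> wd m" for J
  proof -
    have *: "(\<Sum>I\<in>wd m. cf (eI I - Q (eI I)) J * cf x I) = cf (x - Q x) J" if "x \<in> T m" for x
      using vform_fsub_sum[of "T m" "\<lambda>x. cf (x - Q x) J" "wd m" eI "cf x"] lin[of J] that
      by (simp add: tensor_sum[symmetric] mult.commute)
    have "(\<Sum>I\<in>wd m. cf (eI I - Q (eI I)) J * cf s I) = 0"
    proof (rule h)
      fix x assume "x \<in> N"
      then show "(\<Sum>I\<in>wd m. cf (eI I - Q (eI I)) J * cf x I) = 0"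
        using N(2) Q(3) by (subst *) auto
    qed
    then show ?thesis by (subst (asm) *[OF s]) simp
  qed
  moreover have "Q s \<in> N" using Q(2) by auto
  ultimately have "s = Q s" using s N by (intro tensor_eqI[where m = m]) auto
  with \<open>Q s \<in> N\<close> show ?thesis by simp
qed

end

section \<open>The spaces $W_p$ of a quadratic algebra\<close>

lemma bforms_left: "F \<in> bforms U W \<Longrightarrow> w \<in> vcar W \<Longrightarrow> vlinear U vfield (\<lambda>u. F u w)"
  and bforms_right: "F \<in> bforms U W \<Longrightarrow> u \<in> vcar U \<Longrightarrow> vlinear W vfield (F u)"
  by (auto simp: bforms_def)

lemma bformsI:
  assumes "\<And>u. u \<in> vcar U \<Longrightarrow> vlinear W vfield (F u)" "\<And>w. w \<in> vcar W \<Longrightarrow> vlinear U vfield (\<lambda>u. F u w)"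
  shows "F \<in> bforms U W"
  using assms by (auto simp: bforms_def)

lemma bforms_plus: "F \<in> bforms U W \<Longrightarrow> G \<in> bforms U W \<Longrightarrow> (\<lambda>u w. F u w + G u w) \<in> bforms U W"
  by (auto simp: bforms_def intro: vform_plus)

lemma bforms_scaled: "F \<in> bforms U W \<Longrightarrow> (\<lambda>u w. a * F u w) \<in> bforms U W"
  by (auto simp: bforms_def intro: vform_scaled)

lemma module_hom_tpow: "module_hom fscale fscale Q \<Longrightarrow> Q (\<Sum>i\<in>A. fscale (k i) (x i)) = (\<Sum>i\<in>A. fscale (k i) (Q (x i)))"
  by (simp add: module_hom.sum module_hom.scale)

locale quad = fdv V d e c for V :: "('k::field, 'a) vspace" and d e c +
  fixes R :: "('k, 'a) tensor set"
  assumes R_subspace: "fv.subspace R" and R_in: "R \<subseteq> T 2"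
begin

abbreviation W where "W p \<equiv> vcar (qW V R p)"
abbreviation alg where "alg m \<equiv> vcar (qalg V R m)"
abbreviation dual where "dual m \<equiv> vdual (qalg V R m)"
abbreviation mul where "mul \<equiv> qmul V R"
abbreviation gen where "gen \<equiv> qgen V R"
abbreviation wform where "wform p l \<equiv> vlinear (qW V R p) vfield l"
abbreviation aform where "aform m l \<equiv> vlinear (qalg V R m) vfield l"
abbreviation wforms where "wforms p q \<equiv> bforms (qW V R p) (qW V R q)"
abbreviation wsplit where "wsplit p q \<equiv> tsplit V (qW V R p) (qW V R q)"

text \<open>Contraction on both sides, leaving only the two letters at which a relation can
  sit.\<close>

definition mid :: "nat list \<Rightarrow> nat list \<Rightarrow> ('k, 'a) tensor \<Rightarrow> ('k, 'a) tensor" where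
  "mid I J w = mk 2 (\<lambda>K. cf w (I @ K @ J))"

lemma mid_in [simp]: "mid I J w \<in> T 2"
  by (simp add: mid_def)

lemma cf_mid [simp]: "K \<in> wd 2 \<Longrightarrow> cf (mid I J w) K = cf w (I @ K @ J)"
  by (simp add: mid_def)

lemma mid_add: "mid I J (v + w) = mid I J v + mid I J w"
  and mid_scale: "mid I J (fscale a w) = fscale a (mid I J w)"
  and mid_zero: "mid I J 0 = 0"
  by (rule tensor_eqI[where m = 2]; simp add: fv.subspace_add fv.subspace_scale fv.subspace_0)+

lemma rels_in: "rels V R i j \<subseteq> T (i + 2 + j)"
  using R_in tmul_in[OF _ tmul_in] by (force simp: rels_def add.assoc)

lemma cf_tmul3: "s \<in> T i \<Longrightarrow> r \<in> T 2 \<Longrightarrow> t \<in> T j \<Longrightarrow> I \<in> wd i \<Longrightarrow> K \<in> wd 2 \<Longrightarrow> J \<in> wd j \<Longrightarrow>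
    cf (tmul V s (tmul V r t)) (I @ K @ J) = cf s I * cf r K * cf t J"
  using cf_tmul[OF _ tmul_in, of s i r 2 t j I "K @ J"] cf_tmul[of r 2 t j K J] words_append[of K d 2 J j]
  by (simp add: mult.assoc)

lemma words3: "I \<in> wd i \<Longrightarrow> K \<in> wd 2 \<Longrightarrow> J \<in> wd j \<Longrightarrow> i + 2 + j = p \<Longrightarrow> I @ K @ J \<in> wd p"
  by (auto simp: words_def)

text \<open>Contracting a product \<open>s r t\<close> on both sides gives a multiple of
  \<open>r\<close>; conversely \<open>w\<close> is the sum over \<open>I\<close>, \<open>J\<close>
  of the products of \<open>eI I\<close>, \<open>mid I J w\<close> and \<open>eI J\<close>.
  Membership in a span becomes a condition checked word by word.\<close>

lemma span_rels: "fspan (rels V R i j) = {w \<in> T (i + 2 + j). \<forall>I\<in>wd i. \<forall>J\<in>wd j. mid I J w \<in> R}"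
proof (intro equalityI subsetI)
  fix w assume w: "w \<in> fspan (rels V R i j)"
  let ?S = "{w \<in> T (i + 2 + j). \<forall>I\<in>wd i. \<forall>J\<in>wd j. mid I J w \<in> R}"
  have "fv.subspace ?S"
    using R_subspace by (auto simp: fv.subspace_def mid_add mid_scale mid_zero
        intro: fv.subspace_0[OF subspace_tpow] fv.subspace_add[OF subspace_tpow] fv.subspace_scale[OF subspace_tpow])
  moreover have "rels V R i j \<subseteq> ?S"
  proof
    fix x assume x: "x \<in> rels V R i j"
    then obtain s r t where *: "x = tmul V s (tmul V r t)" "s \<in> T i" "r \<in> R" "t \<in> T j"
      by (auto simp: rels_def)
    have "mid I J x = fscale (cf s I * cf t J) r" if "I \<in> wd i" "J \<in> wd j" for I J
      using * R_in that
      by (intro tensor_eqI[where m = 2]) (auto simp: cf_tmul3[where i = i and j = j] fv.subspace_scale)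
    then show "x \<in> ?S" using subsetD[OF rels_in x] * R_subspace by (auto simp: fv.subspace_scale)
  qed
  ultimately show "w \<in> ?S" using w fspan_minimal by blast
next
  fix w assume w: "w \<in> {w \<in> T (i + 2 + j). \<forall>I\<in>wd i. \<forall>J\<in>wd j. mid I J w \<in> R}"
  have "w = (\<Sum>I\<in>wd i. \<Sum>J\<in>wd j. tmul V (eI I) (tmul V (mid I J w) (eI J)))" (is "w = ?s")
  proof (rule tensor_eqI)
    show "w \<in> T (i + 2 + j)" using w by simp
    show "?s \<in> T (i + 2 + j)"
      using tmul_in[OF eI_in tmul_in[OF mid_in eI_in]] by (intro fv.subspace_sum subspace_tpow) (simp add: add.assoc)
    fix L assume "L \<in> wd (i + 2 + j)"
    then have "L \<in> wd (i + (2 + j))" by (simp only: add.assoc)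
    then obtain I K J where L: "L = I @ K @ J" "I \<in> wd i" "K \<in> wd 2" "J \<in> wd j"
      using words_take[OF words_drop] words_drop[OF words_drop] words_take
      by (metis append_take_drop_id)
    have *: "cf (tmul V (eI I') (tmul V (mid I' J' w) (eI J'))) (I @ K @ J)
        = (if I = I' then if J = J' then cf w (I @ K @ J) else 0 else 0)"
      if "I' \<in> wd i" "J' \<in> wd j" for I' J'
      using that L by (simp add: cf_tmul3[where i = i and j = j] cf_eI[of _ i] cf_eI[of _ j])
    have "cf ?s L = (\<Sum>I'\<in>wd i. \<Sum>J'\<in>wd j. if I = I' then if J = J' then cf w (I @ K @ J) else 0 else 0)"
      unfolding cf_sum L(1) by (intro sum.cong refl *)
    also have "\<dots> = (\<Sum>I'\<in>wd i. if I = I' then cf w (I @ K @ J) else 0)"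
      using L(4) by (intro sum.cong refl) simp
    also have "\<dots> = cf w L" using L by simp
    finally show "cf w L = cf ?s L" ..
  qed
  also have "\<dots> \<in> fspan (rels V R i j)"
    using w eI_in unfolding rels_def by (intro fv.subspace_sum subspace_fspan fspan_base) blast
  finally show "w \<in> fspan (rels V R i j)" .
qed

lemma W_iff: "w \<in> W p \<longleftrightarrow>
    w \<in> T p \<and> (\<forall>i j. i + 2 + j = p \<longrightarrow> (\<forall>I\<in>wd i. \<forall>J\<in>wd j. mid I J w \<in> R))"
  by (auto simp: qW_def span_rels)

lemma W_T: "w \<in> W p \<Longrightarrow> w \<in> T p"
  by (simp add: W_iff)

lemma subspace_W [simp]: "fv.subspace (W p)"
  using R_subspace by (auto simp: fv.subspace_def W_iff mid_add mid_scale mid_zero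
      intro: fv.subspace_0[OF subspace_tpow] fv.subspace_add[OF subspace_tpow] fv.subspace_scale[OF subspace_tpow])

lemma qW_fsub [simp]: "fsub (W p) = qW V R p"
  and qW_ops [simp]: "vadd (qW V R p) = (+)" "vzero (qW V R p) = 0" "vscale (qW V R p) = fscale"
  by (simp_all add: qW_def)

lemma vsp_qW [simp]: "vsp (qW V R p)"
  using vsp_fsub[OF subspace_W] by simp

lemma vform_T_W: "vlinear (tpow V p) vfield l \<Longrightarrow> wform p l"
  by (auto simp: vlinear_def W_T)

text \<open>A position of a relation among the first \<open>p\<close> factors is also one among all
  \<open>p + q\<close>, with \<open>J' @ J\<close> as the word contracted on its right.\<close>

lemma ctr_W: 
  assumes "w \<in> W (p + q)" "J \<in> wd q"
  shows "ctr p J w \<in> W p"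
  unfolding W_iff
proof (intro conjI allI impI ballI)
  fix i j I J' assume *: "i + 2 + j = p" "I \<in> wd i" "J' \<in> wd j"
  have "cf (ctr p J w) (I @ K @ J') = cf w (I @ K @ J' @ J)" if "K \<in> wd 2" for K
  proof -
    have "I @ K @ J' \<in> wd p" using * that by (intro words3)
    then show ?thesis by simp
  qed
  then have "mid I J' (ctr p J w) = mid I (J' @ J) w" by (intro tensor_eqI[where m = 2]) auto
  also have "\<dots> \<in> R"
  proof -
    have "i + 2 + (j + q) = p + q" "J' @ J \<in> wd (j + q)" using * assms by auto
    then show ?thesis using assms(1) *(2) unfolding W_iff by blast
  qed
  finally show "mid I J' (ctr p J w) \<in> R" .
qed simp

lemma ctl_W: 
  assumes "w \<in> W (p + q)" "I \<in> wd p"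
  shows "ctl q I w \<in> W q"
  unfolding W_iff
proof (intro conjI allI impI ballI)
  fix i j I' J assume *: "i + 2 + j = q" "I' \<in> wd i" "J \<in> wd j"
  have "cf (ctl q I w) (I' @ K @ J) = cf w ((I @ I') @ K @ J)" if "K \<in> wd 2" for K
  proof -
    have "I' @ K @ J \<in> wd q" using * that by (intro words3)
    then show ?thesis by simp
  qed
  then have "mid I' J (ctl q I w) = mid (I @ I') J w" by (intro tensor_eqI[where m = 2]) auto
  also have "\<dots> \<in> R"
  proof -
    have "(p + i) + 2 + j = p + q" "I @ I' \<in> wd (p + i)" using * assms by auto
    then show ?thesis using assms(1) *(3) unfolding W_iff by blast
  qed
  finally show "mid I' J (ctl q I w) \<in> R" .
qed simp

text \<open>A retraction of the ambient space onto \<open>W p\<close>. The elements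
  \<open>Pj p (eI J)\<close> span \<open>W p\<close>, possibly with dependencies, and together with
  the coefficients \<open>cf v J\<close> they do the work of a basis with its dual basis.\<close>

definition Pj :: "nat \<Rightarrow> ('k, 'a) tensor \<Rightarrow> ('k, 'a) tensor" where
  "Pj p = (SOME Q. module_hom fscale fscale Q \<and> range Q \<subseteq> W p \<and> (\<forall>x\<in>W p. Q x = x))"

lemma Pj: "module_hom fscale fscale (Pj p)" "Pj p x \<in> W p" "x \<in> W p \<Longrightarrow> Pj p x = x"
  using someI_ex[OF projection_exists[OF subspace_W[of p]]] unfolding Pj_def[symmetric] by auto

lemma Pj_sum: "v \<in> W q \<Longrightarrow> v = (\<Sum>J\<in>wd q. fscale (cf v J) (Pj q (eI J)))"
  using tensor_sum[OF W_T, of v q] Pj(3)[of v q] module_hom_tpow[OF Pj(1)] by metis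

text \<open>This is the inclusion of W_(p+q) in W_p (x) W_q. Fixing the first letters of
  \<open>w\<close> leaves an element of \<open>W q\<close>, which \<open>Pj_sum\<close> expands; its
  coefficients are those of the contractions \<open>ctr p J w\<close>, which lie in
  \<open>W p\<close>.\<close>

lemma W_sum:
  assumes w: "w \<in> W (p + q)"
  shows "w = (\<Sum>J\<in>wd q. tmul V (ctr p J w) (Pj q (eI J)))"
proof (rule tensor_eqI2)
  show "w \<in> T (p + q)" using w by (rule W_T)
  show "(\<Sum>J\<in>wd q. tmul V (ctr p J w) (Pj q (eI J))) \<in> T (p + q)"
    by (intro fv.subspace_sum subspace_tpow tmul_in W_T[OF Pj(2)]) simp
  fix I L assume *: "I \<in> wd p" "L \<in> wd q"
  have "cf w (I @ L) = cf (ctl q I w) L" using * by simp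
  also have "ctl q I w = (\<Sum>J\<in>wd q. fscale (cf (ctl q I w) J) (Pj q (eI J)))"
    by (rule Pj_sum[OF ctl_W[OF w *(1)]])
  also have "cf \<dots> L = cf (\<Sum>J\<in>wd q. tmul V (ctr p J w) (Pj q (eI J))) (I @ L)"
    using * by (simp add: cf_tmul[where m = p and n = q] W_T[OF Pj(2)])
  finally show "cf w (I @ L) = cf (\<Sum>J\<in>wd q. tmul V (ctr p J w) (Pj q (eI J))) (I @ L)" .
qed

text \<open>The value at \<open>w \<in> W\<^sub>p\<^sub>+\<^sub>q\<close> of the linear form induced by the bilinear form \<open>F\<close> on
  \<open>W\<^sub>p \<times> W\<^sub>q\<close>, along the decomposition of \<open>w\<close> in \<open>W_sum\<close>.\<close>

definition Lam :: "nat \<Rightarrow> nat \<Rightarrow> (('k, 'a) tensor \<Rightarrow> ('k, 'a) tensor \<Rightarrow> 'k) \<Rightarrow> ('k, 'a) tensor \<Rightarrow> 'k" where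
  "Lam p q F w = (\<Sum>J\<in>wd q. F (ctr p J w) (Pj q (eI J)))"

lemma Lam_cong:
  assumes "w \<in> W (p + q)" "\<And>u v. u \<in> W p \<Longrightarrow> v \<in> W q \<Longrightarrow> F u v = G u v"
  shows "Lam p q F w = Lam p q G w"
  unfolding Lam_def using assms by (intro sum.cong refl) (simp add: ctr_W Pj)

lemma Lam_scaled: "Lam p q (\<lambda>u v. a * F u v) w = a * Lam p q F w"
  and Lam_scaled': "Lam p q (\<lambda>u v. F u v * a) w = Lam p q F w * a"
  and Lam_zero: "Lam p q (\<lambda>u v. 0) w = 0"
  by (simp_all add: Lam_def sum_distrib_left sum_distrib_right)

text \<open>On products \<open>Lam\<close> returns the bilinear form itself, so by linearity it does
  not depend on the chosen retraction.\<close>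

lemma Lam_tmul:
  assumes F: "F \<in> wforms p q" and u: "u \<in> W p" and v: "v \<in> W q"
  shows "Lam p q F (tmul V u v) = F u v"
proof -
  have "Lam p q F (tmul V u v) = (\<Sum>J\<in>wd q. cf v J * F u (Pj q (eI J)))"
    using u v by (auto simp: Lam_def ctr_tmul[where q = q] W_T Pj vform_scale[OF bforms_left[OF F], simplified]
        intro!: sum.cong)
  also have "\<dots> = F u (\<Sum>J\<in>wd q. fscale (cf v J) (Pj q (eI J)))"
    using bforms_right[OF F u] by (intro vform_fsub_sum[OF subspace_W[of q], symmetric]) (auto simp: Pj)
  finally show ?thesis by (simp flip: Pj_sum[OF v])
qed

lemma tprod_W: "vcar (tprod V (qW V R p) (qW V R q)) = fspan {tmul V u v | u v. u \<in> W p \<and> v \<in> W q}"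
  by (simp add: tprod_def)

lemma W_tprod: "w \<in> W (p + q) \<Longrightarrow> w \<in> vcar (tprod V (qW V R p) (qW V R q))"
  by (subst W_sum, assumption, unfold tprod_W)
     (intro fv.subspace_sum subspace_fspan fspan_base, auto intro: ctr_W Pj)

lemma ctr_tprod:
  assumes "w \<in> vcar (tprod V (qW V R p) (qW V R q))" "J \<in> wd q"
  shows "ctr p J w \<in> W p"
proof -
  have z: "ctr p J 0 = 0" by (rule tensor_eqI[where m = p]) (simp_all add: fv.subspace_0)
  have "fspan {tmul V u v | u v. u \<in> W p \<and> v \<in> W q} \<subseteq> {w. ctr p J w \<in> W p}"
  proof (rule fspan_minimal)
    show "fv.subspace {w. ctr p J w \<in> W p}"
      using subspace_W[of p] by (auto simp: fv.subspace_def ctr_add ctr_scale z)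
  qed (use assms in \<open>auto simp: ctr_tmul[where q = q] W_T fv.subspace_scale\<close>)
  then show ?thesis using assms by (auto simp: tprod_W)
qed

lemma Lam_vlinear:
  assumes F: "F \<in> wforms p q"
  shows "vlinear (tprod V (qW V R p) (qW V R q)) vfield (Lam p q F)"
    and "wform (p + q) (Lam p q F)"
proof -
  have lin: "vlinear U vfield (Lam p q F)"
    if "\<And>w J. w \<in> vcar U \<Longrightarrow> J \<in> wd q \<Longrightarrow> ctr p J w \<in> W p" "vadd U = (+)" "vscale U = fscale" for U
    using that vform_add[OF bforms_left[OF F Pj(2)]] vform_scale[OF bforms_left[OF F Pj(2)]]
    by (intro vlinear_formI) (auto simp: Lam_def ctr_add ctr_scale sum.distrib sum_distrib_left intro!: sum.cong)
  show "vlinear (tprod V (qW V R p) (qW V R q)) vfield (Lam p q F)"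
    by (rule lin) (auto simp: tprod_def intro: ctr_tprod[unfolded tprod_def fsub_simps])
  show "wform (p + q) (Lam p q F)"
    by (rule lin) (auto intro: ctr_W)
qed

text \<open>If the bilinear form comes from a form on all tensors of weight \<open>p + q\<close>,
  the decomposition in \<open>W_sum\<close> is invisible: both sides are \<open>l\<close> applied to
  it.\<close>

lemma Lam_restrict:
  assumes l: "vlinear (tpow V (p + q)) vfield l" and w: "w \<in> W (p + q)"
  shows "Lam p q (\<lambda>u v. l (tmul V u v)) w = l w"
proof -
  have "l (\<Sum>J\<in>wd q. fscale 1 (tmul V (ctr p J w) (Pj q (eI J))))
      = (\<Sum>J\<in>wd q. 1 * l (tmul V (ctr p J w) (Pj q (eI J))))"
    using l by (intro vform_fsub_sum[of "T (p + q)"]) (auto intro!: tmul_in W_T[OF Pj(2)])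
  then show ?thesis using W_sum[OF w] by (simp add: Lam_def)
qed

text \<open>Both sides evaluate the trilinear form on \<open>w\<close> in W_p (x) W_q (x) W_r, but
  expand \<open>w\<close> along different families: those of \<open>W q\<close> and
  \<open>W r\<close> on the left, that of \<open>W (q + r)\<close> first on the right. The left side
  is rewritten in terms of the latter family, the sums are exchanged, and the family of
  \<open>W q\<close> is summed up again.\<close>

lemma Lam_assoc:
  assumes w: "w \<in> W (p + q + r)"
    and F1: "\<And>v x. v \<in> W q \<Longrightarrow> x \<in> W r \<Longrightarrow> wform p (\<lambda>u. F u v x)"
    and F2: "\<And>u x. u \<in> W p \<Longrightarrow> x \<in> W r \<Longrightarrow> wform q (\<lambda>v. F u v x)"
  shows "Lam (p + q) r (\<lambda>y x. Lam p q (\<lambda>u v. F u v x) y) w = Lam p (q + r) (\<lambda>u y. Lam q r (F u) y) w"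
proof -
  have w': "w \<in> W (p + (q + r))" using w by (simp add: add.assoc)
  let ?P = "\<lambda>L. Pj (q + r) (eI L)"
  have u: "ctr p L w \<in> W p" if "L \<in> wd (q + r)" for L using ctr_W[OF w' that] .
  \<comment> \<open>The coefficients of \<open>W_sum\<close> at the last \<open>q + r\<close>
    letters express a contraction by \<open>J @ K\<close> through the contractions
    \<open>ctr p L w\<close>, which are known to lie in \<open>W p\<close>.\<close>
  have 1: "ctr p (J @ K) w = (\<Sum>L\<in>wd (q + r). fscale (cf (?P L) (J @ K)) (ctr p L w))"
    if "J \<in> wd q" "K \<in> wd r" for J K
  proof (rule tensor_eqI[where m = p])
    fix I assume I: "I \<in> wd p"
    have "cf w (I @ J @ K) = cf (\<Sum>L\<in>wd (q + r). tmul V (ctr p L w) (?P L)) (I @ J @ K)"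
      using W_sum[OF w'] by simp
    then show "cf (ctr p (J @ K) w) I = cf (\<Sum>L\<in>wd (q + r). fscale (cf (?P L) (J @ K)) (ctr p L w)) I"
      using that I by (simp add: cf_tmul[where m = p and n = "q + r"] W_T[OF Pj(2)] mult.commute)
  qed (auto intro!: fv.subspace_sum fv.subspace_scale)
  have 2: "F (ctr p (J @ K) w) (Pj q (eI J)) (Pj r (eI K))
      = (\<Sum>L\<in>wd (q + r). cf (?P L) (J @ K) * F (ctr p L w) (Pj q (eI J)) (Pj r (eI K)))"
    if "J \<in> wd q" "K \<in> wd r" for J K
    unfolding 1[OF that] using F1[OF Pj(2) Pj(2)] u by (intro vform_fsub_sum[OF subspace_W[of p]]) auto
  have 3: "F u (ctr q K y) x = (\<Sum>J\<in>wd q. cf y (J @ K) * F u (Pj q (eI J)) x)"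
    if "K \<in> wd r" "u \<in> W p" "x \<in> W r" "y \<in> W (q + r)" for u x K y
  proof -
    have "F u (ctr q K y) x = F u (\<Sum>J\<in>wd q. fscale (cf (ctr q K y) J) (Pj q (eI J))) x"
      by (rule arg_cong[OF Pj_sum[OF ctr_W[OF that(4,1)]], of "\<lambda>z. F u z x"])
    also have "\<dots> = (\<Sum>J\<in>wd q. cf (ctr q K y) J * F u (Pj q (eI J)) x)"
      using F2[OF that(2,3)] by (intro vform_fsub_sum[OF subspace_W[of q]]) (auto simp: Pj)
    finally show ?thesis using that by simp
  qed
  have "Lam (p + q) r (\<lambda>y x. Lam p q (\<lambda>u v. F u v x) y) w
      = (\<Sum>K\<in>wd r. \<Sum>J\<in>wd q. \<Sum>L\<in>wd (q + r). cf (?P L) (J @ K) * F (ctr p L w) (Pj q (eI J)) (Pj r (eI K)))"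
    unfolding Lam_def by (intro sum.cong refl) (simp add: ctr_ctr 2)
  also have "\<dots> = (\<Sum>K\<in>wd r. \<Sum>L\<in>wd (q + r). F (ctr p L w) (ctr q K (?P L)) (Pj r (eI K)))"
    by (rule sum.cong[OF refl], rule trans[OF sum.swap]) (simp add: 3 Pj u)
  also have "\<dots> = Lam p (q + r) (\<lambda>u y. Lam q r (F u) y) w"
    unfolding Lam_def by (rule sum.swap)
  finally show ?thesis .
qed

definition binto where
  "binto Y p q \<beta> \<longleftrightarrow> (\<forall>u\<in>W p. \<forall>v\<in>W q. \<beta> u v \<in> vcar Y) \<and>
    (\<forall>l. vlinear Y vfield l \<longrightarrow> (\<lambda>u v. l (\<beta> u v)) \<in> wforms p q)"

text \<open>Replaces the description \<open>tsplit\<close> by a finite sum: \<open>Lam\<close> of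
  the composed bilinear form is the candidate that \<open>blift_form\<close> asks for.\<close>

lemma tsplit_form:
  assumes Y: "vsp Y" and b: "binto Y p q \<beta>" and w: "w \<in> W (p + q)"
  shows "wsplit p q Y \<beta> w \<in> vcar Y"
    and "\<And>l. vlinear Y vfield l \<Longrightarrow>
      l (wsplit p q Y \<beta> w) = Lam p q (\<lambda>u v. l (\<beta> u v)) w"
proof -
  let ?D = "tprod V (qW V R p) (qW V R q)"
  note B = blift_form[OF Y, of ?D "tmul V" "qW V R p" "qW V R q" \<beta> "\<lambda>l. Lam p q (\<lambda>u v. l (\<beta> u v))"]
  have *: "?D = fsub (fspan {tmul V u v | u v. u \<in> W p \<and> v \<in> W q})" by (simp add: tprod_def)
  have w': "w \<in> vcar ?D" using W_tprod[OF w] .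
  have bf: "vlinear Y vfield l \<Longrightarrow> (\<lambda>u v. l (\<beta> u v)) \<in> wforms p q" for l
    using b by (simp add: binto_def)
  note lin = Lam_vlinear(1)[OF bf, unfolded *]
  have bi: "u \<in> W p \<Longrightarrow> v \<in> W q \<Longrightarrow> \<beta> u v \<in> vcar Y" for u v using b by (simp add: binto_def)
  show "wsplit p q Y \<beta> w \<in> vcar Y"
    unfolding tsplit_def
    by (rule vhom_in[OF B(1) w']) (auto simp: * bi bf Lam_tmul intro!: lin)
  show "l (wsplit p q Y \<beta> w) = Lam p q (\<lambda>u v. l (\<beta> u v)) w"
    if "vlinear Y vfield l" for l
    unfolding tsplit_def
    by (rule B(3)) (use that w' in \<open>auto simp: * bi bf Lam_tmul intro!: lin\<close>)
qed

end

section \<open>Quadratic algebras\<close>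

context quad
begin

abbreviation I where "I m \<equiv> qideal V R m"
abbreviation cl where "cl m s \<equiv> vclass (tpow V m) (qideal V R m) s"

lemma subspace_I [simp]: "fv.subspace (I m)"
  by (simp add: qideal_def)

lemma I_T: "I m \<subseteq> T m"
  unfolding qideal_def using rels_in by (intro fspan_minimal) auto

lemma relsI: "a \<in> T i \<Longrightarrow> r \<in> R \<Longrightarrow> b \<in> T j \<Longrightarrow> tmul V a (tmul V r b) \<in> rels V R i j"
  unfolding rels_def by blast

lemma rels_I: "x \<in> rels V R i j \<Longrightarrow> i + 2 + j = m \<Longrightarrow> x \<in> I m"
  unfolding qideal_def by (intro fspan_base) blast

lemma vsubsp_I [simp]: "vsubsp (tpow V m) (I m)"
  using I_T subspace_I[of m] by (auto simp: vsubsp_def fv.subspace_def)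

text \<open>Left multiplication by weight \<open>m\<close> carries V^i R V^j into V^(m+i) R V^j.
  With its mirror image it makes \<open>qmul\<close> independent of representatives.\<close>

lemma tmul_I_left:
  assumes s: "s \<in> T m" and x: "x \<in> I n"
  shows "tmul V s x \<in> I (m + n)"
proof -
  have "I n \<subseteq> {x \<in> T n. tmul V s x \<in> I (m + n)}"
    unfolding qideal_def[of V R n]
  proof (rule fspan_minimal)
    have z: "tmul V s 0 = 0"
      using tmul_scale_right[OF s fv.subspace_0[OF subspace_tpow], of 0] by simp
    show "fv.subspace {x \<in> T n. tmul V s x \<in> I (m + n)}"
      using s subspace_I[of "m + n"] by (auto simp: fv.subspace_def tmul_add_right tmul_scale_right z
          intro: fv.subspace_0[OF subspace_tpow] fv.subspace_add[OF subspace_tpow] fv.subspace_scale[OF subspace_tpow])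
    show "\<Union> {rels V R i j |i j. i + 2 + j = n} \<subseteq> {x \<in> T n. tmul V s x \<in> I (m + n)}"
    proof clarsimp
      fix x i j assume x: "x \<in> rels V R i j" and n: "n = Suc (Suc (i + j))"
      then obtain a r b where *: "x = tmul V a (tmul V r b)" "a \<in> T i" "r \<in> R" "b \<in> T j"
        by (auto simp: rels_def)
      then have "tmul V s x = tmul V (tmul V s a) (tmul V r b)"
        using s R_in tmul_in[of r 2 b j] by (auto simp: tmul_assoc[of s m a i _ "2 + j"])
      then have "tmul V s x \<in> rels V R (m + i) j"
        using * tmul_in[OF s *(2)] unfolding rels_def by blast
      then have "tmul V s x \<in> I (m + n)" by (rule rels_I) (simp add: n)
      then show "x \<in> T (Suc (Suc (i + j))) \<and> tmul V s x \<in> I (Suc (Suc (m + (i + j))))"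
        using x rels_in[of i j] n by auto
    qed
  qed
  with x show ?thesis by auto
qed

lemma tmul_I_right:
  assumes x: "x \<in> I m" and t: "t \<in> T n"
  shows "tmul V x t \<in> I (m + n)"
proof -
  have "I m \<subseteq> {x \<in> T m. tmul V x t \<in> I (m + n)}"
    unfolding qideal_def[of V R m]
  proof (rule fspan_minimal)
    have z: "tmul V 0 t = 0"
      using tmul_scale_left[OF fv.subspace_0[OF subspace_tpow] t, of 0] by simp
    show "fv.subspace {x \<in> T m. tmul V x t \<in> I (m + n)}"
      using t subspace_I[of "m + n"] by (auto simp: fv.subspace_def tmul_add_left tmul_scale_left z
          intro: fv.subspace_0[OF subspace_tpow] fv.subspace_add[OF subspace_tpow] fv.subspace_scale[OF subspace_tpow])
    show "\<Union> {rels V R i j |i j. i + 2 + j = m} \<subseteq> {x \<in> T m. tmul V x t \<in> I (m + n)}"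
    proof clarsimp
      fix x i j assume x: "x \<in> rels V R i j" and m: "m = Suc (Suc (i + j))"
      then obtain a r b where *: "x = tmul V a (tmul V r b)" "a \<in> T i" "r \<in> R" "b \<in> T j"
        by (auto simp: rels_def)
      then have "tmul V x t = tmul V a (tmul V r (tmul V b t))"
        using t R_in tmul_in[of r 2 b j] by (auto simp: tmul_assoc[of a i _ "2 + j" t n] tmul_assoc[of r 2 b j t n])
      then have "tmul V x t \<in> rels V R i (j + n)"
        using * tmul_in[OF *(4) t] unfolding rels_def by blast
      then have "tmul V x t \<in> I (m + n)" by (rule rels_I) (simp add: m)
      then show "x \<in> T (Suc (Suc (i + j))) \<and> tmul V x t \<in> I (Suc (Suc (i + j + n)))"
        using x rels_in[of i j] m by auto
    qed
  qed
  with x show ?thesis by auto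
qed

lemma qalg_ops:
  "alg m = cl m ` T m" "vzero (qalg V R m) = cl m 0"
  "s \<in> T m \<Longrightarrow> t \<in> T m \<Longrightarrow> vadd (qalg V R m) (cl m s) (cl m t) = cl m (s + t)"
  "s \<in> T m \<Longrightarrow> vscale (qalg V R m) a (cl m s) = cl m (fscale a s)"
  using vquot_ops[OF vsp_tpow vsubsp_I] by (simp_all add: qalg_def)

lemma qalgE:
  assumes "X \<in> alg m"
  obtains s where "s \<in> T m" "X = cl m s"
  using assms by (auto simp: qalg_ops)

lemma cl_in [simp]: "s \<in> T m \<Longrightarrow> cl m s \<in> alg m"
  by (simp add: qalg_ops)

lemma cl_self: "s \<in> T m \<Longrightarrow> s \<in> cl m s"
  by (rule vclass_self) simp_all

lemma mem_cl: "t \<in> cl m s \<Longrightarrow> t - s \<in> I m"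
  by (auto elim!: vclassE)

lemma mem_cl_T: "s \<in> T m \<Longrightarrow> t \<in> cl m s \<Longrightarrow> t \<in> T m"
  using vclass_sub[OF vsp_tpow vsubsp_I] by blast

lemma cl_eqI:
  assumes "s \<in> T m" "t \<in> T m" "t - s \<in> I m"
  shows "cl m s = cl m t"
proof -
  have "t = vadd (tpow V m) s (t - s)" by simp
  then show ?thesis using vclass_add[OF vsp_tpow vsubsp_I assms(1,3)] by simp
qed

text \<open>For other representatives \<open>s'\<close>, \<open>t'\<close> the difference
  \<open>s' t' - s t = (s' - s) t + s' (t' - t)\<close> lies in the ideal, so all sets in the union
  defining \<open>qmul\<close> agree.\<close>

lemma qmul_cl:
  assumes s: "s \<in> T m" and t: "t \<in> T n"
  shows "mul m n (cl m s) (cl n t) = cl (m + n) (tmul V s t)"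
proof -
  have "cl (m + n) (tmul V s' t') = cl (m + n) (tmul V s t)" if "s' \<in> cl m s" "t' \<in> cl n t" for s' t'
  proof (rule cl_eqI[symmetric])
    have s': "s' \<in> T m" "s' - s \<in> I m" and t': "t' \<in> T n" "t' - t \<in> I n"
      using that s t mem_cl mem_cl_T by blast+
    show "tmul V s t \<in> T (m + n)" "tmul V s' t' \<in> T (m + n)" using s t s' t' by (auto intro: tmul_in)
    have *: "tmul V s' (t + (t' - t)) = tmul V s' t + tmul V s' (t' - t)"
      using s' t t' I_T by (intro tmul_add_right) auto
    moreover have **: "tmul V (s + (s' - s)) t = tmul V s t + tmul V (s' - s) t"
      using s s' t I_T by (intro tmul_add_left) auto
    ultimately have "tmul V s' t' - tmul V s t = tmul V (s' - s) t + tmul V s' (t' - t)" by simp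
    then show "tmul V s' t' - tmul V s t \<in> I (m + n)"
      using s' t' t tmul_I_left[OF s'(1) t'(2)] tmul_I_right[OF s'(2) t] by (simp add: fv.subspace_add)
  qed
  then show ?thesis using cl_self[OF s] cl_self[OF t] unfolding qmul_def by blast
qed

lemma qmul_in: "X \<in> alg m \<Longrightarrow> Y \<in> alg n \<Longrightarrow> mul m n X Y \<in> alg (m + n)"
  by (auto elim!: qalgE simp: qmul_cl tmul_in)

lemma qmul_assoc: "X \<in> alg l \<Longrightarrow> Y \<in> alg m \<Longrightarrow> Z \<in> alg n \<Longrightarrow>
    mul (l + m) n (mul l m X Y) Z = mul l (m + n) X (mul m n Y Z)"
  by (elim qalgE) (simp add: qmul_cl tmul_in tmul_assoc add.assoc[symmetric] del: add.assoc)

lemma qgen_in: "x \<in> W 1 \<Longrightarrow> gen x \<in> alg 1"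
  unfolding qgen_def using W_T by (intro cl_in)

lemma qmul_vform_left:
  assumes l: "aform (m + n) l" and Y: "Y \<in> alg n"
  shows "aform m (\<lambda>X. l (mul m n X Y))"
  using Y
proof (elim qalgE, intro vlinear_formI; elim qalgE)
  fix t s s' assume "Y = cl n t" "t \<in> T n" "s \<in> T m" "s' \<in> T m"
  then show "\<And>X X'. X = cl m s \<Longrightarrow> X' = cl m s' \<Longrightarrow>
      l (mul m n (vadd (qalg V R m) X X') Y) = l (mul m n X Y) + l (mul m n X' Y)"
    and "\<And>X a. X = cl m s \<Longrightarrow> l (mul m n (vscale (qalg V R m) a X) Y) = a * l (mul m n X Y)"
    using vform_add[OF l, of "cl (m + n) (tmul V s t)" "cl (m + n) (tmul V s' t)"]
      vform_scale[OF l, of "cl (m + n) (tmul V s t)"]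
    by (simp_all add: qalg_ops qmul_cl tmul_in fv.subspace_add fv.subspace_scale tmul_add_left tmul_scale_left)
qed

lemma qmul_vform_right:
  assumes l: "aform (m + n) l" and X: "X \<in> alg m"
  shows "aform n (\<lambda>Y. l (mul m n X Y))"
  using X
proof (elim qalgE, intro vlinear_formI; elim qalgE)
  fix s t t' assume "X = cl m s" "s \<in> T m" "t \<in> T n" "t' \<in> T n"
  then show "\<And>Y Y'. Y = cl n t \<Longrightarrow> Y' = cl n t' \<Longrightarrow>
      l (mul m n X (vadd (qalg V R n) Y Y')) = l (mul m n X Y) + l (mul m n X Y')"
    and "\<And>Y a. Y = cl n t \<Longrightarrow> l (mul m n X (vscale (qalg V R n) a Y)) = a * l (mul m n X Y)"
    using vform_add[OF l, of "cl (m + n) (tmul V s t)" "cl (m + n) (tmul V s t')"]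
      vform_scale[OF l, of "cl (m + n) (tmul V s t)"]
    by (simp_all add: qalg_ops qmul_cl tmul_in fv.subspace_add fv.subspace_scale tmul_add_right tmul_scale_right)
qed

lemma qgen_vform: "aform 1 l \<Longrightarrow> wform 1 (\<lambda>x. l (gen x))"
  using vform_add[of "qalg V R 1" l] vform_scale[of "qalg V R 1" l]
  by (intro vlinear_formI) (simp_all add: qgen_def W_T flip: qalg_ops(3,4))

text \<open>Descends a form on tensors to the quotient. The form kills the ideal, so its value at a
  chosen representative is the value at any other.\<close>

lemma rep_form:
  assumes l: "vlinear (tpow V m) vfield l" "\<And>x. x \<in> I m \<Longrightarrow> l x = 0"
  shows "s \<in> T m \<Longrightarrow> l (SOME t. t \<in> cl m s) = l s"
    and "aform m (\<lambda>X. l (SOME t. t \<in> X))"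
proof -
  show *: "l (SOME t. t \<in> cl m s) = l s" if s: "s \<in> T m" for s
  proof -
    have "(SOME t. t \<in> cl m s) \<in> cl m s" using some_in_eq[of "cl m s"] cl_self[OF s] by auto
    then obtain n where n: "n \<in> I m" "(SOME t. t \<in> cl m s) = s + n" by (auto elim!: vclassE)
    then show ?thesis using vform_add[OF l(1), of s n] s l(2) I_T by auto
  qed
  show "aform m (\<lambda>X. l (SOME t. t \<in> X))"
    using vform_add[OF l(1)] vform_scale[OF l(1)]
    by (intro vlinear_formI; elim qalgE) (auto simp: qalg_ops * fv.subspace_add fv.subspace_scale)
qed

text \<open>By \<open>separate\<close> the ideal is cut out by forms on tensors, and each of them
  descends to the quotient by \<open>rep_form\<close>. Hence forms on the quotient separate
  cosets.\<close>

lemma vsp_qalg [simp]: "vsp (qalg V R m)"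
proof (rule vspI)
  fix X Y assume "X \<in> alg m" "Y \<in> alg m"
    and eq: "\<And>l. aform m l \<Longrightarrow> l X = l Y"
  then obtain s t where s: "s \<in> T m" "X = cl m s" and t: "t \<in> T m" "Y = cl m t" by (auto simp: qalg_ops)
  have "t - s \<in> I m"
  proof (rule separate[OF subspace_I I_T])
    fix a assume a: "\<And>x. x \<in> I m \<Longrightarrow> (\<Sum>I\<in>wd m. a I * cf x I) = 0"
    have "vlinear (tpow V m) vfield (\<lambda>x. \<Sum>I\<in>wd m. a I * cf x I)"
      by (rule vform_comb) (simp add: vlinear_def)
    note * = rep_form[OF this a]
    show "(\<Sum>I\<in>wd m. a I * cf (t - s) I) = 0"
      using eq[OF *(2)] s t by (simp add: * right_diff_distrib sum_subtractf)
  qed (use s t in \<open>simp_all add: fv.subspace_diff\<close>)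
  with s t show "X = Y" by (simp add: cl_eqI)
qed (auto elim!: qalgE simp: qalg_ops fv.subspace_0 fv.subspace_add fv.subspace_scale)

lemma form_cl:
  assumes l: "aform m l"
  shows "vlinear (tpow V m) vfield (\<lambda>s. l (cl m s))" and "s \<in> I m \<Longrightarrow> l (cl m s) = 0"
proof -
  show "vlinear (tpow V m) vfield (\<lambda>s. l (cl m s))"
    using vform_add[OF l] vform_scale[OF l]
    by (intro vlinear_formI) (auto simp flip: qalg_ops(3,4))
  assume s: "s \<in> I m"
  then have "cl m s = cl m 0" using I_T by (intro cl_eqI) (auto simp: fv.subspace_0 fv.subspace_neg)
  then show "l (cl m s) = 0" using vform_zero[OF vsp_qalg l] by (simp add: qalg_ops)
qed

end

section \<open>Duality\<close>

text \<open>Both algebras are instances of \<open>quad\<close> over the same \<open>d\<close>, so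
  all results so far hold for A and for A^!, and the same words index tensors on both sides. The
  last assumption says that the two bases are dual to each other.\<close>

locale qdual = A: quad V d e c R + B: quad V' d e' c' R'
  for V :: "('k::field, 'a) vspace" and d e c R and V' :: "('k, 'a \<Rightarrow> 'k) vspace" and e' c' R' +
  assumes V': "V' = vdual V" and R': "R' = rperp V R"
    and e'_e: "i < d \<Longrightarrow> j < d \<Longrightarrow> e' i (e j) = (if i = j then 1 else 0)"
begin

abbreviation K where "K \<equiv> Kch V R"
abbreviation Kc where "Kc q n \<equiv> vcar (Kch V R q n)"
abbreviation kforms where "kforms n q \<equiv> bforms (qalg V R n) (qW V R q)"
abbreviation kpure where "kpure \<equiv> Kpure V R"
abbreviation dK where "dK \<equiv> bKh V R"
abbreviation ph where "ph \<equiv> phiA V R"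

lemma V'_linear: "\<xi> \<in> vcar V' \<Longrightarrow> vlinear V vfield \<xi>"
  and eval_linear: "x \<in> vcar V \<Longrightarrow> vlinear V' vfield (\<lambda>\<xi>. \<xi> x)"
  by (simp_all add: V' vcar_vdual vdual_eval)

lemma R'_iff: "t \<in> R' \<longleftrightarrow> t \<in> B.T 2 \<and> (\<forall>r\<in>R. tpair t r = 0)"
  by (simp add: R' rperp_def V')

definition pr :: "('a \<Rightarrow> 'k) list \<Rightarrow> 'a list \<Rightarrow> 'k" where
  "pr \<xi>s xs = (if length \<xi>s = length xs then prod_list (map2 (\<lambda>\<xi> x. \<xi> x) \<xi>s xs) else 0)"

lemma pr_Cons: "pr (\<xi> # \<xi>s) (x # xs) = \<xi> x * pr \<xi>s xs"
  by (simp add: pr_def)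

lemma pr_append: "length \<xi>s = length xs \<Longrightarrow> pr (\<xi>s @ \<xi>s') (xs @ xs') = pr \<xi>s xs * pr \<xi>s' xs'"
  by (auto simp: pr_def)

lemma pr_e: "I \<in> A.wd m \<Longrightarrow> J \<in> A.wd m \<Longrightarrow> pr (map e' I) (map e J) = (if I = J then 1 else 0)"
proof (induction m arbitrary: I J)
  case (Suc m)
  then obtain i I' j J' where "I = i # I'" "J = j # J'" "i < d" "j < d" "I' \<in> A.wd m" "J' \<in> A.wd m"
    by (auto simp: words_def length_Suc_conv)
  with Suc show ?case by (simp add: pr_Cons e'_e)
qed (simp add: pr_def)

lemma pr_mforms:
  assumes \<xi>s: "\<xi>s \<in> lists (vcar V')"
  shows "pr \<xi>s \<in> mforms V"
  unfolding mforms_def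
proof (safe, goal_cases)
  case (1 ys zs)
  show ?case
  proof (cases "length \<xi>s = length ys + Suc (length zs)")
    case True
    define n where "n = length ys"
    have n: "n < length \<xi>s" using True by (simp add: n_def)
    have "pr \<xi>s (ys @ x # zs) = pr (take n \<xi>s) ys * pr (drop (Suc n) \<xi>s) zs * (\<xi>s ! n) x" for x
    proof -
      have "pr (take n \<xi>s @ (\<xi>s ! n) # drop (Suc n) \<xi>s) (ys @ x # zs)
          = pr (take n \<xi>s) ys * pr (\<xi>s ! n # drop (Suc n) \<xi>s) (x # zs)"
        using n by (intro pr_append) (simp add: n_def)
      then show ?thesis using id_take_nth_drop[OF n] by (simp add: pr_Cons)
    qed
    moreover have "\<xi>s ! n \<in> vcar V'" using \<xi>s n by (auto simp: in_lists_conv_set)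
    ultimately show ?thesis by (simp add: vform_scaled V'_linear)
  next
    case False
    then have "pr \<xi>s (ys @ x # zs) = 0" for x by (auto simp: pr_def)
    then show ?thesis by (simp add: vlinear_def)
  qed
qed

lemma pr_mforms':
  assumes xs: "xs \<in> lists (vcar V)"
  shows "(\<lambda>\<xi>s. pr \<xi>s xs) \<in> mforms V'"
  unfolding mforms_def
proof (safe, goal_cases)
  case (1 ys zs)
  show ?case
  proof (cases "length xs = length ys + Suc (length zs)")
    case True
    define n where "n = length ys"
    have n: "n < length xs" using True by (simp add: n_def)
    have "pr (ys @ \<xi> # zs) xs = pr ys (take n xs) * pr zs (drop (Suc n) xs) * \<xi> (xs ! n)" for \<xi>
    proof -
      have "pr (ys @ \<xi> # zs) (take n xs @ (xs ! n) # drop (Suc n) xs)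
          = pr ys (take n xs) * pr (\<xi> # zs) (xs ! n # drop (Suc n) xs)"
        using n by (intro pr_append) (simp add: n_def)
      then show ?thesis using id_take_nth_drop[OF n] by (simp add: pr_Cons)
    qed
    moreover have "xs ! n \<in> vcar V" using xs n by (auto simp: in_lists_conv_set)
    ultimately show ?thesis by (simp add: vform_scaled eval_linear)
  next
    case False
    then have "pr (ys @ \<xi> # zs) xs = 0" for \<xi> by (auto simp: pr_def)
    then show ?thesis by (simp add: vlinear_def)
  qed
qed

text \<open>Words in the dual bases pair to 0 or 1, so the pairing is the dot product of coefficient
  families. As in \<open>tmul_mk\<close>, the inner function has to be recognised as multilinear
  before \<open>t\<close> can be expanded at it.\<close>

lemma tpair_cf:
  assumes t: "t \<in> B.T m" and s: "s \<in> A.T m"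
  shows "tpair t s = (\<Sum>I\<in>A.wd m. B.cf t I * A.cf s I)"
proof -
  define \<Phi> where "\<Phi> = (\<lambda>\<xi>s. s (pr \<xi>s))"
  have \<Phi>: "\<Phi> \<xi>s = (\<Sum>I\<in>A.wd m. A.cf s I * pr \<xi>s (map e I))" if "\<xi>s \<in> lists (vcar V')" for \<xi>s
    unfolding \<Phi>_def using A.tensor_expand[OF s pr_mforms[OF that]] .
  have "\<Phi> \<in> mforms V'"
    unfolding mforms_def
  proof (safe, goal_cases)
    case (1 ys zs)
    have "vlinear V' vfield (\<lambda>\<xi>. \<Sum>I\<in>A.wd m. A.cf s I * pr (ys @ \<xi> # zs) (map e I))"
      using 1 A.e_lists pr_mforms' by (intro vform_comb mforms_vlinear[where \<phi> = "\<lambda>\<xi>s. pr \<xi>s (map e _)"]) auto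
    then show ?case
    proof (rule vform_cong)
      fix \<xi> assume "\<xi> \<in> vcar V'"
      then have "ys @ \<xi> # zs \<in> lists (vcar V')" using 1 by auto
      from \<Phi>[OF this] show "(\<Sum>I\<in>A.wd m. A.cf s I * pr (ys @ \<xi> # zs) (map e I)) = \<Phi> (ys @ \<xi> # zs)" by simp
    qed (use B.vsp_V in auto)
  qed
  have "tpair t s = t \<Phi>"
    unfolding tpair_def \<Phi>_def pr_def ..
  also have "\<dots> = (\<Sum>J\<in>A.wd m. B.cf t J * \<Phi> (map e' J))"
    by (rule B.tensor_expand[OF t \<open>\<Phi> \<in> mforms V'\<close>])
  also have "\<dots> = (\<Sum>J\<in>A.wd m. B.cf t J * (\<Sum>I\<in>A.wd m. A.cf s I * (if J = I then 1 else 0)))"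
    by (intro sum.cong refl) (simp add: \<Phi> B.e_lists pr_e)
  finally show ?thesis
    by (simp add: if_distrib[of "(*) _"] cong: if_cong)
qed

lemma tpair_linear_right: "t \<in> B.T m \<Longrightarrow> vlinear (tpow V m) vfield (tpair t)"
  by (rule vform_cong[where l = "\<lambda>s. \<Sum>I\<in>A.wd m. B.cf t I * A.cf s I"], rule vform_comb)
     (simp_all add: tpair_cf fv.subspace_add fv.subspace_scale vlinear_def)

lemma tpair_linear_left: "vlinear (tpow V' m) vfield (\<lambda>t. tpair t s)"
  by (simp add: vlinear_def tpair_def fscale_def)

lemma tpair_tmul: "t \<in> B.T m \<Longrightarrow> b \<in> B.T n \<Longrightarrow> s \<in> A.T m \<Longrightarrow> w \<in> A.T n \<Longrightarrow>
    tpair (tmul V' t b) (tmul V s w) = tpair t s * tpair b w"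
  by (simp add: tpair_cf[where m = "m + n"] tpair_cf A.tmul_in B.tmul_in sum_words_add
      A.cf_tmul[where m = m and n = n] B.cf_tmul[where m = m and n = n] sum_product)
     (simp add: algebra_simps)

text \<open>Adjunction: pairing \<open>\<omega>\<close> with a product around \<open>r\<close>
  amounts to contracting \<open>\<omega>\<close> on both sides and pairing the remaining two letters
  with \<open>r\<close>.\<close>

lemma tpair_rels_right:
  assumes "\<omega> \<in> B.T (i + 2 + j)" "a \<in> A.T i" "r \<in> A.T 2" "b \<in> A.T j"
  shows "tpair \<omega> (tmul V a (tmul V r b))
    = (\<Sum>I\<in>A.wd i. \<Sum>J\<in>A.wd j. A.cf a I * A.cf b J * tpair (B.mid I J \<omega>) r)"
proof -
  have "tmul V a (tmul V r b) \<in> A.T (i + (2 + j))" using assms by (intro A.tmul_in)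
  then have "tpair \<omega> (tmul V a (tmul V r b)) = (\<Sum>I\<in>A.wd i. \<Sum>K\<in>A.wd 2. \<Sum>J\<in>A.wd j.
      B.cf \<omega> (I @ K @ J) * (A.cf a I * A.cf r K * A.cf b J))"
    using assms(1) unfolding add.assoc
    by (simp only: tpair_cf sum_words_add) (intro sum.cong refl, simp add: A.cf_tmul3[where i = i and j = j] assms)
  also have "\<dots> = (\<Sum>I\<in>A.wd i. \<Sum>J\<in>A.wd j. A.cf a I * A.cf b J * tpair (B.mid I J \<omega>) r)"
    by (rule sum.cong[OF refl], subst sum.swap)
       (simp add: tpair_cf[OF B.mid_in assms(3)] sum_distrib_left algebra_simps)
  finally show ?thesis .
qed

lemma tpair_rels_left:
  assumes "w \<in> A.T (i + 2 + j)" "a \<in> B.T i" "r \<in> B.T 2" "b \<in> B.T j"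
  shows "tpair (tmul V' a (tmul V' r b)) w
    = (\<Sum>I\<in>A.wd i. \<Sum>J\<in>A.wd j. B.cf a I * B.cf b J * tpair r (A.mid I J w))"
proof -
  have "tmul V' a (tmul V' r b) \<in> B.T (i + (2 + j))" using assms by (intro B.tmul_in)
  then have "tpair (tmul V' a (tmul V' r b)) w = (\<Sum>I\<in>A.wd i. \<Sum>K\<in>A.wd 2. \<Sum>J\<in>A.wd j.
      (B.cf a I * B.cf r K * B.cf b J) * A.cf w (I @ K @ J))"
    using assms(1) unfolding add.assoc
    by (simp only: tpair_cf sum_words_add) (intro sum.cong refl, simp add: B.cf_tmul3[where i = i and j = j] assms)
  also have "\<dots> = (\<Sum>I\<in>A.wd i. \<Sum>J\<in>A.wd j. B.cf a I * B.cf b J * tpair r (A.mid I J w))"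
    by (rule sum.cong[OF refl], subst sum.swap)
       (simp add: tpair_cf[OF assms(3) A.mid_in] sum_distrib_left algebra_simps)
  finally show ?thesis .
qed

text \<open>The double orthogonal of \<open>R\<close> is \<open>R\<close>. A form on tensors of
  weight 2 vanishing on \<open>R\<close> is the pairing with the tensor \<open>B.mk 2 a\<close> of
  its coefficients, which lies in \<open>R'\<close>; \<open>separate\<close> does the rest.\<close>

lemma R_perp:
  assumes x: "x \<in> A.T 2" and "\<And>t. t \<in> R' \<Longrightarrow> tpair t x = 0"
  shows "x \<in> R"
proof (rule A.separate[OF A.R_subspace A.R_in x])
  fix a assume a: "\<And>r. r \<in> R \<Longrightarrow> (\<Sum>I\<in>A.wd 2. a I * A.cf r I) = 0"
  have *: "tpair (B.mk 2 a) y = (\<Sum>I\<in>A.wd 2. a I * A.cf y I)" if "y \<in> A.T 2" for y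
    using that by (simp add: tpair_cf[where m = 2])
  have "B.mk 2 a \<in> R'"
    unfolding R'_iff
  proof (intro conjI ballI)
    fix r assume "r \<in> R"
    then show "tpair (B.mk 2 a) r = 0" using a[of r] *[OF subsetD[OF A.R_in]] by simp
  qed simp
  from assms(2)[OF this] show "(\<Sum>I\<in>A.wd 2. a I * A.cf x I) = 0" by (simp only: *[OF x])
qed

lemma sum_eI2:
  "I0 \<in> A.wd i \<Longrightarrow> J0 \<in> A.wd j \<Longrightarrow>
    (\<Sum>I\<in>A.wd i. \<Sum>J\<in>A.wd j. A.cf (A.eI I0) I * A.cf (A.eI J0) J * f I J) = (f I0 J0 :: 'k)"
  "I0 \<in> A.wd i \<Longrightarrow> J0 \<in> A.wd j \<Longrightarrow>
    (\<Sum>I\<in>A.wd i. \<Sum>J\<in>A.wd j. B.cf (B.eI I0) I * B.cf (B.eI J0) J * f I J) = (f I0 J0 :: 'k)"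
  unfolding mult.assoc sum_distrib_left[symmetric]
  by (simp_all add: A.cf_eI[of _ i] A.cf_eI[of _ j] B.cf_eI[of _ i] B.cf_eI[of _ j]
      if_distrib[of "\<lambda>x. x * _"] cong: if_cong)

lemma mform_span_zero:
  assumes "vlinear (fsub S) vfield l" "fv.subspace S" "G \<subseteq> S" "\<And>g. g \<in> G \<Longrightarrow> l g = 0" "x \<in> fspan G"
  shows "l x = 0"
proof -
  have "fspan G \<subseteq> S" using assms by (intro fspan_minimal)
  then have "vlinear (fsub (fspan G)) vfield l" using assms(1) by (auto simp: vlinear_def subset_iff)
  then show ?thesis
    using vform_span_eq[of G l "\<lambda>_. 0" x] assms by (simp add: vlinear_def)
qed

text \<open>By adjunction the pairings with V^i R V^j are combinations of pairings of
  \<open>R\<close> with contractions of \<open>\<omega>\<close>. For the converse, basis words on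
  both sides of \<open>r\<close> isolate a single contraction.\<close>

lemma W_perp_right:
  assumes "\<omega> \<in> B.T m"
  shows "\<omega> \<in> B.W m \<longleftrightarrow> (\<forall>s\<in>A.I m. tpair \<omega> s = 0)"
proof
  assume w: "\<omega> \<in> B.W m"
  have "tpair \<omega> x = 0" if x: "x \<in> rels V R i j" "i + 2 + j = m" for x i j
  proof -
    obtain a r b where *: "x = tmul V a (tmul V r b)" "a \<in> A.T i" "r \<in> R" "b \<in> A.T j"
      using x by (auto simp: rels_def)
    have "B.mid I J \<omega> \<in> R'" if "I \<in> A.wd i" "J \<in> A.wd j" for I J
      using w x(2) that unfolding B.W_iff by blast
    then have "tpair (B.mid I J \<omega>) r = 0" if "I \<in> A.wd i" "J \<in> A.wd j" for I J
      using that *(3) by (simp add: R'_iff)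
    then show ?thesis using * assms A.R_in x(2) by (subst *(1), subst tpair_rels_right) auto
  qed
  then have 1: "\<And>x. x \<in> \<Union> {rels V R i j |i j. i + 2 + j = m} \<Longrightarrow> tpair \<omega> x = 0" by blast
  have 2: "\<Union> {rels V R i j |i j. i + 2 + j = m} \<subseteq> A.T m" using A.rels_in by blast
  have "vlinear (fsub (A.T m)) vfield (tpair \<omega>)" using tpair_linear_right[OF assms] by simp
  from mform_span_zero[OF this subspace_tpow 2 1] show "\<forall>s\<in>A.I m. tpair \<omega> s = 0"
    unfolding qideal_def by blast
next
  assume *: "\<forall>s\<in>A.I m. tpair \<omega> s = 0"
  have "B.mid I J \<omega> \<in> R'" if ij: "i + 2 + j = m" "I \<in> A.wd i" "J \<in> A.wd j" for i j I J
  proof -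
    have "tpair (B.mid I J \<omega>) r = 0" if r: "r \<in> R" for r
    proof -
      have "tmul V (A.eI I) (tmul V r (A.eI J)) \<in> A.I m"
        using \<open>i + 2 + j = m\<close> \<open>I \<in> A.wd i\<close> \<open>J \<in> A.wd j\<close> r
        by (intro A.rels_I[of _ i j] A.relsI) auto
      then have "tpair \<omega> (tmul V (A.eI I) (tmul V r (A.eI J))) = 0" using * by blast
      then show ?thesis
        using ij r A.R_in assms tpair_rels_right[of \<omega> i j "A.eI I" r "A.eI J"]
          sum_eI2(1)[of I i J j "\<lambda>I J. tpair (B.mid I J \<omega>) r"] by auto
    qed
    then show ?thesis by (simp add: R'_iff)
  qed
  then show "\<omega> \<in> B.W m" using assms by (simp add: B.W_iff)
qed

text \<open>The same adjunction on the other side. Its converse needs \<open>R_perp\<close>, since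
  only \<open>R'\<close> is defined as an orthogonal.\<close>

lemma W_perp_left:
  assumes "w \<in> A.T m"
  shows "w \<in> A.W m \<longleftrightarrow> (\<forall>t\<in>B.I m. tpair t w = 0)"
proof
  assume w: "w \<in> A.W m"
  have "tpair x w = 0" if x: "x \<in> rels V' R' i j" "i + 2 + j = m" for x i j
  proof -
    obtain a r b where *: "x = tmul V' a (tmul V' r b)" "a \<in> B.T i" "r \<in> R'" "b \<in> B.T j"
      using x by (auto simp: rels_def)
    have "A.mid I J w \<in> R" if "I \<in> A.wd i" "J \<in> A.wd j" for I J
      using w x(2) that unfolding A.W_iff by blast
    then have "tpair r (A.mid I J w) = 0" if "I \<in> A.wd i" "J \<in> A.wd j" for I J
      using that *(3) by (simp add: R'_iff)
    then show ?thesis using * assms B.R_in x(2) by (subst *(1), subst tpair_rels_left) auto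
  qed
  then have 1: "\<And>x. x \<in> \<Union> {rels V' R' i j |i j. i + 2 + j = m} \<Longrightarrow> tpair x w = 0" by blast
  have 2: "\<Union> {rels V' R' i j |i j. i + 2 + j = m} \<subseteq> B.T m" using B.rels_in by blast
  have "vlinear (fsub (B.T m)) vfield (\<lambda>t. tpair t w)" using tpair_linear_left[of m w] by simp
  from mform_span_zero[OF this subspace_tpow 2 1] show "\<forall>t\<in>B.I m. tpair t w = 0"
    unfolding qideal_def by blast
next
  assume *: "\<forall>t\<in>B.I m. tpair t w = 0"
  have "A.mid I J w \<in> R" if "i + 2 + j = m" "I \<in> A.wd i" "J \<in> A.wd j" for i j I J
  proof (rule R_perp[OF A.mid_in])
    fix r assume r: "r \<in> R'"
    have "tmul V' (B.eI I) (tmul V' r (B.eI J)) \<in> B.I m"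
      using that r by (intro B.rels_I[of _ i j] B.relsI) auto
    then have "tpair (tmul V' (B.eI I) (tmul V' r (B.eI J))) w = 0" using * by blast
    then show "tpair r (A.mid I J w) = 0"
      using that r B.R_in assms tpair_rels_left[of w i j "B.eI I" r "B.eI J"]
        sum_eI2(2)[of I i J j "\<lambda>I J. tpair r (A.mid I J w)"] by auto
  qed
  then show "w \<in> A.W m" using assms by (simp add: A.W_iff)
qed

section \<open>The perfect pairings of W^! with A and of A^! with W\<close>

lemma tpair_mk: "s \<in> A.T m \<Longrightarrow> tpair (B.mk m a) s = (\<Sum>I\<in>A.wd m. a I * A.cf s I)"
  and tpair_mk': "t \<in> B.T m \<Longrightarrow> tpair t (A.mk m a) = (\<Sum>I\<in>A.wd m. a I * B.cf t I)"
  by (simp_all add: tpair_cf[where m = m] mult.commute)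

lemma form_T: "vlinear (tpow V m) vfield l \<Longrightarrow> s \<in> A.T m \<Longrightarrow> tpair (B.mk m (\<lambda>I. l (A.eI I))) s = l s"
  using vform_fsub_sum[of "A.T m" l "A.wd m" A.eI "A.cf s"]
  by (simp add: tpair_mk mult.commute flip: A.tensor_sum)

lemma form_T': "vlinear (tpow V' m) vfield l \<Longrightarrow> t \<in> B.T m \<Longrightarrow> tpair t (A.mk m (\<lambda>I. l (B.eI I))) = l t"
  using vform_fsub_sum[of "B.T m" l "B.wd m" B.eI "B.cf t"]
  by (simp add: tpair_mk' mult.commute flip: B.tensor_sum)

text \<open>The retraction \<open>A.Pj\<close> extends a form from \<open>A.W m\<close> to all
  tensors, where it is a pairing. This produces the class in A^! that makes up the transpose of a
  cochain.\<close>

lemma form_W: "A.wform m l \<Longrightarrow> w \<in> A.W m \<Longrightarrow> tpair (B.mk m (\<lambda>I. l (A.Pj m (A.eI I)))) w = l w"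
  using vform_fsub_sum[of "A.W m" l "A.wd m" "\<lambda>I. A.Pj m (A.eI I)" "A.cf w"]
  by (simp add: tpair_mk A.W_T A.Pj(2) mult.commute flip: A.Pj_sum)

definition evA :: "('k, 'a \<Rightarrow> 'k) tensor \<Rightarrow> ('k, 'a) tensor set \<Rightarrow> 'k" where
  "evA \<omega> X = tpair \<omega> (SOME s. s \<in> X)"

definition evB :: "('k, 'a \<Rightarrow> 'k) tensor set \<Rightarrow> ('k, 'a) tensor \<Rightarrow> 'k" where
  "evB X w = tpair (SOME t. t \<in> X) w"

text \<open>The chosen representative does not matter, because an element of W^! annihilates the
  relation ideal by \<open>W_perp_right\<close>.\<close>

lemma evA_cl: "\<omega> \<in> B.W m \<Longrightarrow> s \<in> A.T m \<Longrightarrow> evA \<omega> (A.cl m s) = tpair \<omega> s"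
  and evA_linear: "\<omega> \<in> B.W m \<Longrightarrow> A.aform m (evA \<omega>)"
  using A.rep_form[OF tpair_linear_right[OF B.W_T], of \<omega> m] W_perp_right[OF B.W_T, of \<omega> m]
  unfolding evA_def by auto

lemma evB_cl: "w \<in> A.W m \<Longrightarrow> t \<in> B.T m \<Longrightarrow> evB (B.cl m t) w = tpair t w"
  and evB_linear: "w \<in> A.W m \<Longrightarrow> B.aform m (\<lambda>b. evB b w)"
  using B.rep_form[OF tpair_linear_left, of m w] W_perp_left[OF A.W_T, of w m]
  unfolding evB_def by auto

lemma evA_linear_left: "X \<in> A.alg m \<Longrightarrow> B.wform m (\<lambda>\<omega>. evA \<omega> X)"
  unfolding evA_def by (rule B.vform_T_W[OF tpair_linear_left])

lemma evB_linear_right: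
  assumes "b \<in> B.alg m"
  shows "A.wform m (evB b)"
proof -
  obtain t where t: "t \<in> B.T m" "b = B.cl m t" using assms by (auto elim: B.qalgE)
  have "A.wform m (tpair t)" by (rule A.vform_T_W[OF tpair_linear_right[OF t(1)]])
  then show ?thesis
    by (rule vform_cong) (simp_all add: t evB_cl fv.subspace_add fv.subspace_scale)
qed

text \<open>Pulled back to tensors, \<open>l\<close> is the pairing with its own coefficient tensor.
  It kills the ideal, so that tensor lies in W^!. This is surjectivity of W^!_m onto the dual of
  A_m.\<close>

lemma formA:
  assumes l: "A.aform m l"
  obtains \<omega> where "\<omega> \<in> B.W m" "\<And>X. X \<in> A.alg m \<Longrightarrow> l X = evA \<omega> X"
proof -
  let ?w = "B.mk m (\<lambda>I. l (A.cl m (A.eI I)))"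
  note * = form_T[OF A.form_cl(1)[OF l]] A.form_cl(2)[OF l]
  have "tpair ?w s = 0" if "s \<in> A.I m" for s
    using *(1)[OF subsetD[OF A.I_T that]] *(2)[OF that] by simp
  then have "?w \<in> B.W m" by (simp add: W_perp_right)
  then show thesis using * by (intro that[of ?w]) (auto elim!: A.qalgE simp: evA_cl)
qed

text \<open>The counterpart for A^!: its forms are evaluations at elements of \<open>W\<close>. It
  yields both the surjectivity of \<open>theta\<close> and the injectivity in
  \<open>evB_eqI\<close>.\<close>

lemma formB:
  assumes l: "B.aform m l"
  obtains w where "w \<in> A.W m" "\<And>b. b \<in> B.alg m \<Longrightarrow> l b = evB b w"
proof -
  let ?w = "A.mk m (\<lambda>I. l (B.cl m (B.eI I)))"
  note * = form_T'[OF B.form_cl(1)[OF l]] B.form_cl(2)[OF l]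
  have "tpair t ?w = 0" if "t \<in> B.I m" for t
    using *(1)[OF subsetD[OF B.I_T that]] *(2)[OF that] by simp
  then have "?w \<in> A.W m" by (simp add: W_perp_left)
  then show thesis using * by (intro that[of ?w]) (auto elim!: B.qalgE simp: evB_cl)
qed

text \<open>Forms separate A^!, and by \<open>formB\<close> each of them is an evaluation at some
  \<open>w\<close>.\<close>

lemma evB_eqI:
  assumes "b \<in> B.alg m" "b' \<in> B.alg m" "\<And>w. w \<in> A.W m \<Longrightarrow> evB b w = evB b' w"
  shows "b = b'"
  using assms by (intro vsp_eqI[OF B.vsp_qalg assms(1,2)]) (metis formB)

end

section \<open>Koszul cochains\<close>

text \<open>Testing on all forms would be unwieldy where few suffice: evaluations at elements for
  dual spaces, at a pair \<open>u\<close>, \<open>b\<close> for cochains with dual values, at the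
  forms \<open>fm\<close> for chains.\<close>

definition sepset :: "('k::field, 'a) vspace \<Rightarrow> ('a \<Rightarrow> 'k) set \<Rightarrow> bool" where
  "sepset Y L \<longleftrightarrow> (\<forall>l\<in>L. vlinear Y vfield l) \<and>
    (\<forall>x\<in>vcar Y. \<forall>y\<in>vcar Y. (\<forall>l\<in>L. l x = l y) \<longrightarrow> x = y)"

lemma sepset_eqI: "sepset Y L \<Longrightarrow> x \<in> vcar Y \<Longrightarrow> y \<in> vcar Y \<Longrightarrow> (\<And>l. l \<in> L \<Longrightarrow> l x = l y) \<Longrightarrow> x = y"
  unfolding sepset_def by blast

lemma sepset_linear: "sepset Y L \<Longrightarrow> l \<in> L \<Longrightarrow> vlinear Y vfield l"
  unfolding sepset_def by blast

lemma sepset_all: "vsp Y \<Longrightarrow> sepset Y {l. vlinear Y vfield l}"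
  unfolding sepset_def using vsp_eqI by fastforce

lemma sepset_vdual: "sepset (vdual U) ((\<lambda>x f. f x) ` vcar U)"
  unfolding sepset_def by (auto intro: vdual_eval vdual_ext)

text \<open>Additivity and homogeneity are equations in \<open>Y\<close>, so they too need only be
  tested on the separating family.\<close>

lemma vlinear_sepI:
  assumes U: "vsp U" and Y: "vsp Y" "sepset Y L" and f: "\<And>x. x \<in> vcar U \<Longrightarrow> f x \<in> vcar Y"
    and l: "\<And>l. l \<in> L \<Longrightarrow> vlinear U vfield (\<lambda>x. l (f x))"
  shows "vlinear U Y f"
  unfolding vlinear_def
proof (intro conjI ballI allI)
  fix x y assume xy: "x \<in> vcar U" "y \<in> vcar U"
  show "f (vadd U x y) = vadd Y (f x) (f y)"
    using xy U Y f sepset_linear[OF Y(2)] vform_add[OF l]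
    by (intro sepset_eqI[OF Y(2)]) (simp_all add: vform_add)
next
  fix a x assume x: "x \<in> vcar U"
  show "f (vscale U a x) = vscale Y a (f x)"
    using x U Y f sepset_linear[OF Y(2)] vform_scale[OF l]
    by (intro sepset_eqI[OF Y(2)]) (simp_all add: vform_scale)
qed

lemma vhom_sepI:
  assumes "vsp U" "vsp Y" "sepset Y L" "\<And>x. x \<in> vcar U \<Longrightarrow> f x \<in> vcar Y" "\<And>x. x \<notin> vcar U \<Longrightarrow> f x = undefined"
    and "\<And>l. l \<in> L \<Longrightarrow> vlinear U vfield (\<lambda>x. l (f x))"
  shows "f \<in> vcar (vhom U Y)"
  using assms by (intro vhomI vlinear_sepI[where L = L])

lemma bforms_sepI:
  assumes U: "vsp U" and W: "vsp W" and Y: "vsp Y" "sepset Y L"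
    and b: "\<And>u w. u \<in> vcar U \<Longrightarrow> w \<in> vcar W \<Longrightarrow> \<beta> u w \<in> vcar Y"
    and L: "\<And>l. l \<in> L \<Longrightarrow> (\<lambda>u w. l (\<beta> u w)) \<in> bforms U W"
    and l: "vlinear Y vfield l"
  shows "(\<lambda>u w. l (\<beta> u w)) \<in> bforms U W"
proof (rule bformsI)
  have comp: "vlinear S vfield (\<lambda>x. l (f x))" if "vlinear S Y f" "\<And>x. x \<in> vcar S \<Longrightarrow> f x \<in> vcar Y" for S f
    using that vform_add[OF l] vform_scale[OF l] by (intro vlinear_formI) (simp_all add: vlinear_def)
  show "vlinear W vfield (\<lambda>w. l (\<beta> u w))" if "u \<in> vcar U" for u
    using that b bforms_right[OF L] by (intro comp vlinear_sepI[OF W Y]) auto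
  show "vlinear U vfield (\<lambda>u. l (\<beta> u w))" if "w \<in> vcar W" for w
    using that b bforms_left[OF L] by (intro comp vlinear_sepI[OF U Y]) auto
qed

context quad
begin

lemma binto_sepI:
  assumes "vsp Y" "sepset Y L" "\<And>u v. u \<in> W p \<Longrightarrow> v \<in> W q \<Longrightarrow> \<beta> u v \<in> vcar Y"
    and "\<And>l. l \<in> L \<Longrightarrow> (\<lambda>u v. l (\<beta> u v)) \<in> wforms p q"
  shows "binto Y p q \<beta>"
  unfolding binto_def using assms by (auto intro: bforms_sepI[OF vsp_qW vsp_qW assms(1,2)])

lemma Lam_param:
  assumes "w \<in> W (p + q)" "\<And>u v. u \<in> W p \<Longrightarrow> v \<in> W q \<Longrightarrow> vlinear U vfield (\<lambda>a. F a u v)"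
  shows "vlinear U vfield (\<lambda>a. Lam p q (F a) w)"
proof -
  have "vlinear U vfield (\<lambda>a. \<Sum>J\<in>wd q. 1 * F a (ctr p J w) (Pj q (eI J)))"
    using assms by (intro vform_comb) (simp add: ctr_W Pj)
  then show ?thesis by (simp add: Lam_def)
qed

text \<open>Linear maps from \<open>W p\<close> to the algebra with no condition outside
  \<open>W p\<close>. Unlike membership in \<open>vhom\<close> this admits \<open>gen\<close>, which
  is not restricted to the carrier, so generators and cochains can be treated alike.\<close>

definition linq :: "nat \<Rightarrow> nat \<Rightarrow> (('k, 'a) tensor \<Rightarrow> ('k, 'a) tensor set) \<Rightarrow> bool" where
  "linq p m F \<longleftrightarrow> (\<forall>u\<in>W p. F u \<in> alg m) \<and>
    (\<forall>l. aform m l \<longrightarrow> wform p (\<lambda>u. l (F u)))"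

lemma linq_in: "linq p m F \<Longrightarrow> u \<in> W p \<Longrightarrow> F u \<in> alg m"
  and linq_form: "linq p m F \<Longrightarrow> aform m l \<Longrightarrow> wform p (\<lambda>u. l (F u))"
  by (simp_all add: linq_def)

lemma linq_vhom: "F \<in> vcar (vhom (qW V R p) (qalg V R m)) \<Longrightarrow> linq p m F"
  by (simp add: linq_def vhom_in vform_vhom)

lemma linq_qgen: "linq 1 1 (gen)"
  unfolding linq_def using qgen_in qgen_vform by blast

lemma bforms_qmul:
  assumes F: "linq p m F" and G: "linq q n G" and l: "aform (m + n) l"
  shows "(\<lambda>u v. l (mul m n (F u) (G v))) \<in> wforms p q"
proof (rule bformsI)
  fix u assume "u \<in> W p"
  then show "wform q (\<lambda>v. l (mul m n (F u) (G v)))"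
    by (rule linq_form[OF G qmul_vform_right[OF l linq_in[OF F]]])
next
  fix v assume "v \<in> W q"
  then show "wform p (\<lambda>u. l (mul m n (F u) (G v)))"
    by (rule linq_form[OF F qmul_vform_left[OF l linq_in[OF G]]])
qed

lemma tsplit_qmul:
  assumes F: "linq p m F" and G: "linq q n G" and w: "w \<in> W (p + q)"
  shows "wsplit p q (qalg V R (m + n)) (\<lambda>u v. mul m n (F u) (G v)) w
      \<in> alg (m + n)"
    and "aform (m + n) l \<Longrightarrow>
      l (wsplit p q (qalg V R (m + n)) (\<lambda>u v. mul m n (F u) (G v)) w)
        = Lam p q (\<lambda>u v. l (mul m n (F u) (G v))) w"
proof -
  have "binto (qalg V R (m + n)) p q (\<lambda>u v. mul m n (F u) (G v))"
    unfolding binto_def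
    by (intro conjI ballI allI impI qmul_in linq_in[OF F] linq_in[OF G] bforms_qmul[OF F G])
  note * = tsplit_form[OF vsp_qalg this w]
  show "wsplit p q (qalg V R (m + n)) (\<lambda>u v. mul m n (F u) (G v)) w
      \<in> alg (m + n)" by (rule *(1))
  show "aform (m + n) l \<Longrightarrow>
      l (wsplit p q (qalg V R (m + n)) (\<lambda>u v. mul m n (F u) (G v)) w)
        = Lam p q (\<lambda>u v. l (mul m n (F u) (G v))) w" by (rule *(2))
qed

text \<open>Both differentials on cochains with values in the algebra have this form, with signs
  \<open>\<epsilon> = - ((-1) ^ p)\<close> and \<open>\<epsilon> = - ((-1) ^ m)\<close> respectively.\<close>

definition bK :: "'k \<Rightarrow> nat \<Rightarrow> nat \<Rightarrow> (('k, 'a) tensor \<Rightarrow> ('k, 'a) tensor set) \<Rightarrow>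
    ('k, 'a) tensor \<Rightarrow> ('k, 'a) tensor set" where
  "bK \<epsilon> p m f = (\<lambda>w\<in>W (p + 1). vadd (qalg V R (m + 1))
      (wsplit p 1 (qalg V R (m + 1)) (\<lambda>u x. mul m 1 (f u) (gen x)) w)
      (vscale (qalg V R (m + 1)) \<epsilon>
        (wsplit 1 p (qalg V R (m + 1)) (\<lambda>x u. mul 1 m (gen x) (f u)) w)))"

lemma bKc_bK: "bKc V R p m = bK (- ((-1) ^ p)) p m"
  by (simp add: fun_eq_iff bKc_def bK_def)

lemma bKm_bK: "bKm V R (regular_bimod V R) p m = bK (- ((-1) ^ m)) p m"
  by (simp add: fun_eq_iff bKm_def bK_def regular_bimod_def Let_def)

lemma bK_form:
  assumes f: "linq p m f"
  shows "w \<in> W (p + 1) \<Longrightarrow> aform (m + 1) l \<Longrightarrow> l (bK \<epsilon> p m f w)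
      = Lam p 1 (\<lambda>u x. l (mul m 1 (f u) (gen x))) w
        + \<epsilon> * Lam 1 p (\<lambda>x u. l (mul 1 m (gen x) (f u))) w"
    and "bK \<epsilon> p m f \<in> vcar (vhom (qW V R (p + 1)) (qalg V R (m + 1)))"
proof -
  note 1 = tsplit_qmul[OF f linq_qgen] and 2 = tsplit_qmul[OF linq_qgen f]
  show eq: "l (bK \<epsilon> p m f w) = Lam p 1 (\<lambda>u x. l (mul m 1 (f u) (gen x))) w
        + \<epsilon> * Lam 1 p (\<lambda>x u. l (mul 1 m (gen x) (f u))) w"
    if w: "w \<in> W (p + 1)" and l: "aform (m + 1) l" for l w
  proof -
    have w': "w \<in> W (1 + p)" and l': "aform (1 + m) l" using w l by (simp_all add: add.commute)
    show ?thesis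
      using 1(1)[OF w] 2(1)[OF w'] 1(2)[OF w l] 2(2)[OF w' l'] w l
      by (simp add: bK_def vform_add vform_scale add.commute[of 1 m])
  qed
  show "bK \<epsilon> p m f \<in> vcar (vhom (qW V R (p + 1)) (qalg V R (m + 1)))"
  proof (rule vhom_sepI[OF _ _ sepset_all])
    fix w assume w: "w \<in> vcar (qW V R (p + 1))"
    then have w': "w \<in> W (1 + p)" by (simp add: add.commute)
    show "bK \<epsilon> p m f w \<in> alg (m + 1)"
      using 1(1)[OF w] 2(1)[OF w'] w by (simp add: bK_def add.commute[of 1 m])
  next
    fix l assume "l \<in> {l. aform (m + 1) l}"
    then have l: "aform (m + 1) l" and l': "aform (1 + m) l"
      by (simp_all add: add.commute)
    have "wform (p + 1) (\<lambda>w. Lam p 1 (\<lambda>u x. l (mul m 1 (f u) (gen x))) w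
        + \<epsilon> * Lam 1 p (\<lambda>x u. l (mul 1 m (gen x) (f u))) w)"
      using Lam_vlinear(2)[OF bforms_qmul[OF f linq_qgen l]] Lam_vlinear(2)[OF bforms_qmul[OF linq_qgen f l']]
      by (intro vform_plus vform_scaled) (simp_all add: add.commute)
    then show "wform (p + 1) (\<lambda>w. l (bK \<epsilon> p m f w))"
      by (rule vform_cong) (use vsp_add[OF vsp_qW] vsp_scale[OF vsp_qW] eq l in auto)
  qed (simp_all add: bK_def)
qed

end

section \<open>Cochains with values in the graded dual\<close>

context quad
begin

abbreviation M where "M \<equiv> dual_bimod V R"
abbreviation dM where "dM \<equiv> bKm V R M"
abbreviation cupl where "cupl \<equiv> mcupl V R M"
abbreviation cupr where "cupr \<equiv> mcupr V R M"
abbreviation ZM where "ZM \<equiv> Mcocyc V R M"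
abbreviation BM where "BM \<equiv> Mcobd V R M"

lemma M_simps [simp]: "bcomp M m = dual m" "bwt M m n = m - n"
  by (simp_all add: dual_bimod_def)

lemma vsp_M [simp]: "vsp (dual m)"
  by (simp add: vsp_vdual)

lemma M_zero [simp]: "vzero (dual m) = (\<lambda>b\<in>alg m. 0)"
  by (simp add: vdual_def)

lemma M_form: "g \<in> vcar (dual m) \<Longrightarrow> aform m g"
  by (simp add: vcar_vdual)

text \<open>Writing the weight of the functional as \<open>m + l\<close> removes the truncated
  subtraction of the definition; the remaining weights are covered by \<open>blmul_M0\<close> and
  \<open>brmul_M0\<close>.\<close>

lemma blmul_M: "blmul M m (m + l) a u = (\<lambda>b\<in>alg l. (-1) ^ m * u (mul l m b a))"
  and brmul_M: "brmul M (m + l) m u a = (\<lambda>b\<in>alg l. u (mul m l a b))"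
  by (simp_all add: dual_bimod_def)

lemma blmul_M0: "n < m \<Longrightarrow> blmul M m n a u = vzero (dual 0)"
  and brmul_M0: "n < m \<Longrightarrow> brmul M n m u a = vzero (dual 0)"
  by (simp_all add: dual_bimod_def)

lemma blmul_M_in:
  assumes "a \<in> alg m" "u \<in> vcar (dual (m + l))"
  shows "blmul M m (m + l) a u \<in> vcar (dual l)"
proof -
  have "aform (l + m) u" using assms by (simp add: M_form add.commute)
  then have "aform l (\<lambda>b. (-1) ^ m * u (mul l m b a))"
    using assms by (intro vform_scaled qmul_vform_left)
  then have "aform l (blmul M m (m + l) a u)"
    by (rule vform_cong) (auto simp: blmul_M)
  then show ?thesis by (simp add: vcar_vdual blmul_M)
qed

lemma brmul_M_in:
  assumes "a \<in> alg m" "u \<in> vcar (dual (m + l))"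
  shows "brmul M (m + l) m u a \<in> vcar (dual l)"
proof -
  have "aform l (\<lambda>b. u (mul m l a b))"
    using assms by (intro qmul_vform_right M_form)
  then have "aform l (brmul M (m + l) m u a)"
    by (rule vform_cong) (auto simp: brmul_M)
  then show ?thesis by (simp add: vcar_vdual brmul_M)
qed

abbreviation MC where "MC n q \<equiv> vhom (qW V R n) (vdual (qalg V R q))"

lemma MC_Mcoch: "Mcoch V R M n q = MC n q"
  by (simp add: Mcoch_def)

lemma MC_form: "g \<in> vcar (MC n q) \<Longrightarrow> u \<in> W n \<Longrightarrow> aform q (g u)"
  by (drule vhom_in, assumption, erule M_form)

lemma MC_form': "g \<in> vcar (MC n q) \<Longrightarrow> b \<in> alg q \<Longrightarrow> wform n (\<lambda>u. g u b)"
  by (rule vform_vhom[OF vdual_eval])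

lemma MC_eqI:
  assumes "f \<in> vcar (MC n q)" "g \<in> vcar (MC n q)"
    "\<And>u b. u \<in> W n \<Longrightarrow> b \<in> alg q \<Longrightarrow> f u b = g u b"
  shows "f = g"
proof (rule vhom_ext[OF assms(1,2)])
  fix u assume u: "u \<in> vcar (qW V R n)"
  show "f u = g u"
    by (rule vdual_ext[OF vhom_in[OF assms(1) u] vhom_in[OF assms(2) u] assms(3)[OF u]])
qed

lemma MC_I:
  assumes "\<And>u. u \<in> W n \<Longrightarrow> f u \<in> vcar (dual q)" "\<And>u. u \<notin> W n \<Longrightarrow> f u = undefined"
    and "\<And>b. b \<in> alg q \<Longrightarrow> wform n (\<lambda>u. f u b)"
  shows "f \<in> vcar (MC n q)"
  by (rule vhom_sepI[OF vsp_qW vsp_M sepset_vdual]) (use assms in blast)+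

lemma vdual_ops:
  assumes "b \<in> alg q"
  shows "vadd (dual q) f g b = f b + g b" "vscale (dual q) a f b = a * f b"
  using assms by (simp_all add: vdual_def)

lemma bforms_actl:
  assumes F: "linq p m F" and g: "g \<in> vcar (MC q (m + l))" and b: "b \<in> alg l"
  shows "(\<lambda>u v. g v (mul l m b (F u))) \<in> wforms p q"
proof -
  have g': "g \<in> vcar (MC q (l + m))" using g by (simp add: add.commute)
  show ?thesis using b
    by (intro bformsI MC_form'[OF g'] qmul_in linq_form[OF F] linq_in[OF F] qmul_vform_right MC_form[OF g'])
qed

lemma bforms_actr:
  assumes F: "linq p m F" and g: "g \<in> vcar (MC q (m + l))" and b: "b \<in> alg l"
  shows "(\<lambda>v u. g v (mul m l (F u) b)) \<in> wforms q p"
  using b by (intro bformsI MC_form'[OF g] qmul_in linq_form[OF F] linq_in[OF F] qmul_vform_left MC_form[OF g])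

lemma tsplit_actl:
  assumes F: "linq p m F" and g: "g \<in> vcar (MC q (m + l))" and w: "w \<in> W (p + q)"
  shows "wsplit p q (dual l) (\<lambda>u v. blmul M m (m + l) (F u) (g v)) w
      \<in> vcar (dual l)"
    and "b \<in> alg l \<Longrightarrow>
      wsplit p q (dual l) (\<lambda>u v. blmul M m (m + l) (F u) (g v)) w b
        = (-1) ^ m * Lam p q (\<lambda>u v. g v (mul l m b (F u))) w"
proof -
  have "binto (dual l) p q (\<lambda>u v. blmul M m (m + l) (F u) (g v))"
  proof (rule binto_sepI[OF vsp_M sepset_vdual])
    fix u v assume "u \<in> W p" "v \<in> W q"
    then show "blmul M m (m + l) (F u) (g v) \<in> vcar (dual l)"
      by (intro blmul_M_in linq_in[OF F] vhom_in[OF g])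
  next
    fix h :: "(('k, 'a) tensor set \<Rightarrow> 'k) \<Rightarrow> 'k" assume "h \<in> (\<lambda>x f. f x) ` alg l"
    then obtain b where b: "b \<in> alg l" "h = (\<lambda>f. f b)" by auto
    then show "(\<lambda>u v. h (blmul M m (m + l) (F u) (g v))) \<in> wforms p q"
      using bforms_scaled[OF bforms_actl[OF F g b(1)]] by (simp add: blmul_M)
  qed
  note * = tsplit_form[OF vsp_M this w]
  show "wsplit p q (dual l) (\<lambda>u v. blmul M m (m + l) (F u) (g v)) w
      \<in> vcar (dual l)" by (rule *(1))
  show "b \<in> alg l \<Longrightarrow>
      wsplit p q (dual l) (\<lambda>u v. blmul M m (m + l) (F u) (g v)) w b
        = (-1) ^ m * Lam p q (\<lambda>u v. g v (mul l m b (F u))) w"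
    by (subst *(2)[OF vdual_eval]) (simp_all add: blmul_M Lam_scaled)
qed

lemma tsplit_actr:
  assumes F: "linq p m F" and g: "g \<in> vcar (MC q (m + l))" and w: "w \<in> W (q + p)"
  shows "wsplit q p (dual l) (\<lambda>v u. brmul M (m + l) m (g v) (F u)) w
      \<in> vcar (dual l)"
    and "b \<in> alg l \<Longrightarrow>
      wsplit q p (dual l) (\<lambda>v u. brmul M (m + l) m (g v) (F u)) w b
        = Lam q p (\<lambda>v u. g v (mul m l (F u) b)) w"
proof -
  have "binto (dual l) q p (\<lambda>v u. brmul M (m + l) m (g v) (F u))"
  proof (rule binto_sepI[OF vsp_M sepset_vdual])
    fix u v assume "v \<in> W q" "u \<in> W p"
    then show "brmul M (m + l) m (g v) (F u) \<in> vcar (dual l)"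
      by (intro brmul_M_in linq_in[OF F] vhom_in[OF g])
  next
    fix h :: "(('k, 'a) tensor set \<Rightarrow> 'k) \<Rightarrow> 'k" assume "h \<in> (\<lambda>x f. f x) ` alg l"
    then obtain b where b: "b \<in> alg l" "h = (\<lambda>f. f b)" by auto
    then show "(\<lambda>v u. h (brmul M (m + l) m (g v) (F u))) \<in> wforms q p"
      using bforms_actr[OF F g b(1)] by (simp add: brmul_M)
  qed
  note * = tsplit_form[OF vsp_M this w]
  show "wsplit q p (dual l) (\<lambda>v u. brmul M (m + l) m (g v) (F u)) w
      \<in> vcar (dual l)" by (rule *(1))
  show "b \<in> alg l \<Longrightarrow>
      wsplit q p (dual l) (\<lambda>v u. brmul M (m + l) m (g v) (F u)) w b
        = Lam q p (\<lambda>v u. g v (mul m l (F u) b)) w"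
    by (subst *(2)[OF vdual_eval]) (simp_all add: brmul_M)
qed

lemma tsplit_zero:
  assumes w: "w \<in> W (p + q)"
  shows "wsplit p q (dual l) (\<lambda>u v. vzero (dual l)) w
    = vzero (dual l)"
proof -
  have z: "vzero (dual l) \<in> vcar (dual l)" by (rule vsp_zero[OF vsp_M])
  have "binto (dual l) p q (\<lambda>u v. vzero (dual l))"
    unfolding binto_def using z vform_zero[OF vsp_M] by (auto simp del: M_zero simp: bforms_def vlinear_def)
  note * = tsplit_form[OF vsp_M this w]
  show ?thesis
    using z by (intro vsp_eqI[OF vsp_M *(1)]) (simp_all add: *(2) vform_zero[OF vsp_M] Lam_zero del: M_zero)
qed

text \<open>The sign of the second term is \<open>- ((-1) ^ Suc q)\<close> from the modified
  differential times \<open>-1\<close> from the left action of a generator.\<close>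

lemma bKm_M_Suc:
  assumes g: "g \<in> vcar (MC n (Suc q))"
  shows "w \<in> W (n + 1) \<Longrightarrow> b \<in> alg q \<Longrightarrow> dM n (Suc q) g w b
      = Lam n 1 (\<lambda>u x. g u (mul 1 q (gen x) b)) w
        - (-1) ^ q * Lam 1 n (\<lambda>x u. g u (mul q 1 b (gen x))) w"
    and "dM n (Suc q) g \<in> vcar (MC (n + 1) q)"
proof -
  have g': "g \<in> vcar (MC n (1 + q))" using g by simp
  note 1 = tsplit_actr[OF linq_qgen g'] and 2 = tsplit_actl[OF linq_qgen g']
  show eq: "dM n (Suc q) g w b = Lam n 1 (\<lambda>u x. g u (mul 1 q (gen x) b)) w
        - (-1) ^ q * Lam 1 n (\<lambda>x u. g u (mul q 1 b (gen x))) w"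
    if w: "w \<in> W (n + 1)" and b: "b \<in> alg q" for w b
  proof -
    have w': "w \<in> W (1 + n)" using w by (simp add: add.commute)
    show ?thesis using w b 1(2)[OF w b] 2(2)[OF w' b] by (simp add: bKm_def Let_def vdual_ops)
  qed
  show "dM n (Suc q) g \<in> vcar (MC (n + 1) q)"
  proof (rule MC_I)
    fix w assume w: "w \<in> W (n + 1)"
    then have w': "w \<in> W (1 + n)" by (simp add: add.commute)
    show "dM n (Suc q) g w \<in> vcar (dual q)"
      using w 1(1)[OF w] 2(1)[OF w'] by (simp add: bKm_def Let_def)
  next
    fix b assume b: "b \<in> alg q"
    have "wform (n + 1) (\<lambda>w. Lam n 1 (\<lambda>u x. g u (mul 1 q (gen x) b)) w
        + - ((-1) ^ q) * Lam 1 n (\<lambda>x u. g u (mul q 1 b (gen x))) w)"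
      using Lam_vlinear(2)[OF bforms_actr[OF linq_qgen g' b]] Lam_vlinear(2)[OF bforms_actl[OF linq_qgen g' b]]
      by (intro vform_plus vform_scaled) (simp_all add: add.commute)
    then show "wform (n + 1) (\<lambda>w. dM n (Suc q) g w b)"
      by (rule vform_cong) (use vsp_add[OF vsp_qW] vsp_scale[OF vsp_qW] eq b in auto)
  qed (simp add: bKm_def Let_def)
qed

text \<open>Generators act as zero on functionals of weight 0, and \<open>0 - 1 = 0\<close> places
  the result in weight 0 instead of the absent weight -1. Hence all cochains of coefficient weight 0
  are cocycles.\<close>

lemma bKm_M_0: "dM n 0 g = vzero (MC (n + 1) 0)"
proof -
  have *: "1 + n = n + 1" by simp
  show ?thesis
    using tsplit_zero[of _ n 1 0] tsplit_zero[of _ 1 n 0, unfolded *]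
    by (auto simp: bKm_def Let_def blmul_M0 brmul_M0 vdual_ops vdual_def simp del: One_nat_def intro!: restrict_ext)
qed

text \<open>The exponent is \<open>m * (m + l)\<close> from the cup product plus \<open>m\<close>
  from the left action on the graded dual.\<close>

lemma mcupl_M:
  assumes F: "linq p m F" and g: "g \<in> vcar (MC q (m + l))"
  shows "w \<in> W (p + q) \<Longrightarrow> b \<in> alg l \<Longrightarrow> cupl p m q (m + l) F g w b
      = (-1) ^ (m * (m + l) + m) * Lam p q (\<lambda>u v. g v (mul l m b (F u))) w"
    and "cupl p m q (m + l) F g \<in> vcar (MC (p + q) l)"
proof -
  note 1 = tsplit_actl[OF F g]
  show eq: "cupl p m q (m + l) F g w b
      = (-1) ^ (m * (m + l) + m) * Lam p q (\<lambda>u v. g v (mul l m b (F u))) w"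
    if w: "w \<in> W (p + q)" and b: "b \<in> alg l" for w b
    using w b 1(2)[OF w b] by (simp add: mcupl_def Let_def vdual_ops power_add mult.assoc)
  show "cupl p m q (m + l) F g \<in> vcar (MC (p + q) l)"
  proof (rule MC_I)
    fix w assume w: "w \<in> W (p + q)"
    show "cupl p m q (m + l) F g w \<in> vcar (dual l)"
      using w 1(1)[OF w] by (simp add: mcupl_def Let_def)
  next
    fix b assume b: "b \<in> alg l"
    show "wform (p + q) (\<lambda>w. cupl p m q (m + l) F g w b)"
      by (rule vform_cong[OF vform_scaled[OF Lam_vlinear(2)[OF bforms_actl[OF F g b]]]])
         (use vsp_add[OF vsp_qW] vsp_scale[OF vsp_qW] eq b in auto)
  qed (simp add: mcupl_def Let_def)
qed

lemma mcupr_M: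
  assumes F: "linq p m F" and g: "g \<in> vcar (MC q (m + l))"
  shows "w \<in> W (q + p) \<Longrightarrow> b \<in> alg l \<Longrightarrow> cupr p m q (m + l) g F w b
      = (-1) ^ ((m + l) * m) * Lam q p (\<lambda>v u. g v (mul m l (F u) b)) w"
    and "cupr p m q (m + l) g F \<in> vcar (MC (q + p) l)"
proof -
  note 1 = tsplit_actr[OF F g]
  show eq: "cupr p m q (m + l) g F w b
      = (-1) ^ ((m + l) * m) * Lam q p (\<lambda>v u. g v (mul m l (F u) b)) w"
    if w: "w \<in> W (q + p)" and b: "b \<in> alg l" for w b
    using w b 1(2)[OF w b] by (simp add: mcupr_def Let_def vdual_ops)
  show "cupr p m q (m + l) g F \<in> vcar (MC (q + p) l)"
  proof (rule MC_I)
    fix w assume w: "w \<in> W (q + p)"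
    show "cupr p m q (m + l) g F w \<in> vcar (dual l)"
      using w 1(1)[OF w] by (simp add: mcupr_def Let_def)
  next
    fix b assume b: "b \<in> alg l"
    show "wform (q + p) (\<lambda>w. cupr p m q (m + l) g F w b)"
      by (rule vform_cong[OF vform_scaled[OF Lam_vlinear(2)[OF bforms_actr[OF F g b]]]])
         (use vsp_add[OF vsp_qW] vsp_scale[OF vsp_qW] eq b in auto)
  qed (simp add: mcupr_def Let_def)
qed

lemma mcup_M0:
  assumes "n < m"
  shows "cupl p m q n F g = vzero (MC (p + q) 0)" "cupr p m q n g F = vzero (MC (q + p) 0)"
  using tsplit_zero[of _ p q 0] tsplit_zero[of _ q p 0] assms
  by (auto simp: mcupl_def mcupr_def Let_def blmul_M0 brmul_M0 vdual_ops vdual_def intro!: restrict_ext)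

end

section \<open>The Leibniz rule\<close>

context quad
begin

lemma qmul_form_l: "aform k h \<Longrightarrow> k = m + n \<Longrightarrow> Y \<in> alg n \<Longrightarrow>
    aform m (\<lambda>X. h (mul m n X Y))"
  and qmul_form_r: "aform k h \<Longrightarrow> k = m + n \<Longrightarrow> X \<in> alg m \<Longrightarrow>
    aform n (\<lambda>Y. h (mul m n X Y))"
  using qmul_vform_left qmul_vform_right by blast+

lemma qmul_in': "X \<in> alg m \<Longrightarrow> Y \<in> alg n \<Longrightarrow> k = m + n \<Longrightarrow> mul m n X Y \<in> alg k"
  using qmul_in by blast

lemma Lam_minus: "Lam p q (\<lambda>u v. F u v - G u v) w = Lam p q F w - Lam p q G w"
  by (simp add: Lam_def sum_subtractf)

lemma Lam_cong2:
  assumes "w \<in> W (p + q + r)" "\<And>u v x. u \<in> W p \<Longrightarrow> v \<in> W q \<Longrightarrow> x \<in> W r \<Longrightarrow> F u v x = G u v x"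
  shows "Lam (p + q) r (\<lambda>y x. Lam p q (\<lambda>u v. F u v x) y) w = Lam (p + q) r (\<lambda>y x. Lam p q (\<lambda>u v. G u v x) y) w"
  using assms by (intro Lam_cong) auto

text \<open>Two successive left actions are the action of the product: associativity in the algebra
  moves the brackets inside \<open>g\<close>, and \<open>Lam_assoc\<close> moves them in the
  splitting of \<open>w\<close>. One of the two maps will be \<open>gen\<close>.\<close>

lemma act_left_left:
  assumes F: "linq p m F" and G: "linq p' m' G" and g: "g \<in> vcar (MC q (l + m + m'))"
    and w: "w \<in> W (p + p' + q)" and b: "b \<in> alg l"
  shows "Lam (p + p') q (\<lambda>y v. Lam p p' (\<lambda>u u'. g v (mul l (m + m') b (mul m m' (F u) (G u')))) y) w
    = Lam p (p' + q) (\<lambda>u y. Lam p' q (\<lambda>u' v. g v (mul (l + m) m' (mul l m b (F u)) (G u'))) y) w"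
proof -
  note gv = MC_form[OF g]
  have "Lam (p + p') q (\<lambda>y v. Lam p p' (\<lambda>u u'. g v (mul l (m + m') b (mul m m' (F u) (G u')))) y) w
    = Lam (p + p') q (\<lambda>y v. Lam p p' (\<lambda>u u'. g v (mul (l + m) m' (mul l m b (F u)) (G u'))) y) w"
    by (rule Lam_cong2[OF w]) (simp only: qmul_assoc[OF b linq_in[OF F] linq_in[OF G]])
  also have "\<dots> = Lam p (p' + q) (\<lambda>u y. Lam p' q (\<lambda>u' v. g v (mul (l + m) m' (mul l m b (F u)) (G u'))) y) w"
  proof (rule Lam_assoc[OF w])
    fix u' v assume "u' \<in> W p'" "v \<in> W q"
    then show "wform p (\<lambda>u. g v (mul (l + m) m' (mul l m b (F u)) (G u')))"
      by (intro linq_form[OF F] qmul_form_r[OF qmul_form_l[OF gv]] b linq_in[OF G]) simp_all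
  next
    fix u v assume "u \<in> W p" "v \<in> W q"
    then show "wform p' (\<lambda>u'. g v (mul (l + m) m' (mul l m b (F u)) (G u')))"
      by (intro linq_form[OF G] qmul_form_r[OF gv] qmul_in b linq_in[OF F]) simp_all
  qed
  finally show ?thesis .
qed

lemma act_right_right:
  assumes F: "linq p m F" and G: "linq p' m' G" and g: "g \<in> vcar (MC q (m' + m + l))"
    and w: "w \<in> W (q + p' + p)" and b: "b \<in> alg l"
  shows "Lam (q + p') p (\<lambda>y u. Lam q p' (\<lambda>v u'. g v (mul m' (m + l) (G u') (mul m l (F u) b))) y) w
    = Lam q (p' + p) (\<lambda>v y. Lam p' p (\<lambda>u' u. g v (mul (m' + m) l (mul m' m (G u') (F u)) b)) y) w"
proof -
  note gv = MC_form[OF g] and gv' = MC_form'[OF g]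
  have "Lam (q + p') p (\<lambda>y u. Lam q p' (\<lambda>v u'. g v (mul m' (m + l) (G u') (mul m l (F u) b))) y) w
    = Lam (q + p') p (\<lambda>y u. Lam q p' (\<lambda>v u'. g v (mul (m' + m) l (mul m' m (G u') (F u)) b)) y) w"
    by (rule Lam_cong2[OF w]) (simp only: qmul_assoc[OF linq_in[OF G] linq_in[OF F] b])
  also have "\<dots> = Lam q (p' + p) (\<lambda>v y. Lam p' p (\<lambda>u' u. g v (mul (m' + m) l (mul m' m (G u') (F u)) b)) y) w"
  proof (rule Lam_assoc[OF w])
    fix u' u assume "u' \<in> W p'" "u \<in> W p"
    then show "wform q (\<lambda>v. g v (mul (m' + m) l (mul m' m (G u') (F u)) b))"
      by (intro gv' qmul_in b linq_in[OF F] linq_in[OF G])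
  next
    fix v u assume "v \<in> W q" "u \<in> W p"
    then show "wform p' (\<lambda>u'. g v (mul (m' + m) l (mul m' m (G u') (F u)) b))"
      by (intro linq_form[OF G] qmul_form_l[OF qmul_form_l[OF gv]] b linq_in[OF F]) simp_all
  qed
  finally show ?thesis .
qed

text \<open>The left and the right action commute, again by associativity in both places.\<close>

lemma act_left_right:
  assumes F: "linq p m F" and G: "linq p' m' G" and g: "g \<in> vcar (MC q (m' + l + m))"
    and w: "w \<in> W (p + q + p')" and b: "b \<in> alg l"
  shows "Lam (p + q) p' (\<lambda>y u'. Lam p q (\<lambda>u v. g v (mul (m' + l) m (mul m' l (G u') b) (F u))) y) w
    = Lam p (q + p') (\<lambda>u y. Lam q p' (\<lambda>v u'. g v (mul m' (l + m) (G u') (mul l m b (F u)))) y) w"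
proof -
  note gv = MC_form[OF g] and gv' = MC_form'[OF g]
  have "Lam (p + q) p' (\<lambda>y u'. Lam p q (\<lambda>u v. g v (mul (m' + l) m (mul m' l (G u') b) (F u))) y) w
    = Lam (p + q) p' (\<lambda>y u'. Lam p q (\<lambda>u v. g v (mul m' (l + m) (G u') (mul l m b (F u)))) y) w"
    by (rule Lam_cong2[OF w]) (simp only: qmul_assoc[OF linq_in[OF G] b linq_in[OF F]])
  also have "\<dots> = Lam p (q + p') (\<lambda>u y. Lam q p' (\<lambda>v u'. g v (mul m' (l + m) (G u') (mul l m b (F u)))) y) w"
  proof (rule Lam_assoc[OF w])
    fix v u' assume "v \<in> W q" "u' \<in> W p'"
    then show "wform p (\<lambda>u. g v (mul m' (l + m) (G u') (mul l m b (F u))))"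
      by (intro linq_form[OF F] qmul_form_r[OF qmul_form_r[OF gv]] b linq_in[OF G]) simp_all
  next
    fix u u' assume "u \<in> W p" "u' \<in> W p'"
    then show "wform q (\<lambda>v. g v (mul m' (l + m) (G u') (mul l m b (F u))))"
      by (intro gv' qmul_in' b linq_in[OF F] linq_in[OF G]) simp_all
  qed
  finally show ?thesis .
qed

text \<open>The triple splittings \<open>?X1\<close>, \<open>?X2\<close>, \<open>?X3\<close> have
  the generator after, between and before the arguments of \<open>F\<close> and \<open>g\<close>.
  The left side consists of the first and the third; the second occurs in the differential of
  \<open>F\<close> and in that of \<open>g\<close>, with opposite signs.\<close>

lemma leibniz_left:
  assumes F: "linq p m F" and g: "g \<in> vcar (MC q (m + Suc l))"
  shows "dM (p + q) (Suc l) (cupl p m q (m + Suc l) F g)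
    = vadd (MC (p + q + 1) l) (cupl (p + 1) (m + 1) q (m + Suc l) (bK (- ((-1) ^ m)) p m F) g)
        (vscale (MC (p + q + 1) l) ((-1) ^ m) (cupl p m (q + 1) (m + l) F (dM q (m + Suc l) g)))"
    (is "?L = vadd _ ?A (vscale _ _ ?B)")
proof -
  let ?\<epsilon> = "- ((-1) ^ m) :: 'k"
  have g1: "g \<in> vcar (MC q (m + 1 + l))" "g \<in> vcar (MC q (Suc (l + m)))" using g by (simp_all add: add.commute)
  have g2: "g \<in> vcar (MC q (1 + l + m))" "g \<in> vcar (MC q (l + m + 1))" "g \<in> vcar (MC q (l + 1 + m))"
    using g1(2) by simp_all
  note Fg = mcupl_M[OF F g]
  note bF = bK_form[OF F, where \<epsilon> = ?\<epsilon>]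
  note bg = bKm_M_Suc[OF g1(2)]
  have bg': "dM q (m + Suc l) g \<in> vcar (MC (q + 1) (m + l))" using bg(2) by (simp add: add.commute)
  note C = mcupl_M[OF linq_vhom[OF bF(2)] g1(1)]
  note D = mcupl_M[OF F bg']
  have mem: "?L \<in> vcar (MC (p + q + 1) l)" "?A \<in> vcar (MC (p + q + 1) l)" "?B \<in> vcar (MC (p + q + 1) l)"
    using bKm_M_Suc(2)[OF Fg(2)] C(2) D(2) by (simp_all add: add.commute[of q 1])
  show ?thesis
  proof (rule MC_eqI[OF mem(1) vsp_add[OF vsp_vhom mem(2) vsp_scale[OF vsp_vhom mem(3)]]])
    fix w b assume w: "w \<in> W (p + q + 1)" and b: "b \<in> alg l"
    have w2: "w \<in> W (p + (q + 1))" "w \<in> W (p + 1 + q)" "w \<in> W (1 + p + q)" "w \<in> W (1 + (p + q))"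
      using w by (simp_all add: ac_simps)
    note A1 = act_left_right[OF F linq_qgen g2(1) w b]
      and A2 = act_left_left[OF F linq_qgen g2(2) w2(2) b]
      and A3 = act_left_left[OF linq_qgen F g2(3) w2(3) b]
    let ?s = "(-1) ^ (m * (m + Suc l) + m) :: 'k"
    let ?X1 = "Lam p (q + 1) (\<lambda>u y. Lam q 1 (\<lambda>v x. g v (mul 1 (l + m) (gen x) (mul l m b (F u)))) y) w"
    let ?X2 = "Lam p (1 + q) (\<lambda>u y. Lam 1 q (\<lambda>x v. g v (mul (l + m) 1 (mul l m b (F u)) (gen x))) y) w"
    let ?X3 = "Lam 1 (p + q) (\<lambda>x y. Lam p q (\<lambda>u v. g v (mul (l + 1) m (mul l 1 b (gen x)) (F u))) y) w"
    have e1: "Lam (p + q) 1 (\<lambda>y x. cupl p m q (m + Suc l) F g y (mul 1 l (gen x) b)) w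
      = Lam (p + q) 1 (\<lambda>y x. ?s * Lam p q (\<lambda>u v. g v (mul (1 + l) m (mul 1 l (gen x) b) (F u))) y) w"
      by (rule Lam_cong[OF w]) (use Fg(1)[OF _ qmul_in[OF qgen_in b, simplified]] in simp)
    have e3: "Lam 1 (p + q) (\<lambda>x y. cupl p m q (m + Suc l) F g y (mul l 1 b (gen x))) w
      = Lam 1 (p + q) (\<lambda>x y. ?s * Lam p q (\<lambda>u v. g v (mul (l + 1) m (mul l 1 b (gen x)) (F u))) y) w"
      by (rule Lam_cong[OF w2(4)]) (use Fg(1)[OF _ qmul_in[OF b qgen_in, simplified]] in simp)
    have L: "?L w b = ?s * (?X1 - (-1) ^ l * ?X3)"
      using bKm_M_Suc(1)[OF Fg(2) w b] unfolding e1 e3 Lam_scaled A1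
      by (simp add: right_diff_distrib mult.left_commute)
    have "Lam p (q + 1) (\<lambda>u y. dM q (Suc (l + m)) g y (mul l m b (F u))) w = ?X1 - (-1) ^ (l + m) * ?X2"
      unfolding Lam_scaled[symmetric] add.commute[of 1 q] Lam_minus[symmetric]
      by (rule Lam_cong[OF w2(1)]) (simp only: bg(1) qmul_in[OF b linq_in[OF F]] Lam_scaled add.commute[of 1 q])
    then have B: "?B w b = (-1) ^ (m * (m + l) + m) * (?X1 - (-1) ^ (l + m) * ?X2)"
      using D(1)[OF w2(1) b] by (simp add: add.commute[of l m])
    have "Lam (p + 1) q (\<lambda>y v. g v (mul l (m + 1) b (bK ?\<epsilon> p m F y))) w
      = Lam (p + 1) q (\<lambda>y v. Lam p 1 (\<lambda>u x. g v (mul l (m + 1) b (mul m 1 (F u) (gen x)))) y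
        + ?\<epsilon> * Lam 1 p (\<lambda>x u. g v (mul l (1 + m) b (mul 1 m (gen x) (F u)))) y) w"
    proof (rule Lam_cong[OF w2(2)])
      fix y v assume y: "y \<in> W (p + 1)" and v: "v \<in> W q"
      have "aform (m + 1) (\<lambda>X. g v (mul l (m + 1) b X))"
        by (rule qmul_form_r[OF MC_form[OF g v] _ b]) simp
      from bF(1)[OF y this] show "g v (mul l (m + 1) b (bK ?\<epsilon> p m F y))
        = Lam p 1 (\<lambda>u x. g v (mul l (m + 1) b (mul m 1 (F u) (gen x)))) y
        + ?\<epsilon> * Lam 1 p (\<lambda>x u. g v (mul l (1 + m) b (mul 1 m (gen x) (F u)))) y"
        by (simp only: add.commute[of 1 m])
    qed
    also have "\<dots> = ?X2 - (-1) ^ m * ?X3"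
      using A2 A3 by (simp add: Lam_minus Lam_scaled)
    finally have A: "?A w b = (-1) ^ ((m + 1) * (m + 1 + l) + (m + 1)) * (?X2 - (-1) ^ m * ?X3)"
      using C(1)[OF w2(2) b] by simp
    have "vadd (MC (p + q + 1) l) ?A (vscale (MC (p + q + 1) l) ((-1) ^ m) ?B) w b = ?A w b + (-1) ^ m * ?B w b"
      using w b by (simp add: vdual_ops)
    also have "\<dots> = ?L w b"
      \<comment> \<open>Only the parities of \<open>m\<close> and \<open>l\<close> enter the signs,
        so four cases decide the identity.\<close>
      unfolding A B L by (cases "even m"; cases "even l"; simp add: minus_one_power_iff algebra_simps)
    finally show "?L w b = vadd (MC (p + q + 1) l) ?A (vscale (MC (p + q + 1) l) ((-1) ^ m) ?B) w b" ..
  qed simp_all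
qed

text \<open>Now \<open>?Y3\<close>, with the generator between the arguments of \<open>g\<close> and
  \<open>F\<close>, is the term that cancels. The sign in front of the second summand has the
  coefficient weight \<open>m + Suc l\<close> of \<open>g\<close> as exponent.\<close>

lemma leibniz_right:
  assumes F: "linq p m F" and g: "g \<in> vcar (MC q (m + Suc l))"
  shows "dM (q + p) (Suc l) (cupr p m q (m + Suc l) g F)
    = vadd (MC (q + p + 1) l) (cupr p m (q + 1) (m + l) (dM q (m + Suc l) g) F)
        (vscale (MC (q + p + 1) l) ((-1) ^ (m + Suc l))
          (cupr (p + 1) (m + 1) q (m + Suc l) g (bK (- ((-1) ^ m)) p m F)))"
    (is "?L = vadd _ ?B (vscale _ _ ?A)")
proof -
  let ?\<epsilon> = "- ((-1) ^ m) :: 'k"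
  have g1: "g \<in> vcar (MC q (m + 1 + l))" "g \<in> vcar (MC q (Suc (m + l)))" using g by simp_all
  have g2: "g \<in> vcar (MC q (1 + m + l))" "g \<in> vcar (MC q (m + l + 1))" using g by simp_all
  note Fg = mcupr_M[OF F g]
  note bF = bK_form[OF F, where \<epsilon> = ?\<epsilon>]
  note bg = bKm_M_Suc[OF g1(2)]
  note C = mcupr_M[OF linq_vhom[OF bF(2)] g1(1)]
  note D = mcupr_M[OF F bg(2)]
  have mem: "?L \<in> vcar (MC (q + p + 1) l)" "?A \<in> vcar (MC (q + p + 1) l)" "?B \<in> vcar (MC (q + p + 1) l)"
    using bKm_M_Suc(2)[OF Fg(2)] C(2) D(2) by simp_all
  show ?thesis
  proof (rule MC_eqI[OF mem(1) vsp_add[OF vsp_vhom mem(3) vsp_scale[OF vsp_vhom mem(2)]]])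
    fix w b assume w: "w \<in> W (q + p + 1)" and b: "b \<in> alg l"
    have w2: "w \<in> W (q + (p + 1))" "w \<in> W (q + 1 + p)" "w \<in> W (1 + q + p)" "w \<in> W (1 + (q + p))"
      using w by (simp_all add: ac_simps)
    note A1 = act_right_right[OF linq_qgen F g1(1) w b]
      and A2 = act_left_right[OF linq_qgen F g2(2) w2(3) b]
      and A3 = act_right_right[OF F linq_qgen g2(1) w2(2) b]
    let ?s = "(-1) ^ ((m + Suc l) * m) :: 'k"
    let ?Y1 = "Lam q (p + 1) (\<lambda>v y. Lam p 1 (\<lambda>u x. g v (mul (m + 1) l (mul m 1 (F u) (gen x)) b)) y) w"
    let ?Y2 = "Lam 1 (q + p) (\<lambda>x y. Lam q p (\<lambda>v u. g v (mul m (l + 1) (F u) (mul l 1 b (gen x)))) y) w"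
    let ?Y3 = "Lam q (1 + p) (\<lambda>v y. Lam 1 p (\<lambda>x u. g v (mul (1 + m) l (mul 1 m (gen x) (F u)) b)) y) w"
    have e1: "Lam (q + p) 1 (\<lambda>y x. cupr p m q (m + Suc l) g F y (mul 1 l (gen x) b)) w
      = Lam (q + p) 1 (\<lambda>y x. ?s * Lam q p (\<lambda>v u. g v (mul m (1 + l) (F u) (mul 1 l (gen x) b))) y) w"
      by (rule Lam_cong[OF w]) (use Fg(1)[OF _ qmul_in[OF qgen_in b, simplified]] in simp)
    have e2: "Lam 1 (q + p) (\<lambda>x y. cupr p m q (m + Suc l) g F y (mul l 1 b (gen x))) w
      = Lam 1 (q + p) (\<lambda>x y. ?s * Lam q p (\<lambda>v u. g v (mul m (l + 1) (F u) (mul l 1 b (gen x)))) y) w"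
      by (rule Lam_cong[OF w2(4)]) (use Fg(1)[OF _ qmul_in[OF b qgen_in, simplified]] in simp)
    have L: "?L w b = ?s * (?Y1 - (-1) ^ l * ?Y2)"
      using bKm_M_Suc(1)[OF Fg(2) w b] unfolding e1 e2 Lam_scaled A1
      by (simp add: right_diff_distrib mult.left_commute)
    have "Lam (q + 1) p (\<lambda>y u. dM q (Suc (m + l)) g y (mul m l (F u) b)) w
      = Lam (q + 1) p (\<lambda>y u. Lam q 1 (\<lambda>v x. g v (mul 1 (m + l) (gen x) (mul m l (F u) b))) y
        - (-1) ^ (m + l) * Lam 1 q (\<lambda>x v. g v (mul (m + l) 1 (mul m l (F u) b) (gen x))) y) w"
      by (rule Lam_cong[OF w2(2)]) (simp only: bg(1) qmul_in[OF linq_in[OF F] b])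
    also have "\<dots> = ?Y3 - (-1) ^ (m + l) * ?Y2"
      using A2 A3 by (simp add: Lam_minus Lam_scaled)
    finally have B: "?B w b = (-1) ^ ((m + l) * m) * (?Y3 - (-1) ^ (m + l) * ?Y2)"
      using D(1)[OF w2(2) b] by simp
    have "Lam q (p + 1) (\<lambda>v y. g v (mul (m + 1) l (bK ?\<epsilon> p m F y) b)) w
      = Lam q (p + 1) (\<lambda>v y. Lam p 1 (\<lambda>u x. g v (mul (m + 1) l (mul m 1 (F u) (gen x)) b)) y
        + ?\<epsilon> * Lam 1 p (\<lambda>x u. g v (mul (1 + m) l (mul 1 m (gen x) (F u)) b)) y) w"
    proof (rule Lam_cong[OF w2(1)])
      fix v y assume v: "v \<in> W q" and y: "y \<in> W (p + 1)"
      have "aform (m + 1) (\<lambda>X. g v (mul (m + 1) l X b))"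
        by (rule qmul_form_l[OF MC_form[OF g v] _ b]) simp
      from bF(1)[OF y this] show "g v (mul (m + 1) l (bK ?\<epsilon> p m F y) b)
        = Lam p 1 (\<lambda>u x. g v (mul (m + 1) l (mul m 1 (F u) (gen x)) b)) y
        + ?\<epsilon> * Lam 1 p (\<lambda>x u. g v (mul (1 + m) l (mul 1 m (gen x) (F u)) b)) y"
        by (simp only: add.commute[of 1 m])
    qed
    also have "\<dots> = ?Y1 - (-1) ^ m * ?Y3"
      by (simp add: Lam_minus Lam_scaled)
    finally have A: "?A w b = (-1) ^ ((m + 1 + l) * (m + 1)) * (?Y1 - (-1) ^ m * ?Y3)"
      using C(1)[OF w2(1) b] by simp
    have "vadd (MC (q + p + 1) l) ?B (vscale (MC (q + p + 1) l) ((-1) ^ (m + Suc l)) ?A) w b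
      = ?B w b + (-1) ^ (m + Suc l) * ?A w b"
      using w b by (simp add: vdual_ops)
    also have "\<dots> = ?L w b"
      unfolding A B L by (cases "even m"; cases "even l"; simp add: minus_one_power_iff algebra_simps)
    finally show "?L w b = vadd (MC (q + p + 1) l) ?B (vscale (MC (q + p + 1) l) ((-1) ^ (m + Suc l)) ?A) w b" ..
  qed simp_all
qed

lemma W_2_I: "r \<in> W 2 \<Longrightarrow> r \<in> I 2"
proof -
  assume "r \<in> W 2"
  then have "r \<in> fspan (rels V R 0 0)" by (simp add: qW_def)
  moreover have "fspan (rels V R 0 0) \<subseteq> I 2" by (rule fspan_minimal) (auto intro: rels_I)
  ultimately show ?thesis by blast
qed

text \<open>Two adjacent generators evaluated along \<open>r\<close> give the class of
  \<open>r\<close> in weight 2, which is zero because elements of \<open>W 2\<close> are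
  relations.\<close>

lemma Lam_qgen2:
  assumes h: "aform (1 + 1) h" and r: "r \<in> W (1 + 1)"
  shows "Lam 1 1 (\<lambda>x y. h (mul 1 1 (gen x) (gen y))) r = 0"
proof -
  have "Lam 1 1 (\<lambda>x y. h (mul 1 1 (gen x) (gen y))) r
    = Lam 1 1 (\<lambda>x y. h (cl (1 + 1) (tmul V x y))) r"
    unfolding qgen_def by (rule Lam_cong[OF r]) (simp only: qmul_cl W_T)
  also have "\<dots> = h (cl (1 + 1) r)" by (rule Lam_restrict[OF form_cl(1)[OF h] r])
  also have "\<dots> = 0" using r by (intro form_cl(2)[OF h]) (simp only: W_2_I one_add_one)
  finally show ?thesis .
qed

text \<open>The outer terms vanish since \<open>W\<^sub>2 = R\<close> and the inner ones cancel.\<close>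

lemma bKm_bKm:
  assumes g: "g \<in> vcar (MC n (Suc (Suc l)))"
  shows "dM (n + 1) (Suc l) (dM n (Suc (Suc l)) g) = vzero (MC (n + 2) l)"
    (is "?L = _")
proof (rule MC_eqI)
  note bg = bKm_M_Suc[OF g]
  note bbg = bKm_M_Suc[OF bg(2)]
  show "?L \<in> vcar (MC (n + 2) l)" using bbg(2) by simp
  show "vzero (MC (n + 2) l) \<in> vcar (MC (n + 2) l)" by (intro vsp_zero vsp_vhom) simp_all
  fix w b assume w: "w \<in> W (n + 2)" and b: "b \<in> alg l"
  have w2: "w \<in> W (n + 1 + 1)" "w \<in> W (1 + n + 1)" "w \<in> W (1 + 1 + n)" "w \<in> W (1 + (n + 1))" "w \<in> W (n + (1 + 1))"
    using w by (simp_all add: numeral_2_eq_2)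
  have g1: "g \<in> vcar (MC n (l + 1 + 1))" "g \<in> vcar (MC n (1 + 1 + l))" "g \<in> vcar (MC n (1 + l + 1))"
    using g by simp_all
  have "Lam n (1 + 1) (\<lambda>v r. Lam 1 1 (\<lambda>x y. g v (mul (1 + 1) l (mul 1 1 (gen x) (gen y)) b)) r) w
    = Lam n (1 + 1) (\<lambda>v r. 0) w"
    by (rule Lam_cong[OF w2(5)], rule Lam_qgen2) (simp_all only: qmul_form_l[OF MC_form[OF g1(2)] _ b])
  then have 1: "Lam (n + 1) 1 (\<lambda>z y. Lam n 1 (\<lambda>v x. g v (mul 1 (1 + l) (gen x) (mul 1 l (gen y) b))) z) w = 0"
    unfolding act_right_right[OF linq_qgen linq_qgen g1(2) w2(1) b] by (simp only: Lam_zero)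
  note 2 = act_left_right[OF linq_qgen linq_qgen g1(3) w2(2) b]
  have "Lam (1 + 1) n (\<lambda>r v. Lam 1 1 (\<lambda>x y. g v (mul l (1 + 1) b (mul 1 1 (gen x) (gen y)))) r) w
    = Lam (1 + 1) n (\<lambda>r v. 0) w"
    by (rule Lam_cong[OF w2(3)], rule Lam_qgen2)
       (simp_all only: qmul_form_r[OF MC_form[OF g1(1)] _ b] add.assoc)
  then have 3: "Lam 1 (1 + n) (\<lambda>x z. Lam 1 n (\<lambda>y v. g v (mul (l + 1) 1 (mul l 1 b (gen x)) (gen y))) z) w = 0"
    unfolding act_left_left[OF linq_qgen linq_qgen g1(1) w2(3) b] by (simp only: Lam_zero)
  have e1: "Lam (n + 1) 1 (\<lambda>z y. dM n (Suc (Suc l)) g z (mul 1 l (gen y) b)) w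
    = Lam (n + 1) 1 (\<lambda>z y. Lam n 1 (\<lambda>v x. g v (mul 1 (1 + l) (gen x) (mul 1 l (gen y) b))) z
        - (-1) ^ Suc l * Lam 1 n (\<lambda>x v. g v (mul (1 + l) 1 (mul 1 l (gen y) b) (gen x))) z) w"
    by (rule Lam_cong[OF w2(1)]) (use bg(1)[OF _ qmul_in[OF qgen_in b, simplified]] in simp)
  have e2: "Lam 1 (n + 1) (\<lambda>y z. dM n (Suc (Suc l)) g z (mul l 1 b (gen y))) w
    = Lam 1 (n + 1) (\<lambda>y z. Lam n 1 (\<lambda>v x. g v (mul 1 (l + 1) (gen x) (mul l 1 b (gen y)))) z
        - (-1) ^ Suc l * Lam 1 n (\<lambda>x v. g v (mul (l + 1) 1 (mul l 1 b (gen y)) (gen x))) z) w"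
    by (rule Lam_cong[OF w2(4)]) (use bg(1)[OF _ qmul_in[OF b qgen_in, simplified]] in simp)
  have "?L w b = 0"
    using bbg(1)[OF w2(1) b] 2 3 unfolding e1 e2 Lam_minus Lam_scaled 1 by simp
  then show "?L w b = vzero (MC (n + 2) l) w b"
    using w b by simp
qed

end

section \<open>Cocycles and coboundaries with values in the graded dual\<close>

lemma vsubsp_image:
  assumes U: "vsp U" and W: "vsp W" and f: "vlinear U W f" "\<And>x. x \<in> vcar U \<Longrightarrow> f x \<in> vcar W"
  shows "vsubsp W (f ` vcar U)" and "vsubsp U {x \<in> vcar U. f x = vzero W}" and "f (vzero U) = vzero W"
proof -
  have add: "f (vadd U x y) = vadd W (f x) (f y)" if "x \<in> vcar U" "y \<in> vcar U" for x y
    using f(1) that by (simp add: vlinear_def)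
  have scale: "f (vscale U a x) = vscale W a (f x)" if "x \<in> vcar U" for x a
    using f(1) that by (simp add: vlinear_def)
  show z: "f (vzero U) = vzero W"
    using scale[of "vzero U" 0] U W f(2) by (simp add: vsp_scale_0)
  show "vsubsp W (f ` vcar U)"
    unfolding vsubsp_def
  proof (intro conjI ballI allI)
    show "vzero W \<in> f ` vcar U" using U by (simp flip: z)
    show "f ` vcar U \<subseteq> vcar W" using f by auto
  qed (use U in \<open>auto simp flip: add scale\<close>)
  show "vsubsp U {x \<in> vcar U. f x = vzero W}"
    unfolding vsubsp_def using U W by (auto simp: add scale z vsp_scale_zero vsp_zero_add)
qed

text \<open>A Leibniz rule may produce the wanted element only up to sign; applying the sign once
  more recovers it inside the subspace of coboundaries.\<close>

lemma vscale_sign: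
  assumes U: "vsp U" and x: "x \<in> vcar U"
  shows "vscale U ((- 1) ^ k) (vscale U ((- 1) ^ k) x) = x"
proof (rule vsp_eqI[OF U])
  fix l assume l: "vlinear U vfield l"
  have "l (vscale U ((- 1) ^ k) (vscale U ((- 1) ^ k) x)) = (- 1) ^ k * ((- 1) ^ k * l x)"
    using U x by (simp only: vform_scale[OF l] vsp_scale)
  then show "l (vscale U ((- 1) ^ k) (vscale U ((- 1) ^ k) x)) = l x"
    by (simp flip: mult.assoc power_mult_distrib)
qed (use U x in auto)

context quad
begin

lemma vsp_MC [simp]: "vsp (MC n q)"
  by (simp add: vsp_vhom)

lemma MC_eval: "u \<in> W n \<Longrightarrow> b \<in> alg q \<Longrightarrow> vlinear (MC n q) vfield (\<lambda>f. f u b)"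
  by (simp add: vlinear_def vdual_ops)

lemma sepset_MC: "sepset (MC n q) {\<lambda>f. f u b | u b. u \<in> W n \<and> b \<in> alg q}"
  unfolding sepset_def by (auto intro: MC_eval MC_eqI)

lemma MC_vlinearI:
  assumes "vsp U" "\<And>x. x \<in> vcar U \<Longrightarrow> f x \<in> vcar (MC n q)"
    and "\<And>w b. w \<in> W n \<Longrightarrow> b \<in> alg q \<Longrightarrow> vlinear U vfield (\<lambda>x. f x w b)"
  shows "vlinear U (MC n q) f"
  by (rule vlinear_sepI[OF assms(1) vsp_MC sepset_MC]) (use assms in auto)

lemma vform_minus: "vlinear U vfield l \<Longrightarrow> vlinear U vfield l' \<Longrightarrow> vlinear U vfield (\<lambda>x. l x - l' x)"
  by (intro vlinear_formI) (auto simp: vform_add vform_scale algebra_simps)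

lemma zero_vlinear: "vsp U \<Longrightarrow> vlinear X U (\<lambda>_. vzero U)"
  by (simp add: vlinear_def vsp_zero_add vsp_scale_zero)

lemma bKm_M_in: "g \<in> vcar (MC n q) \<Longrightarrow> dM n q g \<in> vcar (MC (n + 1) (q - 1))"
  by (cases q) (use bKm_M_Suc(2) vsp_zero[OF vsp_MC] in \<open>simp_all add: bKm_M_0 del: vhom_simps\<close>)

lemma bKm_M_vlinear: "vlinear (MC n q) (MC (n + 1) (q - 1)) (dM n q)"
proof (cases q)
  case 0
  then show ?thesis using zero_vlinear[OF vsp_MC, of "MC n 0" "n + 1" 0]
    by (simp add: bKm_M_0 vlinear_def del: vhom_simps)
next
  case (Suc l)
  have "vlinear (MC n (Suc l)) (MC (n + 1) l) (dM n (Suc l))"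
  proof (rule MC_vlinearI[OF vsp_MC bKm_M_Suc(2)])
    fix w b assume w: "w \<in> W (n + 1)" and b: "b \<in> alg l"
    have w': "w \<in> W (1 + n)" using w by simp
    have "vlinear (MC n (Suc l)) vfield (\<lambda>g. Lam n 1 (\<lambda>u x. g u (mul 1 l (gen x) b)) w
        - (-1) ^ l * Lam 1 n (\<lambda>x u. g u (mul l 1 b (gen x))) w)"
      using b by (intro vform_minus vform_scaled Lam_param[OF w] Lam_param[OF w'] MC_eval qmul_in' qgen_in) simp_all
    then show "vlinear (MC n (Suc l)) vfield (\<lambda>g. dM n (Suc l) g w b)"
      by (rule vform_cong) (simp_all only: bKm_M_Suc(1)[OF _ w b] vsp_add[OF vsp_MC] vsp_scale[OF vsp_MC])
  qed
  then show ?thesis using Suc by simp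
qed

lemma Mcocyc_M: "ZM n q = {g \<in> vcar (MC n q). dM n q g = vzero (MC (n + 1) (q - 1))}"
  by (simp add: Mcocyc_def MC_Mcoch)

lemma Mcobd_M_0: "BM 0 q = {vzero (MC 0 q)}"
  by (simp add: Mcobd_def MC_Mcoch)

text \<open>For \<open>q = 0\<close> the equation \<open>q = bwt M q' 1\<close> has the extra
  solution \<open>q' = 0\<close>, by truncation. The differential vanishes there and so contributes
  only zero, which lies in the image anyway.\<close>

lemma Mcobd_M_Suc: "BM (Suc n) q = dM n (Suc q) ` vcar (MC n (Suc q))"
proof (intro equalityI subsetI)
  have z: "vzero (MC (Suc n) q) \<in> dM n (Suc q) ` vcar (MC n (Suc q))"
    using vsubsp_image(3)[OF vsp_MC vsp_MC bKm_M_vlinear bKm_M_in, of n "Suc q"]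
    by (intro image_eqI[of _ _ "vzero (MC n (Suc q))"] vsp_zero[OF vsp_MC]) (simp del: vhom_simps)
  fix x assume "x \<in> BM (Suc n) q"
  then consider "x = vzero (MC (Suc n) q)" | q' f where "x = dM n q' f" "q = q' - 1" "f \<in> vcar (MC n q')"
    by (auto simp: Mcobd_def MC_Mcoch)
  then show "x \<in> dM n (Suc q) ` vcar (MC n (Suc q))"
  proof cases
    case 2
    then show ?thesis using z by (cases q') (simp_all add: bKm_M_0 del: vhom_simps)
  qed (use z in simp)
next
  fix x assume "x \<in> dM n (Suc q) ` vcar (MC n (Suc q))"
  then show "x \<in> BM (Suc n) q"
    by (fastforce simp: Mcobd_def MC_Mcoch)
qed

lemma vsubsp_Mcocyc: "vsubsp (MC n q) (ZM n q)"
  unfolding Mcocyc_M by (rule vsubsp_image(2)[OF vsp_MC vsp_MC bKm_M_vlinear bKm_M_in])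

lemma vsubsp_Mcobd: "vsubsp (MC n q) (BM n q)"
proof (cases n)
  case 0
  then show ?thesis using vsp_zero[OF vsp_MC, of 0 q]
    by (simp add: Mcobd_M_0 vsubsp_def vsp_zero_add[OF vsp_MC] vsp_scale_zero[OF vsp_MC] del: vhom_simps)
next
  case (Suc k)
  then show ?thesis
    using vsubsp_image(1)[OF vsp_MC vsp_MC bKm_M_vlinear bKm_M_in, of k "Suc q"] by (simp add: Mcobd_M_Suc)
qed

lemma Mcobd_Mcocyc: "BM n q \<subseteq> ZM n q"
proof (cases n)
  case 0
  then show ?thesis using vsubsp_Mcocyc[of 0 q] by (simp add: Mcobd_M_0 vsubsp_def)
next
  case (Suc k)
  have "dM (Suc k) q (dM k (Suc q) g) = vzero (MC (Suc k + 1) (q - 1))"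
    if "g \<in> vcar (MC k (Suc q))" for g
    using bKm_bKm[of g k "q - 1"] that bKm_M_0 by (cases q) (simp_all del: vhom_simps)
  then show ?thesis
    using Suc bKm_M_in[of _ k "Suc q"] by (auto simp: Mcobd_M_Suc Mcocyc_M simp del: vhom_simps)
qed

section \<open>Cup actions on cocycles and coboundaries\<close>

abbreviation N where "N \<equiv> regular_bimod V R"
abbreviation ZN where "ZN \<equiv> Mcocyc V R N"
abbreviation BN where "BN \<equiv> Mcobd V R N"
abbreviation NC where "NC p m \<equiv> vhom (qW V R p) (qalg V R m)"

lemma N_simps [simp]: "bcomp N m = qalg V R m" "bwt N m n = m + n"
  by (simp_all add: regular_bimod_def)

lemma vsp_NC [simp]: "vsp (NC p m)"
  by (simp add: vsp_vhom)

lemma NC_Mcoch: "Mcoch V R N p m = NC p m"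
  by (simp add: Mcoch_def)

lemma NC_eval: "aform m h \<Longrightarrow> u \<in> W p \<Longrightarrow> vlinear (NC p m) vfield (\<lambda>F. h (F u))"
  by (intro vlinear_formI) (simp_all add: vhom_in vform_add vform_scale)

lemma mcup_in:
  assumes F: "F \<in> vcar (NC p m)" and g: "g \<in> vcar (MC q n)"
  shows "cupl p m q n F g \<in> vcar (MC (p + q) (n - m))"
    and "cupr p m q n g F \<in> vcar (MC (q + p) (n - m))"
proof -
  have "cupl p m q n F g \<in> vcar (MC (p + q) (n - m)) \<and> cupr p m q n g F \<in> vcar (MC (q + p) (n - m))"
  proof (cases "n < m")
    case True
    then show ?thesis using vsp_zero[OF vsp_MC] by (simp add: mcup_M0 del: vhom_simps)
  next
    case False
    then obtain l where l: "n = m + l" by (metis le_Suc_ex not_le)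
    show ?thesis using mcupl_M(2)[OF linq_vhom[OF F]] mcupr_M(2)[OF linq_vhom[OF F]] g by (simp add: l)
  qed
  then show "cupl p m q n F g \<in> vcar (MC (p + q) (n - m))"
    and "cupr p m q n g F \<in> vcar (MC (q + p) (n - m))" by simp_all
qed

lemma mcup_vlinear_M:
  assumes F: "F \<in> vcar (NC p m)"
  shows "vlinear (MC q n) (MC (p + q) (n - m)) (\<lambda>g. cupl p m q n F g)"
    and "vlinear (MC q n) (MC (q + p) (n - m)) (\<lambda>g. cupr p m q n g F)"
proof -
  note L = linq_vhom[OF F]
  have "vlinear (MC q n) (MC (p + q) (n - m)) (\<lambda>g. cupl p m q n F g) \<and>
    vlinear (MC q n) (MC (q + p) (n - m)) (\<lambda>g. cupr p m q n g F)"
  proof (cases "n < m")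
    case True
    then show ?thesis by (simp add: mcup_M0 del: vhom_simps) (intro conjI zero_vlinear vsp_MC)
  next
    case False
    then obtain l where l: "n = m + l" by (metis le_Suc_ex not_le)
    have "vlinear (MC q (m + l)) (MC (p + q) l) (\<lambda>g. cupl p m q (m + l) F g)"
    proof (rule MC_vlinearI[OF vsp_MC mcupl_M(2)[OF L]])
      fix w b assume w: "w \<in> W (p + q)" and b: "b \<in> alg l"
      have "vlinear (MC q (m + l)) vfield (\<lambda>g. (-1) ^ (m * (m + l) + m) * Lam p q (\<lambda>u v. g v (mul l m b (F u))) w)"
        using b by (intro vform_scaled Lam_param[OF w] MC_eval qmul_in' linq_in[OF L]) simp_all
      then show "vlinear (MC q (m + l)) vfield (\<lambda>g. cupl p m q (m + l) F g w b)"
        by (rule vform_cong) (simp_all only: mcupl_M(1)[OF L _ w b] vsp_add[OF vsp_MC] vsp_scale[OF vsp_MC])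
    qed
    moreover have "vlinear (MC q (m + l)) (MC (q + p) l) (\<lambda>g. cupr p m q (m + l) g F)"
    proof (rule MC_vlinearI[OF vsp_MC mcupr_M(2)[OF L]])
      fix w b assume w: "w \<in> W (q + p)" and b: "b \<in> alg l"
      have "vlinear (MC q (m + l)) vfield (\<lambda>g. (-1) ^ ((m + l) * m) * Lam q p (\<lambda>v u. g v (mul m l (F u) b)) w)"
        using b by (intro vform_scaled Lam_param[OF w] MC_eval qmul_in' linq_in[OF L]) simp_all
      then show "vlinear (MC q (m + l)) vfield (\<lambda>g. cupr p m q (m + l) g F w b)"
        by (rule vform_cong) (simp_all only: mcupr_M(1)[OF L _ w b] vsp_add[OF vsp_MC] vsp_scale[OF vsp_MC])
    qed
    ultimately show ?thesis by (simp add: l)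
  qed
  then show "vlinear (MC q n) (MC (p + q) (n - m)) (\<lambda>g. cupl p m q n F g)"
    and "vlinear (MC q n) (MC (q + p) (n - m)) (\<lambda>g. cupr p m q n g F)" by simp_all
qed

lemma mcup_vlinear_N:
  assumes g: "g \<in> vcar (MC q n)"
  shows "vlinear (NC p m) (MC (p + q) (n - m)) (\<lambda>F. cupl p m q n F g)"
    and "vlinear (NC p m) (MC (q + p) (n - m)) (\<lambda>F. cupr p m q n g F)"
proof -
  have "vlinear (NC p m) (MC (p + q) (n - m)) (\<lambda>F. cupl p m q n F g) \<and>
    vlinear (NC p m) (MC (q + p) (n - m)) (\<lambda>F. cupr p m q n g F)"
  proof (cases "n < m")
    case True
    then show ?thesis by (simp add: mcup_M0 del: vhom_simps) (intro conjI zero_vlinear vsp_MC)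
  next
    case False
    then obtain l where l: "n = m + l" by (metis le_Suc_ex not_le)
    have g': "g \<in> vcar (MC q (m + l))" using g l by simp
    have "vlinear (NC p m) (MC (p + q) l) (\<lambda>F. cupl p m q (m + l) F g)"
    proof (rule MC_vlinearI[OF vsp_NC mcupl_M(2)[OF linq_vhom g']])
      fix w b assume w: "w \<in> W (p + q)" and b: "b \<in> alg l"
      have "vlinear (NC p m) vfield (\<lambda>F. (-1) ^ (m * (m + l) + m) * Lam p q (\<lambda>u v. g v (mul l m b (F u))) w)"
        using b by (intro vform_scaled Lam_param[OF w] NC_eval qmul_form_r[OF MC_form[OF g']]) simp_all
      then show "vlinear (NC p m) vfield (\<lambda>F. cupl p m q (m + l) F g w b)"
        by (rule vform_cong) (simp_all only: mcupl_M(1)[OF linq_vhom g' w b] vsp_add[OF vsp_NC] vsp_scale[OF vsp_NC])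
    qed
    moreover have "vlinear (NC p m) (MC (q + p) l) (\<lambda>F. cupr p m q (m + l) g F)"
    proof (rule MC_vlinearI[OF vsp_NC mcupr_M(2)[OF linq_vhom g']])
      fix w b assume w: "w \<in> W (q + p)" and b: "b \<in> alg l"
      have "vlinear (NC p m) vfield (\<lambda>F. (-1) ^ ((m + l) * m) * Lam q p (\<lambda>v u. g v (mul m l (F u) b)) w)"
        using b by (intro vform_scaled Lam_param[OF w] NC_eval qmul_form_l[OF MC_form[OF g']]) simp_all
      then show "vlinear (NC p m) vfield (\<lambda>F. cupr p m q (m + l) g F w b)"
        by (rule vform_cong) (simp_all only: mcupr_M(1)[OF linq_vhom g' w b] vsp_add[OF vsp_NC] vsp_scale[OF vsp_NC])
    qed
    ultimately show ?thesis by (simp add: l)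
  qed
  then show "vlinear (NC p m) (MC (p + q) (n - m)) (\<lambda>F. cupl p m q n F g)"
    and "vlinear (NC p m) (MC (q + p) (n - m)) (\<lambda>F. cupr p m q n g F)" by simp_all
qed

lemma mcup_zero_M:
  assumes "F \<in> vcar (NC p m)"
  shows "cupl p m q n F (vzero (MC q n)) = vzero (MC (p + q) (n - m))"
    and "cupr p m q n (vzero (MC q n)) F = vzero (MC (q + p) (n - m))"
  using vsubsp_image(3)[OF vsp_MC vsp_MC mcup_vlinear_M(1)[OF assms] mcup_in(1)[OF assms]]
    vsubsp_image(3)[OF vsp_MC vsp_MC mcup_vlinear_M(2)[OF assms] mcup_in(2)[OF assms]] by blast+

lemma mcup_zero_N:
  assumes "g \<in> vcar (MC q n)"
  shows "cupl p m q n (vzero (NC p m)) g = vzero (MC (p + q) (n - m))"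
    and "cupr p m q n g (vzero (NC p m)) = vzero (MC (q + p) (n - m))"
  using vsubsp_image(3)[OF vsp_NC vsp_MC mcup_vlinear_N(1)[OF assms] mcup_in(1)[OF _ assms]]
    vsubsp_image(3)[OF vsp_NC vsp_MC mcup_vlinear_N(2)[OF assms] mcup_in(2)[OF _ assms]] by blast+

lemma Mcocyc_N: "F \<in> ZN p m \<longleftrightarrow> F \<in> vcar (NC p m) \<and> bK (- ((-1) ^ m)) p m F = vzero (NC (p + 1) (m + 1))"
  by (simp add: Mcocyc_def NC_Mcoch bKm_bK del: vhom_simps)

lemma Mcobd_N: "F \<in> BN p m \<longleftrightarrow> F = vzero (NC p m) \<or>
    (\<exists>p' m' h. p = p' + 1 \<and> m = m' + 1 \<and> h \<in> vcar (NC p' m') \<and> F = bK (- ((-1) ^ m')) p' m' h)"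
  by (auto simp: Mcobd_def NC_Mcoch bKm_bK simp del: vhom_simps)

text \<open>For \<open>n \<le> m\<close> the result has coefficient weight 0, where every cochain is
  a cocycle. Otherwise both summands of the Leibniz rule are products with a zero factor.\<close>

lemma mcup_cocyc:
  assumes F: "F \<in> ZN p m" and g: "g \<in> ZM q n"
  shows "cupl p m q n F g \<in> ZM (p + q) (n - m)"
    and "cupr p m q n g F \<in> ZM (q + p) (n - m)"
proof -
  have F': "F \<in> vcar (NC p m)" "bK (- ((-1) ^ m)) p m F = vzero (NC (p + 1) (m + 1))"
    using F by (simp_all add: Mcocyc_N del: vhom_simps)
  have g': "g \<in> vcar (MC q n)" "dM q n g = vzero (MC (q + 1) (n - 1))"
    using g by (simp_all add: Mcocyc_M del: vhom_simps)
  have "dM (p + q) (n - m) (cupl p m q n F g) = vzero (MC (p + q + 1) (n - m - 1)) \<and>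
    dM (q + p) (n - m) (cupr p m q n g F) = vzero (MC (q + p + 1) (n - m - 1))"
  proof (cases "n \<le> m")
    case True
    then show ?thesis by (simp add: bKm_M_0 del: vhom_simps)
  next
    case False
    then obtain l where l: "n = m + Suc l" by (metis add_Suc_right less_imp_Suc_add not_le)
    have z: "g \<in> vcar (MC q (m + Suc l))" "dM q (m + Suc l) g = vzero (MC (q + 1) (m + l))"
      using g' l by (simp_all del: vhom_simps)
    have z1: "cupl (p + 1) (m + 1) q (m + Suc l) (vzero (NC (p + 1) (m + 1))) g = vzero (MC (p + q + 1) l)"
      "cupr (p + 1) (m + 1) q (m + Suc l) g (vzero (NC (p + 1) (m + 1))) = vzero (MC (q + p + 1) l)"
      using mcup_zero_N[OF z(1), of "p + 1" "m + 1"] by (simp_all del: vhom_simps)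
    have z2: "cupl p m (q + 1) (m + l) F (vzero (MC (q + 1) (m + l))) = vzero (MC (p + q + 1) l)"
      "cupr p m (q + 1) (m + l) (vzero (MC (q + 1) (m + l))) F = vzero (MC (q + p + 1) l)"
      using mcup_zero_M[OF F'(1), of "q + 1" "m + l"] by (simp_all del: vhom_simps)
    show ?thesis
      using leibniz_left[OF linq_vhom[OF F'(1)] z(1)] leibniz_right[OF linq_vhom[OF F'(1)] z(1)] l
      unfolding F'(2) z(2) z1 z2
      by (simp add: vsp_zero_add[OF vsp_MC] vsp_scale_zero[OF vsp_MC] del: vhom_simps)
  qed
  then show "cupl p m q n F g \<in> ZM (p + q) (n - m)"
    and "cupr p m q n g F \<in> ZM (q + p) (n - m)"
    using mcup_in[OF F'(1) g'(1)] by (simp_all add: Mcocyc_M del: vhom_simps)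
qed

text \<open>If \<open>F\<close> is the differential of \<open>h\<close>, the Leibniz rule for
  \<open>h\<close> and the cocycle \<open>g\<close> exhibits the product as a coboundary; in the
  right action this holds up to a sign.\<close>

lemma mcup_cobd_N:
  assumes F: "F \<in> BN p m" and g: "g \<in> ZM q n"
  shows "cupl p m q n F g \<in> BM (p + q) (n - m)"
    and "cupr p m q n g F \<in> BM (q + p) (n - m)"
proof -
  have g': "g \<in> vcar (MC q n)" "dM q n g = vzero (MC (q + 1) (n - 1))"
    using g by (simp_all add: Mcocyc_M del: vhom_simps)
  have z: "vzero (MC i j) \<in> BM i j" for i j
    using vsubsp_Mcobd by (simp add: vsubsp_def)
  \<comment> \<open>As \<open>h\<close> has coefficient weight \<open>m' = m - 1\<close>, the case
    \<open>m \<le> n\<close> always gives \<open>n = m' + Suc l\<close>, the form required by the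
    Leibniz rules.\<close>
  consider "F = vzero (NC p m)" | "n < m" | p' m' h l where "p = p' + 1" "m = m' + 1" "h \<in> vcar (NC p' m')"
    "F = bK (- ((-1) ^ m')) p' m' h" "n = m' + Suc l"
  proof (cases "n < m")
    case False
    then obtain l where "n = m + l" by (metis le_Suc_ex not_le)
    then show thesis using F[unfolded Mcobd_N] that(1) that(3)[of _ _ _ l] by auto
  qed (rule that(2))
  then have "cupl p m q n F g \<in> BM (p + q) (n - m) \<and> cupr p m q n g F \<in> BM (q + p) (n - m)"
  proof cases
    case 1
    then show ?thesis using mcup_zero_N[OF g'(1), of p m] z by (simp del: vhom_simps)
  next
    case 2
    then show ?thesis using z by (simp add: mcup_M0 del: vhom_simps)
  next
    case 3
    note L = linq_vhom[OF 3(3)]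
    have g1: "g \<in> vcar (MC q (m' + Suc l))" "dM q (m' + Suc l) g = vzero (MC (q + 1) (m' + l))"
      using g' 3 by (simp_all del: vhom_simps)
    have z2: "cupl p' m' (q + 1) (m' + l) h (vzero (MC (q + 1) (m' + l))) = vzero (MC (p' + q + 1) l)"
      "cupr p' m' (q + 1) (m' + l) (vzero (MC (q + 1) (m' + l))) h = vzero (MC (q + p' + 1) l)"
      using mcup_zero_M[OF 3(3), of "q + 1" "m' + l"] by (simp_all del: vhom_simps)
    have F': "F \<in> vcar (NC p m)" using bK_form(2)[OF L] 3 by simp
    have mem: "cupl p m q n F g \<in> vcar (MC (p' + q + 1) l)"
      "cupr p m q n g F \<in> vcar (MC (q + p' + 1) l)"
      using mcup_in[OF F' g'(1)] 3 by simp_all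
    have l: "dM (p' + q) (Suc l) (cupl p' m' q (m' + Suc l) h g) = cupl p m q n F g"
      using leibniz_left[OF L g1(1)] mem(1) 3 unfolding g1(2) z2
      by (simp add: vsp_add_zero[OF vsp_MC] vsp_scale_zero[OF vsp_MC] del: vhom_simps)
    have "cupr p' m' (q + 1) (m' + l) (dM q (m' + Suc l) g) h = vzero (MC (q + p' + 1) l)"
      unfolding g1(2) z2 ..
    then have "dM (q + p') (Suc l) (cupr p' m' q (m' + Suc l) g h)
      = vscale (MC (q + p' + 1) l) ((-1) ^ (m' + Suc l)) (cupr p m q n g F)"
      using leibniz_right[OF L g1(1)] mem(2) 3 vsp_scale[OF vsp_MC mem(2)]
      by (simp add: vsp_zero_add[OF vsp_MC] del: vhom_simps)
    moreover have "vscale (MC (q + p' + 1) l) ((-1) ^ (m' + Suc l))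
        (vscale (MC (q + p' + 1) l) ((-1) ^ (m' + Suc l)) (cupr p m q n g F)) = cupr p m q n g F"
      by (rule vscale_sign[OF vsp_MC mem(2)])
    moreover have "dM (q + p') (Suc l) (cupr p' m' q (m' + Suc l) g h) \<in> BM (q + p' + 1) l"
      using mcup_in(2)[OF 3(3) g1(1)] by (auto simp: Mcobd_M_Suc)
    ultimately have "cupr p m q n g F \<in> BM (q + p' + 1) l"
      using vsubsp_Mcobd[of "q + p' + 1" l] unfolding vsubsp_def by metis
    moreover have "cupl p m q n F g \<in> BM (p' + q + 1) l"
      unfolding l[symmetric] using mcup_in(1)[OF 3(3) g1(1)] by (auto simp: Mcobd_M_Suc)
    ultimately show ?thesis using 3 by simp
  qed
  then show "cupl p m q n F g \<in> BM (p + q) (n - m)"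
    and "cupr p m q n g F \<in> BM (q + p) (n - m)" by simp_all
qed

text \<open>The Leibniz rule is applied to the cocycle \<open>F\<close> and a primitive
  \<open>k\<close> of \<open>g\<close>. This time it is the left action that acquires a sign,
  because the differential of the second factor carries it.\<close>

lemma mcup_cobd_M:
  assumes F: "F \<in> ZN p m" and g: "g \<in> BM q n"
  shows "cupl p m q n F g \<in> BM (p + q) (n - m)"
    and "cupr p m q n g F \<in> BM (q + p) (n - m)"
proof -
  have F': "F \<in> vcar (NC p m)" "bK (- ((-1) ^ m)) p m F = vzero (NC (p + 1) (m + 1))"
    using F by (simp_all add: Mcocyc_N del: vhom_simps)
  note L = linq_vhom[OF F'(1)]
  have z: "vzero (MC i j) \<in> BM i j" for i j
    using vsubsp_Mcobd by (simp add: vsubsp_def)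
  consider "g = vzero (MC q n)" | "n < m" | q' k l where "q = Suc q'" "k \<in> vcar (MC q' (m + Suc l))"
    "g = dM q' (m + Suc l) k" "n = m + l"
  proof (cases "q = 0 \<or> n < m")
    case True
    then show thesis using g that(1,2) by (auto simp: Mcobd_M_0 simp del: vhom_simps)
  next
    case False
    then obtain l q' where "n = m + l" "q = Suc q'" by (metis le_Suc_ex not_le not0_implies_Suc)
    then show thesis using g that(3)[of q' _ l] by (auto simp: Mcobd_M_Suc)
  qed
  then have "cupl p m q n F g \<in> BM (p + q) (n - m) \<and> cupr p m q n g F \<in> BM (q + p) (n - m)"
  proof cases
    case 1
    then show ?thesis using mcup_zero_M[OF F'(1), of q n] z by (simp del: vhom_simps)
  next
    case 2
    then show ?thesis using z by (simp add: mcup_M0 del: vhom_simps)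
  next
    case 3
    have z1: "cupl (p + 1) (m + 1) q' (m + Suc l) (vzero (NC (p + 1) (m + 1))) k = vzero (MC (p + q' + 1) l)"
      "cupr (p + 1) (m + 1) q' (m + Suc l) k (vzero (NC (p + 1) (m + 1))) = vzero (MC (q' + p + 1) l)"
      using mcup_zero_N[OF 3(2), of "p + 1" "m + 1"] by (simp_all del: vhom_simps)
    have g': "g \<in> vcar (MC q n)" using bKm_M_in[OF 3(2)] 3 by simp
    have mem: "cupl p m q n F g \<in> vcar (MC (p + q' + 1) l)"
      "cupr p m q n g F \<in> vcar (MC (q' + p + 1) l)"
      using mcup_in[OF F'(1) g'] 3 by simp_all
    have r: "dM (q' + p) (Suc l) (cupr p m q' (m + Suc l) k F) = cupr p m q n g F"
      using leibniz_right[OF L 3(2)] mem(2) 3 unfolding F'(2) z1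
      by (simp add: vsp_add_zero[OF vsp_MC] vsp_scale_zero[OF vsp_MC] del: vhom_simps)
    have "cupl (p + 1) (m + 1) q' (m + Suc l) (bK (- ((-1) ^ m)) p m F) k = vzero (MC (p + q' + 1) l)"
      unfolding F'(2) z1 ..
    then have "dM (p + q') (Suc l) (cupl p m q' (m + Suc l) F k)
      = vscale (MC (p + q' + 1) l) ((-1) ^ m) (cupl p m q n F g)"
      using leibniz_left[OF L 3(2)] 3 vsp_scale[OF vsp_MC mem(1)]
      by (simp add: vsp_zero_add[OF vsp_MC] del: vhom_simps)
    moreover have "vscale (MC (p + q' + 1) l) ((-1) ^ m)
        (vscale (MC (p + q' + 1) l) ((-1) ^ m) (cupl p m q n F g)) = cupl p m q n F g"
      by (rule vscale_sign[OF vsp_MC mem(1)])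
    moreover have "dM (p + q') (Suc l) (cupl p m q' (m + Suc l) F k) \<in> BM (p + q' + 1) l"
      using mcup_in(1)[OF F'(1) 3(2)] by (auto simp: Mcobd_M_Suc)
    ultimately have "cupl p m q n F g \<in> BM (p + q' + 1) l"
      using vsubsp_Mcobd[of "p + q' + 1" l] unfolding vsubsp_def by metis
    moreover have "cupr p m q n g F \<in> BM (q' + p + 1) l"
      unfolding r[symmetric] using mcup_in(2)[OF F'(1) 3(2)] by (auto simp: Mcobd_M_Suc)
    ultimately show ?thesis using 3 by simp
  qed
  then show "cupl p m q n F g \<in> BM (p + q) (n - m)"
    and "cupr p m q n g F \<in> BM (q + p) (n - m)" by simp_all
qed

end

section \<open>The comparison maps\<close>

context qdual
begin

text \<open>Multiplication in A is dual to splitting W^!_(m+n) into W^!_m (x) W^!_n: the pairing is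
  multiplicative on products of tensors, and \<open>B.Lam_restrict\<close> reads this along
  \<open>\<omega>\<close>.\<close>

lemma evA_mul:
  assumes w: "\<omega> \<in> B.W (m + n)" and X: "X \<in> A.alg m" and Y: "Y \<in> A.alg n"
  shows "evA \<omega> (A.mul m n X Y) = B.Lam m n (\<lambda>\<omega>1 \<omega>2. evA \<omega>1 X * evA \<omega>2 Y) \<omega>"
proof -
  obtain s t where s: "s \<in> A.T m" "X = A.cl m s" and t: "t \<in> A.T n" "Y = A.cl n t"
    using X Y by (auto elim!: A.qalgE)
  have "evA \<omega> (A.mul m n X Y) = tpair \<omega> (tmul V s t)"
    using w s t by (simp add: A.qmul_cl evA_cl A.tmul_in)
  also have "\<dots> = B.Lam m n (\<lambda>\<omega>1 \<omega>2. tpair (tmul V' \<omega>1 \<omega>2) (tmul V s t)) \<omega>"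
    by (rule B.Lam_restrict[OF tpair_linear_left w, symmetric])
  also have "\<dots> = B.Lam m n (\<lambda>\<omega>1 \<omega>2. evA \<omega>1 X * evA \<omega>2 Y) \<omega>"
    by (rule B.Lam_cong[OF w]) (use s t in \<open>simp add: tpair_tmul[where m = m and n = n] B.W_T evA_cl\<close>)
  finally show ?thesis .
qed

lemma evB_mul:
  assumes w: "w \<in> A.W (m + n)" and X: "X \<in> B.alg m" and Y: "Y \<in> B.alg n"
  shows "evB (B.mul m n X Y) w = A.Lam m n (\<lambda>u v. evB X u * evB Y v) w"
proof -
  obtain s t where s: "s \<in> B.T m" "X = B.cl m s" and t: "t \<in> B.T n" "Y = B.cl n t"
    using X Y by (auto elim!: B.qalgE)
  have "evB (B.mul m n X Y) w = tpair (tmul V' s t) w"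
    using w s t by (simp add: B.qmul_cl evB_cl B.tmul_in)
  also have "\<dots> = A.Lam m n (\<lambda>u v. tpair (tmul V' s t) (tmul V u v)) w"
    by (rule A.Lam_restrict[OF tpair_linear_right w, symmetric]) (use s t in \<open>intro B.tmul_in\<close>)
  also have "\<dots> = A.Lam m n (\<lambda>u v. evB X u * evB Y v) w"
    by (rule A.Lam_cong[OF w]) (use s t in \<open>simp add: tpair_tmul[where m = m and n = n] A.W_T evB_cl\<close>)
  finally show ?thesis .
qed

lemma ev_qgen: "\<xi> \<in> B.W 1 \<Longrightarrow> x \<in> A.W 1 \<Longrightarrow> evB (B.gen \<xi>) x = evA \<xi> (A.gen x)"
  unfolding qgen_def by (simp only: evA_cl evB_cl A.W_T B.W_T)

text \<open>Splitting \<open>w\<close> and splitting \<open>\<omega>\<close> are independent finite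
  sums, which is what lets an operation on chains be traded for one on dual cochains.\<close>

lemma Lam_swap: "A.Lam p q (\<lambda>u v. B.Lam m n (\<lambda>s t. G u v s t) \<omega>) w
    = B.Lam m n (\<lambda>s t. A.Lam p q (\<lambda>u v. G u v s t) w) \<omega>"
  unfolding A.Lam_def B.Lam_def by (rule sum.swap)

text \<open>The element \<open>\<omega>\<close> (x) \<open>b\<close> seen as a bilinear form on A_n
  and W_q. Chains are functionals on bilinear forms, so \<open>theta\<close> only has to evaluate
  them here.\<close>

definition fm :: "('k, 'a \<Rightarrow> 'k) tensor \<Rightarrow> ('k, 'a \<Rightarrow> 'k) tensor set \<Rightarrow>
    ('k, 'a) tensor set \<Rightarrow> ('k, 'a) tensor \<Rightarrow> 'k" where
  "fm \<omega> b = (\<lambda>a w. evA \<omega> a * evB b w)"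

lemma fm_bforms: "\<omega> \<in> B.W n \<Longrightarrow> b \<in> B.alg q \<Longrightarrow> fm \<omega> b \<in> kforms n q"
  unfolding fm_def by (intro bformsI vform_scaled vform_scaled' evA_linear evB_linear_right)

lemma Kch_ops [simp]: "vadd (K q n) = (+)" "vzero (K q n) = 0" "vscale (K q n) = fscale"
  by (simp_all add: Kch_def vtens_def)

lemma Kch_span: "K q n = fsub (fspan {kpure q n a w | a w. a \<in> A.alg n \<and> w \<in> A.W q})"
  by (simp add: Kch_def vtens_def Kpure_def)

lemma vsp_Kch [simp]: "vsp (K q n)"
  unfolding Kch_span by (intro vsp_fsub subspace_fspan)

lemma Kpure_in: "a \<in> A.alg n \<Longrightarrow> w \<in> A.W q \<Longrightarrow> kpure q n a w \<in> Kc q n"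
  unfolding Kch_span by (auto intro: fspan_base)

lemma Kpure_apply: "\<phi> \<in> kforms n q \<Longrightarrow> kpure q n a w \<phi> = \<phi> a w"
  by (simp add: Kpure_def ptens_def)

lemma Kpure_fm: "\<omega> \<in> B.W n \<Longrightarrow> b \<in> B.alg q \<Longrightarrow> kpure q n a w (fm \<omega> b) = evA \<omega> a * evB b w"
  by (simp add: Kpure_apply fm_bforms) (simp add: fm_def)

lemma Kch_eval: "vlinear (K q n) vfield (\<lambda>z. z \<phi>)"
  by (simp add: vlinear_def fscale_def)

lemma Kch_form_eq:
  assumes "vlinear (K q n) vfield l" "vlinear (K q n) vfield l'" "z \<in> Kc q n"
    and "\<And>a w. a \<in> A.alg n \<Longrightarrow> w \<in> A.W q \<Longrightarrow> l (kpure q n a w) = l' (kpure q n a w)"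
  shows "l z = l' z"
  by (rule vform_span_eq[OF _ assms(1-3)[unfolded Kch_span fsub_simps(1)]]) (use assms(4) in auto)

lemma Kch_off: "z \<in> Kc q n \<Longrightarrow> \<phi> \<notin> kforms n q \<Longrightarrow> z \<phi> = 0"
  by (rule Kch_form_eq[OF Kch_eval vform_scaled[OF Kch_eval], of z q n \<phi> 0 \<phi>, simplified])
     (simp_all add: Kpure_def ptens_def)

lemma evB_eI: "J \<in> A.wd q \<Longrightarrow> w \<in> A.W q \<Longrightarrow> evB (B.cl q (B.eI J)) w = A.cf w J"
  by (simp add: evB_cl tpair_cf[where m = q] A.W_T B.cf_eI if_distrib[of "\<lambda>x. x * _"] cong: if_cong)

text \<open>For chains every bilinear form is a finite sum of forms \<open>fm\<close>: the second
  argument is expanded with \<open>A.Pj\<close>, the coefficient \<open>A.cf w J\<close> being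
  evaluation of a class in A^!, and the form left in the first argument is represented by
  \<open>formA\<close>. Injectivity of \<open>theta\<close> rests on this.\<close>

lemma Kch_decomp:
  assumes "\<phi> \<in> kforms n q"
  obtains \<omega> where "\<And>J. \<omega> J \<in> B.W n"
    "\<And>z. z \<in> Kc q n \<Longrightarrow> z \<phi> = (\<Sum>J\<in>A.wd q. 1 * z (fm (\<omega> J) (B.cl q (B.eI J))))"
proof -
  have "\<exists>\<omega>. \<omega> \<in> B.W n \<and> (\<forall>a\<in>A.alg n. \<phi> a (A.Pj q (A.eI J)) = evA \<omega> a)" for J
    using formA[OF bforms_left[OF assms A.Pj(2)]] by metis
  then obtain \<omega> where \<omega>: "\<And>J. \<omega> J \<in> B.W n"
    "\<And>J a. a \<in> A.alg n \<Longrightarrow> \<phi> a (A.Pj q (A.eI J)) = evA (\<omega> J) a" by metis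
  have "z \<phi> = (\<Sum>J\<in>A.wd q. 1 * z (fm (\<omega> J) (B.cl q (B.eI J))))" if z: "z \<in> Kc q n" for z
  proof (rule Kch_form_eq[OF Kch_eval vform_comb[OF Kch_eval] z])
    fix a w assume a: "a \<in> A.alg n" and w: "w \<in> A.W q"
    have "\<phi> a w = \<phi> a (\<Sum>J\<in>A.wd q. fscale (A.cf w J) (A.Pj q (A.eI J)))"
      by (rule arg_cong[OF A.Pj_sum[OF w]])
    also have "\<dots> = (\<Sum>J\<in>A.wd q. A.cf w J * \<phi> a (A.Pj q (A.eI J)))"
      using bforms_right[OF assms a] by (intro vform_fsub_sum[OF A.subspace_W[of q]]) (simp_all add: A.Pj)
    finally show "kpure q n a w \<phi> = (\<Sum>J\<in>A.wd q. 1 * kpure q n a w (fm (\<omega> J) (B.cl q (B.eI J))))"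
      using a w by (simp add: Kpure_apply[OF assms] Kpure_fm \<omega> evB_eI mult.commute)
  qed
  with \<omega>(1) show thesis by (rule that)
qed

lemma sepset_Kch: "sepset (K q n) {\<lambda>z. z (fm \<omega> b) | \<omega> b. \<omega> \<in> B.W n \<and> b \<in> B.alg q}"
  unfolding sepset_def
proof (intro conjI ballI impI)
  fix z z' assume z: "z \<in> Kc q n" "z' \<in> Kc q n"
    and eq: "\<forall>l\<in>{\<lambda>z. z (fm \<omega> b) | \<omega> b. \<omega> \<in> B.W n \<and> b \<in> B.alg q}. l z = l z'"
  show "z = z'"
  proof
    fix \<phi> show "z \<phi> = z' \<phi>"
    proof (cases "\<phi> \<in> kforms n q")
      case True
      then obtain \<omega> where w: "\<And>J. \<omega> J \<in> B.W n"
        "\<And>z. z \<in> Kc q n \<Longrightarrow> z \<phi> = (\<Sum>J\<in>A.wd q. 1 * z (fm (\<omega> J) (B.cl q (B.eI J))))"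
        using Kch_decomp by blast
      have "z (fm (\<omega> J) (B.cl q (B.eI J))) = z' (fm (\<omega> J) (B.cl q (B.eI J)))" if "J \<in> A.wd q" for J
        using bspec[OF eq, of "\<lambda>z. z (fm (\<omega> J) (B.cl q (B.eI J)))"] w(1)[of J] B.cl_in[OF B.eI_in[OF that]] by blast
      then show ?thesis unfolding w(2)[OF z(1)] w(2)[OF z(2)] by (intro sum.cong refl) simp
    qed (simp add: Kch_off[OF z(1)] Kch_off[OF z(2)])
  qed
qed (auto intro: Kch_eval)

text \<open>A chain is a combination of evaluations at pure tensors, so it depends linearly on the
  bilinear form. This gives linearity of \<open>theta q n z\<close> in each of
  \<open>\<omega>\<close> and \<open>b\<close>.\<close>

lemma Kch_param:
  assumes z: "z \<in> Kc q n" and S: "vsp S"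
    and "\<And>s. s \<in> vcar S \<Longrightarrow> \<phi> s \<in> kforms n q"
    and "\<And>a w. a \<in> A.alg n \<Longrightarrow> w \<in> A.W q \<Longrightarrow> vlinear S vfield (\<lambda>s. \<phi> s a w)"
  shows "vlinear S vfield (\<lambda>s. z (\<phi> s))"
proof -
  have p: "kpure q n a w (\<phi> s) = \<phi> s a w" if "s \<in> vcar S" for s a w
    using that assms by (simp add: Kpure_apply)
  show ?thesis
  proof (rule vlinear_formI)
    fix s t assume s: "s \<in> vcar S" and t: "t \<in> vcar S"
    show "z (\<phi> (vadd S s t)) = z (\<phi> s) + z (\<phi> t)"
      by (rule Kch_form_eq[OF Kch_eval vform_plus[OF Kch_eval Kch_eval] z])
         (use s t S vform_add[OF assms(4)] in \<open>simp add: p\<close>)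
  next
    fix a s assume s: "s \<in> vcar S"
    show "z (\<phi> (vscale S a s)) = a * z (\<phi> s)"
      by (rule Kch_form_eq[OF Kch_eval vform_scaled[OF Kch_eval] z])
         (use s S vform_scale[OF assms(4)] in \<open>simp add: p\<close>)
  qed
qed

lemma Klift_form:
  assumes Y: "vsp Y" "sepset Y L"
    and b: "\<And>a w. a \<in> A.alg n \<Longrightarrow> w \<in> A.W q \<Longrightarrow> \<beta> a w \<in> vcar Y"
    and L: "\<And>l. l \<in> L \<Longrightarrow> (\<lambda>a w. l (\<beta> a w)) \<in> kforms n q"
  shows "Klift V R q n Y \<beta> \<in> vcar (vhom (K q n) Y)"
    and "\<And>l z. l \<in> L \<Longrightarrow> z \<in> Kc q n \<Longrightarrow> l (Klift V R q n Y \<beta> z) = z (\<lambda>a w. l (\<beta> a w))"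
proof -
  have *: "(\<lambda>a w. l (\<beta> a w)) \<in> kforms n q" if "vlinear Y vfield l" for l
    by (rule bforms_sepI[OF A.vsp_qalg A.vsp_qW Y _ _ that]) (use b L in auto)
  have p: "kpure q n a w (\<lambda>a w. l (\<beta> a w)) = l (\<beta> a w)" if "vlinear Y vfield l" for l a w
    by (rule Kpure_apply[OF *[OF that]])
  note B = blift_form[where L = "\<lambda>l z. z (\<lambda>a w. l (\<beta> a w))", OF Y(1) Kch_span b Kch_eval p]
  show "Klift V R q n Y \<beta> \<in> vcar (vhom (K q n) Y)"
    unfolding Klift_def by (rule B(1))
  show "l (Klift V R q n Y \<beta> z) = z (\<lambda>a w. l (\<beta> a w))" if "l \<in> L" "z \<in> Kc q n" for l z
    unfolding Klift_def by (rule B(3)) (use sepset_linear[OF Y(2) that(1)] that(2) in auto)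
qed

text \<open>An operation on chains becomes a substitution of bilinear forms,
  \<open>fm \<omega> b\<close> going to \<open>\<gamma> \<omega> b\<close>. Agreement with the
  values of \<open>\<beta>\<close> is asked on the carriers only; pure tensors then carry it over to
  all chains.\<close>

lemma Klift_Kch:
  assumes b: "\<And>a w. a \<in> A.alg n \<Longrightarrow> w \<in> A.W q \<Longrightarrow> \<beta> a w \<in> Kc k N"
    and ev: "\<And>a w \<omega> b. a \<in> A.alg n \<Longrightarrow> w \<in> A.W q \<Longrightarrow> \<omega> \<in> B.W N \<Longrightarrow> b \<in> B.alg k \<Longrightarrow>
      \<beta> a w (fm \<omega> b) = \<gamma> \<omega> b a w"
    and bf: "\<And>\<omega> b. \<omega> \<in> B.W N \<Longrightarrow> b \<in> B.alg k \<Longrightarrow> \<gamma> \<omega> b \<in> kforms n q"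
  shows "Klift V R q n (K k N) \<beta> \<in> vcar (vhom (K q n) (K k N))"
    and "\<And>z \<omega> b. z \<in> Kc q n \<Longrightarrow> \<omega> \<in> B.W N \<Longrightarrow> b \<in> B.alg k \<Longrightarrow>
      Klift V R q n (K k N) \<beta> z (fm \<omega> b) = z (\<gamma> \<omega> b)"
proof -
  have bf': "(\<lambda>a w. \<beta> a w (fm \<omega> b)) \<in> kforms n q"
    if "\<omega> \<in> B.W N" "b \<in> B.alg k" for \<omega> b
  proof (rule bformsI)
    fix a assume a: "a \<in> A.alg n"
    show "A.wform q (\<lambda>w. \<beta> a w (fm \<omega> b))"
      by (rule vform_cong[OF bforms_right[OF bf[OF that] a]])
         (use a that in \<open>simp_all only: ev vsp_add[OF A.vsp_qW] vsp_scale[OF A.vsp_qW]\<close>)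
  next
    fix w assume w: "w \<in> A.W q"
    show "A.aform n (\<lambda>a. \<beta> a w (fm \<omega> b))"
      by (rule vform_cong[OF bforms_left[OF bf[OF that] w]])
         (use w that in \<open>simp_all only: ev vsp_add[OF A.vsp_qalg] vsp_scale[OF A.vsp_qalg]\<close>)
  qed
  have L: "(\<lambda>a w. l (\<beta> a w)) \<in> kforms n q"
    if "l \<in> {\<lambda>z. z (fm \<omega> b) | \<omega> b. \<omega> \<in> B.W N \<and> b \<in> B.alg k}" for l
    using that bf' by auto
  note K = Klift_form[where \<beta> = \<beta>, OF vsp_Kch sepset_Kch b L]
  show "Klift V R q n (K k N) \<beta> \<in> vcar (vhom (K q n) (K k N))" by (rule K(1))
  show "Klift V R q n (K k N) \<beta> z (fm \<omega> b) = z (\<gamma> \<omega> b)"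
    if z: "z \<in> Kc q n" and w: "\<omega> \<in> B.W N" and b': "b \<in> B.alg k" for z \<omega> b
  proof -
    have "Klift V R q n (K k N) \<beta> z (fm \<omega> b) = z (\<lambda>a w. \<beta> a w (fm \<omega> b))"
      using K(2)[of "\<lambda>z. z (fm \<omega> b)" z] z w b' by blast
    also have "\<dots> = z (\<gamma> \<omega> b)"
      by (rule Kch_form_eq[OF Kch_eval Kch_eval z])
         (use w b' in \<open>simp add: Kpure_apply[OF bf'] Kpure_apply[OF bf] ev\<close>)
    finally show ?thesis .
  qed
qed

text \<open>Common frame for \<open>a\<close> times \<open>F u\<close> and \<open>F u\<close> times
  \<open>a\<close>, so that the terms of the differential and both cap actions are instances of
  \<open>tens_left\<close> and \<open>tens_right\<close>.\<close>

definition bim :: "nat \<Rightarrow> nat \<Rightarrow> nat \<Rightarrow> (('k, 'a) tensor set \<Rightarrow> ('k, 'a) tensor \<Rightarrow> ('k, 'a) tensor set) \<Rightarrow> bool" where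
  "bim n i N \<alpha> \<longleftrightarrow> (\<forall>a\<in>A.alg n. \<forall>u\<in>A.W i. \<alpha> a u \<in> A.alg N) \<and>
    (\<forall>l. A.aform N l \<longrightarrow> (\<lambda>a u. l (\<alpha> a u)) \<in> kforms n i)"

lemma bim_in: "bim n i N \<alpha> \<Longrightarrow> a \<in> A.alg n \<Longrightarrow> u \<in> A.W i \<Longrightarrow> \<alpha> a u \<in> A.alg N"
  and bim_bforms: "bim n i N \<alpha> \<Longrightarrow> A.aform N l \<Longrightarrow> (\<lambda>a u. l (\<alpha> a u)) \<in> kforms n i"
  by (simp_all add: bim_def)

lemma bim_qmul:
  assumes F: "A.linq i m F"
  shows "bim n i (n + m) (\<lambda>a u. A.mul n m a (F u))" and "bim n i (m + n) (\<lambda>a u. A.mul m n (F u) a)"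
  unfolding bim_def
  by (intro conjI ballI allI impI bformsI A.qmul_in A.linq_in[OF F] A.linq_form[OF F] A.qmul_vform_left A.qmul_vform_right;
      assumption)+

lemma tens_left:
  assumes al: "bim n i N \<alpha>" and a: "a \<in> A.alg n" and w: "w \<in> A.W (i + k)"
  defines "y \<equiv> A.wsplit i k (K k N) (\<lambda>u v. kpure k N (\<alpha> a u) v) w"
  shows "y \<in> Kc k N"
    and "\<omega> \<in> B.W N \<Longrightarrow> b \<in> B.alg k \<Longrightarrow> y (fm \<omega> b) = A.Lam i k (\<lambda>u v. evA \<omega> (\<alpha> a u) * evB b v) w"
proof -
  have "A.binto (K k N) i k (\<lambda>u v. kpure k N (\<alpha> a u) v)"
  proof (rule A.binto_sepI[OF vsp_Kch sepset_Kch])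
    fix l :: "('k, 'a) kchain \<Rightarrow> 'k"
    assume "l \<in> {\<lambda>z. z (fm \<omega> b) | \<omega> b. \<omega> \<in> B.W N \<and> b \<in> B.alg k}"
    then obtain \<omega> b where *: "\<omega> \<in> B.W N" "b \<in> B.alg k" "l = (\<lambda>z. z (fm \<omega> b))" by auto
    then show "(\<lambda>u v. l (kpure k N (\<alpha> a u) v)) \<in> A.wforms i k"
      using bforms_right[OF bim_bforms[OF al evA_linear] a]
      by (intro bformsI) (simp_all add: Kpure_fm vform_scaled vform_scaled' evB_linear_right)
  qed (intro Kpure_in bim_in[OF al a])
  note * = A.tsplit_form[OF vsp_Kch this w]
  show "y \<in> Kc k N" unfolding y_def by (rule *(1))
  show "y (fm \<omega> b) = A.Lam i k (\<lambda>u v. evA \<omega> (\<alpha> a u) * evB b v) w"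
    if "\<omega> \<in> B.W N" "b \<in> B.alg k"
    unfolding y_def *(2)[OF Kch_eval] using that by (simp add: Kpure_fm)
qed

lemma tens_right:
  assumes al: "bim n i N \<alpha>" and a: "a \<in> A.alg n" and w: "w \<in> A.W (k + i)"
  defines "y \<equiv> A.wsplit k i (K k N) (\<lambda>u v. kpure k N (\<alpha> a v) u) w"
  shows "y \<in> Kc k N"
    and "\<omega> \<in> B.W N \<Longrightarrow> b \<in> B.alg k \<Longrightarrow> y (fm \<omega> b) = A.Lam k i (\<lambda>u v. evA \<omega> (\<alpha> a v) * evB b u) w"
proof -
  have "A.binto (K k N) k i (\<lambda>u v. kpure k N (\<alpha> a v) u)"
  proof (rule A.binto_sepI[OF vsp_Kch sepset_Kch])
    fix l :: "('k, 'a) kchain \<Rightarrow> 'k"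
    assume "l \<in> {\<lambda>z. z (fm \<omega> b) | \<omega> b. \<omega> \<in> B.W N \<and> b \<in> B.alg k}"
    then obtain \<omega> b where *: "\<omega> \<in> B.W N" "b \<in> B.alg k" "l = (\<lambda>z. z (fm \<omega> b))" by auto
    then show "(\<lambda>u v. l (kpure k N (\<alpha> a v) u)) \<in> A.wforms k i"
      using bforms_right[OF bim_bforms[OF al evA_linear] a]
      by (intro bformsI) (simp_all add: Kpure_fm vform_scaled vform_scaled' evB_linear_right)
  qed (intro Kpure_in bim_in[OF al a])
  note * = A.tsplit_form[OF vsp_Kch this w]
  show "y \<in> Kc k N" unfolding y_def by (rule *(1))
  show "y (fm \<omega> b) = A.Lam k i (\<lambda>u v. evA \<omega> (\<alpha> a v) * evB b u) w"
    if "\<omega> \<in> B.W N" "b \<in> B.alg k"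
    unfolding y_def *(2)[OF Kch_eval] using that by (simp add: Kpure_fm)
qed

lemma bforms_tens:
  assumes al: "bim n i N \<alpha>" and w: "\<omega> \<in> B.W N" and b: "b \<in> B.alg k"
  shows "(\<lambda>a w. A.Lam i k (\<lambda>u v. evA \<omega> (\<alpha> a u) * evB b v) w) \<in> kforms n (i + k)"
    and "(\<lambda>a w. A.Lam k i (\<lambda>u v. evA \<omega> (\<alpha> a v) * evB b u) w) \<in> kforms n (k + i)"
proof -
  note bf = bim_bforms[OF al evA_linear[OF w]]
  note r = bforms_right[OF bf] and l = bforms_left[OF bf] and e = evB_linear_right[OF b]
  show "(\<lambda>a w. A.Lam i k (\<lambda>u v. evA \<omega> (\<alpha> a u) * evB b v) w) \<in> kforms n (i + k)"
    by (intro bformsI A.Lam_vlinear(2) A.Lam_param vform_scaled vform_scaled' r l e)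
  show "(\<lambda>a w. A.Lam k i (\<lambda>u v. evA \<omega> (\<alpha> a v) * evB b u) w) \<in> kforms n (k + i)"
    by (intro bformsI A.Lam_vlinear(2) A.Lam_param vform_scaled vform_scaled' r l e)
qed

lemma bKh_Suc:
  shows "dK (Suc q) n \<in> vcar (vhom (K (Suc q) n) (K q (n + 1)))"
    and "z \<in> Kc (Suc q) n \<Longrightarrow> \<omega> \<in> B.W (n + 1) \<Longrightarrow> b \<in> B.alg q \<Longrightarrow>
      dK (Suc q) n z (fm \<omega> b) = z (\<lambda>a w. A.Lam 1 q (\<lambda>x u. evA \<omega> (A.mul n 1 a (A.gen x)) * evB b u) w
        + (-1) ^ Suc q * A.Lam q 1 (\<lambda>u x. evA \<omega> (A.mul 1 n (A.gen x) a) * evB b u) w)"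
    and "\<omega> \<in> B.W (n + 1) \<Longrightarrow> b \<in> B.alg q \<Longrightarrow>
      (\<lambda>a w. A.Lam 1 q (\<lambda>x u. evA \<omega> (A.mul n 1 a (A.gen x)) * evB b u) w
        + (-1) ^ Suc q * A.Lam q 1 (\<lambda>u x. evA \<omega> (A.mul 1 n (A.gen x) a) * evB b u) w)
      \<in> kforms n (Suc q)"
proof -
  note m1 = bim_qmul(1)[OF A.linq_qgen, of n] and m2 = bim_qmul(2)[OF A.linq_qgen, of n, unfolded add.commute[of 1 n]]
  let ?Y = "K q (n + 1)"
  define \<beta> where "\<beta> = (\<lambda>a w. vadd ?Y
        (A.wsplit 1 q ?Y (\<lambda>x u. kpure q (n + 1) (A.mul n 1 a (A.gen x)) u) w)
        (vscale ?Y ((-1) ^ Suc q)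
          (A.wsplit q 1 ?Y (\<lambda>u x. kpure q (n + 1) (A.mul 1 n (A.gen x) a) u) w)))"
  have b: "dK (Suc q) n = Klift V R (Suc q) n ?Y \<beta>"
    by (simp add: fun_eq_iff bKh_def \<beta>_def Let_def)
  have c: "Suc q = 1 + q" "Suc q = q + 1" by simp_all
  have in1: "\<beta> a w \<in> vcar ?Y" if "a \<in> A.alg n" "w \<in> A.W (Suc q)" for a w
    unfolding \<beta>_def using that(2) tens_left(1)[OF m1 that(1), of w q] tens_right(1)[OF m2 that(1), of w q]
    by (intro vsp_add[OF vsp_Kch] vsp_scale[OF vsp_Kch]) (simp_all add: c[symmetric])
  have ev: "\<beta> a w (fm \<omega> b) = A.Lam 1 q (\<lambda>x u. evA \<omega> (A.mul n 1 a (A.gen x)) * evB b u) w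
        + (-1) ^ Suc q * A.Lam q 1 (\<lambda>u x. evA \<omega> (A.mul 1 n (A.gen x) a) * evB b u) w"
    if "a \<in> A.alg n" "w \<in> A.W (Suc q)" "\<omega> \<in> B.W (n + 1)" "b \<in> B.alg q" for a w \<omega> b
    unfolding \<beta>_def
    using that tens_left(2)[OF m1 that(1), of w q \<omega> b] tens_right(2)[OF m2 that(1), of w q \<omega> b]
    by (simp add: fscale_def)
  have bf: "(\<lambda>a w. A.Lam 1 q (\<lambda>x u. evA \<omega> (A.mul n 1 a (A.gen x)) * evB b u) w
        + (-1) ^ Suc q * A.Lam q 1 (\<lambda>u x. evA \<omega> (A.mul 1 n (A.gen x) a) * evB b u) w)
      \<in> kforms n (Suc q)"
    if "\<omega> \<in> B.W (n + 1)" "b \<in> B.alg q" for \<omega> b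
    using bforms_tens(1)[OF m1 that] bforms_tens(2)[OF m2 that]
    by (intro bforms_plus bforms_scaled) (simp_all add: c[symmetric])
  note K = Klift_Kch[where \<beta> = \<beta>, OF in1 ev bf]
  show "dK (Suc q) n \<in> vcar (vhom (K (Suc q) n) (K q (n + 1)))"
    unfolding b by (rule K(1))
  show "z \<in> Kc (Suc q) n \<Longrightarrow> \<omega> \<in> B.W (n + 1) \<Longrightarrow> b \<in> B.alg q \<Longrightarrow>
      dK (Suc q) n z (fm \<omega> b) = z (\<lambda>a w. A.Lam 1 q (\<lambda>x u. evA \<omega> (A.mul n 1 a (A.gen x)) * evB b u) w
        + (-1) ^ Suc q * A.Lam q 1 (\<lambda>u x. evA \<omega> (A.mul 1 n (A.gen x) a) * evB b u) w)"
    unfolding b by (rule K(2))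
  show "\<omega> \<in> B.W (n + 1) \<Longrightarrow> b \<in> B.alg q \<Longrightarrow>
      (\<lambda>a w. A.Lam 1 q (\<lambda>x u. evA \<omega> (A.mul n 1 a (A.gen x)) * evB b u) w
        + (-1) ^ Suc q * A.Lam q 1 (\<lambda>u x. evA \<omega> (A.mul 1 n (A.gen x) a) * evB b u) w)
      \<in> kforms n (Suc q)"
    by (rule bf)
qed

text \<open>Writing the chain weight as \<open>k + p\<close> avoids truncated subtraction. The last
  part is recorded separately because \<open>Kpure_apply\<close> evaluates a pure chain only at a
  form known to be bilinear.\<close>

lemma capl_form:
  assumes f: "A.linq p m f"
  shows "capl V R p m (k + p) n f \<in> vcar (vhom (K (k + p) n) (K k (m + n)))"
    and "z \<in> Kc (k + p) n \<Longrightarrow> \<omega> \<in> B.W (m + n) \<Longrightarrow> b \<in> B.alg k \<Longrightarrow>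
      capl V R p m (k + p) n f z (fm \<omega> b)
        = z (\<lambda>a w. (-1) ^ (k * p) * A.Lam k p (\<lambda>u v. evA \<omega> (A.mul m n (f v) a) * evB b u) w)"
    and "\<omega> \<in> B.W (m + n) \<Longrightarrow> b \<in> B.alg k \<Longrightarrow>
      (\<lambda>a w. (-1) ^ (k * p) * A.Lam k p (\<lambda>u v. evA \<omega> (A.mul m n (f v) a) * evB b u) w)
      \<in> kforms n (k + p)"
proof -
  note m = bim_qmul(2)[OF f, of n]
  let ?Y = "K k (m + n)"
  define \<beta> where "\<beta> = (\<lambda>a w. vscale ?Y ((-1) ^ (k * p))
       (A.wsplit k p ?Y (\<lambda>u v. kpure k (m + n) (A.mul m n (f v) a) u) w))"
  have b: "capl V R p m (k + p) n f = Klift V R (k + p) n ?Y \<beta>"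
    by (simp add: fun_eq_iff capl_def \<beta>_def Let_def)
  have in1: "\<beta> a w \<in> vcar ?Y" if "a \<in> A.alg n" "w \<in> A.W (k + p)" for a w
    unfolding \<beta>_def by (rule vsp_scale[OF vsp_Kch tens_right(1)[OF m that]])
  have ev: "\<beta> a w (fm \<omega> b) = (-1) ^ (k * p) * A.Lam k p (\<lambda>u v. evA \<omega> (A.mul m n (f v) a) * evB b u) w"
    if "a \<in> A.alg n" "w \<in> A.W (k + p)" "\<omega> \<in> B.W (m + n)" "b \<in> B.alg k" for a w \<omega> b
    unfolding \<beta>_def using tens_right(2)[OF m that] by (simp add: fscale_def)
  note bf = bforms_scaled[OF bforms_tens(2)[OF m]]
  note K = Klift_Kch[where \<beta> = \<beta>, OF in1 ev bf]
  show "capl V R p m (k + p) n f \<in> vcar (vhom (K (k + p) n) (K k (m + n)))"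
    unfolding b by (rule K(1))
  show "z \<in> Kc (k + p) n \<Longrightarrow> \<omega> \<in> B.W (m + n) \<Longrightarrow> b \<in> B.alg k \<Longrightarrow>
      capl V R p m (k + p) n f z (fm \<omega> b)
        = z (\<lambda>a w. (-1) ^ (k * p) * A.Lam k p (\<lambda>u v. evA \<omega> (A.mul m n (f v) a) * evB b u) w)"
    unfolding b by (rule K(2))
qed (rule bforms_scaled[OF bforms_tens(2)[OF bim_qmul(2)[OF f]]])

lemma capr_form:
  assumes f: "A.linq p m f"
  shows "z \<in> Kc (p + k) n \<Longrightarrow> capr V R p m (p + k) n z f \<in> Kc k (m + n)"
    and "z \<in> Kc (p + k) n \<Longrightarrow> \<omega> \<in> B.W (n + m) \<Longrightarrow> b \<in> B.alg k \<Longrightarrow>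
      capr V R p m (p + k) n z f (fm \<omega> b)
        = z (\<lambda>a w. (-1) ^ (p * (p + k)) * A.Lam p k (\<lambda>u v. evA \<omega> (A.mul n m a (f u)) * evB b v) w)"
    and "\<omega> \<in> B.W (n + m) \<Longrightarrow> b \<in> B.alg k \<Longrightarrow>
      (\<lambda>a w. (-1) ^ (p * (p + k)) * A.Lam p k (\<lambda>u v. evA \<omega> (A.mul n m a (f u)) * evB b v) w)
      \<in> kforms n (p + k)"
proof -
  note m = bim_qmul(1)[OF f, of n]
  let ?Y = "K k (n + m)"
  define \<beta> where "\<beta> = (\<lambda>a w. vscale ?Y ((-1) ^ (p * (p + k)))
       (A.wsplit p k ?Y (\<lambda>u v. kpure k (n + m) (A.mul n m a (f u)) v) w))"
  have b: "capr V R p m (p + k) n z f = Klift V R (p + k) n ?Y \<beta> z" for z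
    by (simp add: fun_eq_iff capr_def \<beta>_def Let_def add.commute[of m n])
  have in1: "\<beta> a w \<in> vcar ?Y" if "a \<in> A.alg n" "w \<in> A.W (p + k)" for a w
    unfolding \<beta>_def by (rule vsp_scale[OF vsp_Kch tens_left(1)[OF m that]])
  have ev: "\<beta> a w (fm \<omega> b) = (-1) ^ (p * (p + k)) * A.Lam p k (\<lambda>u v. evA \<omega> (A.mul n m a (f u)) * evB b v) w"
    if "a \<in> A.alg n" "w \<in> A.W (p + k)" "\<omega> \<in> B.W (n + m)" "b \<in> B.alg k" for a w \<omega> b
    unfolding \<beta>_def using tens_left(2)[OF m that] by (simp add: fscale_def)
  note bf = bforms_scaled[OF bforms_tens(1)[OF m]]
  note K = Klift_Kch[where \<beta> = \<beta>, OF in1 ev bf]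
  show "z \<in> Kc (p + k) n \<Longrightarrow> capr V R p m (p + k) n z f \<in> Kc k (m + n)"
    unfolding b add.commute[of m n] by (rule vhom_in[OF K(1)])
  show "z \<in> Kc (p + k) n \<Longrightarrow> \<omega> \<in> B.W (n + m) \<Longrightarrow> b \<in> B.alg k \<Longrightarrow>
      capr V R p m (p + k) n z f (fm \<omega> b)
        = z (\<lambda>a w. (-1) ^ (p * (p + k)) * A.Lam p k (\<lambda>u v. evA \<omega> (A.mul n m a (f u)) * evB b v) w)"
    unfolding b by (rule K(2))
qed (rule bforms_scaled[OF bforms_tens(1)[OF bim_qmul(1)[OF f]]])

end

section \<open>Well-definedness of the cup actions on cohomology classes\<close>

lemma vsubsp_preimage:
  assumes U: "vsp U" and W: "vsp W" and t: "t \<in> vcar (vhom U W)" and Z: "vsubsp W Z"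
  shows "vsubsp U {x \<in> vcar U. t x \<in> Z}"
  unfolding vsubsp_def
  using assms vhom_zero[OF U W t] by (auto simp: vsubsp_def vhom_add[OF t] vhom_scale[OF t])

lemma UN_const2: "(\<And>x y. x \<in> X \<Longrightarrow> y \<in> Y \<Longrightarrow> f x y = C) \<Longrightarrow> X \<noteq> {} \<Longrightarrow> Y \<noteq> {} \<Longrightarrow> (\<Union>x\<in>X. \<Union>y\<in>Y. f x y) = C"
  by auto

context quad
begin

lemma Mcobd_N_in: "F \<in> BN p m \<Longrightarrow> F \<in> vcar (NC p m)"
  unfolding Mcobd_N using vsp_zero[OF vsp_NC] bK_form(2)[OF linq_vhom] by blast

text \<open>The product is expanded as \<open>F0 g0\<close>, \<open>F0 g1\<close> and
  \<open>F1 (g0 + g1)\<close>. The last two are coboundaries since \<open>F0\<close> and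
  \<open>g0 + g1\<close> are cocycles.\<close>

lemma mcup_class:
  assumes F0: "F0 \<in> ZN p m" and F1: "F1 \<in> BN p m"
    and g0: "g0 \<in> ZM q n" and g1: "g1 \<in> BM q n"
  shows "vclass (MC (p + q) (n - m)) (BM (p + q) (n - m))
      (cupl p m q n (vadd (NC p m) F0 F1) (vadd (MC q n) g0 g1))
    = vclass (MC (p + q) (n - m)) (BM (p + q) (n - m)) (cupl p m q n F0 g0)"
    and "vclass (MC (q + p) (n - m)) (BM (q + p) (n - m))
      (cupr p m q n (vadd (MC q n) g0 g1) (vadd (NC p m) F0 F1))
    = vclass (MC (q + p) (n - m)) (BM (q + p) (n - m)) (cupr p m q n g0 F0)"
proof -
  have F: "F0 \<in> vcar (NC p m)" "F1 \<in> vcar (NC p m)"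
    using F0 F1 Mcobd_N_in by (simp_all add: Mcocyc_N)
  have g: "g0 \<in> vcar (MC q n)" "g1 \<in> vcar (MC q n)" "g1 \<in> ZM q n"
    using g0 g1 Mcobd_Mcocyc vsubsp_Mcobd[of q n] by (auto simp: Mcocyc_M vsubsp_def)
  have g2: "vadd (MC q n) g0 g1 \<in> ZM q n" "vadd (MC q n) g0 g1 \<in> vcar (MC q n)"
    using vsubsp_Mcocyc[of q n] g0 g by (auto simp: vsubsp_def)
  have step: "vclass U K (vadd U (vadd U x y) z) = vclass U K x"
    if "vsp U" "vsubsp U K" "x \<in> vcar U" "y \<in> K" "z \<in> K" for U :: "('k, ('k, 'a) tensor \<Rightarrow> ('k, 'a) tensor set \<Rightarrow> 'k) vspace" and K x y z
    using that vclass_add[OF that(1,2), of "vadd U x y" z] vclass_add[OF that(1-4)]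
    by (auto simp: vsubsp_def)
  let ?l = "cupl p m q n" and ?r = "cupr p m q n"
  have "?l (vadd (NC p m) F0 F1) (vadd (MC q n) g0 g1)
    = vadd (MC (p + q) (n - m)) (vadd (MC (p + q) (n - m)) (?l F0 g0) (?l F0 g1)) (?l F1 (vadd (MC q n) g0 g1))"
    using mcup_vlinear_N(1)[OF g2(2), of p m] mcup_vlinear_M(1)[OF F(1), of q n] F g
    unfolding vlinear_def by (simp del: vhom_simps)
  then show "vclass (MC (p + q) (n - m)) (BM (p + q) (n - m))
      (cupl p m q n (vadd (NC p m) F0 F1) (vadd (MC q n) g0 g1))
    = vclass (MC (p + q) (n - m)) (BM (p + q) (n - m)) (cupl p m q n F0 g0)"
    using step[OF vsp_MC vsubsp_Mcobd mcup_in(1)[OF F(1) g(1)] mcup_cobd_M(1)[OF F0 g1] mcup_cobd_N(1)[OF F1 g2(1)]]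
    by (simp del: vhom_simps)
  have "?r (vadd (MC q n) g0 g1) (vadd (NC p m) F0 F1)
    = vadd (MC (q + p) (n - m)) (vadd (MC (q + p) (n - m)) (?r g0 F0) (?r g1 F0)) (?r (vadd (MC q n) g0 g1) F1)"
    using mcup_vlinear_N(2)[OF g2(2), of p m] mcup_vlinear_M(2)[OF F(1), of q n] F g
    unfolding vlinear_def by (simp del: vhom_simps)
  then show "vclass (MC (q + p) (n - m)) (BM (q + p) (n - m))
      (cupr p m q n (vadd (MC q n) g0 g1) (vadd (NC p m) F0 F1))
    = vclass (MC (q + p) (n - m)) (BM (q + p) (n - m)) (cupr p m q n g0 F0)"
    using step[OF vsp_MC vsubsp_Mcobd mcup_in(2)[OF F(1) g(1)] mcup_cobd_M(2)[OF F0 g1] mcup_cobd_N(2)[OF F1 g2(1)]]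
    by (simp del: vhom_simps)
qed

end

section \<open>The comparison map \<open>theta\<close> and its compatibility with the
  differentials\<close>

context qdual
begin

definition theta where
  "theta q n = (\<lambda>z\<in>Kc q n. \<lambda>\<omega>\<in>B.W n. \<lambda>b\<in>B.alg q. z (fm \<omega> b))"

lemma theta_apply: "z \<in> Kc q n \<Longrightarrow> \<omega> \<in> B.W n \<Longrightarrow> b \<in> B.alg q \<Longrightarrow> theta q n z \<omega> b = z (fm \<omega> b)"
  by (simp add: theta_def)

lemma theta_in:
  assumes z: "z \<in> Kc q n"
  shows "theta q n z \<in> vcar (B.MC n q)"
proof (rule B.MC_I)
  fix \<omega> assume w: "\<omega> \<in> B.W n"
  have "B.aform q (\<lambda>b. z (fm \<omega> b))"
    by (rule Kch_param[OF z B.vsp_qalg]) (use w fm_bforms in \<open>auto simp: fm_def intro: vform_scaled evB_linear\<close>)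
  then have "B.aform q (theta q n z \<omega>)"
    by (rule vform_cong) (simp_all only: theta_apply[OF z w] vsp_add[OF B.vsp_qalg] vsp_scale[OF B.vsp_qalg])
  then show "theta q n z \<omega> \<in> vcar (B.dual q)"
    using z w by (simp add: vcar_vdual theta_def)
next
  fix b assume b: "b \<in> B.alg q"
  have "B.wform n (\<lambda>\<omega>. z (fm \<omega> b))"
    by (rule Kch_param[OF z B.vsp_qW]) (use b fm_bforms in \<open>auto simp: fm_def intro: vform_scaled' evA_linear_left\<close>)
  then show "B.wform n (\<lambda>\<omega>. theta q n z \<omega> b)"
    by (rule vform_cong) (simp_all only: theta_apply[OF z _ b] vsp_add[OF B.vsp_qW] vsp_scale[OF B.vsp_qW])
qed (use z in \<open>simp add: theta_def\<close>)

lemma theta_hom: "theta q n \<in> vcar (vhom (K q n) (B.MC n q))"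
proof (rule vhomI[OF theta_in])
  show "vlinear (K q n) (B.MC n q) (theta q n)"
  proof (rule B.MC_vlinearI[OF vsp_Kch theta_in])
    fix \<omega> b assume "\<omega> \<in> B.W n" "b \<in> B.alg q"
    then show "vlinear (K q n) vfield (\<lambda>z. theta q n z \<omega> b)"
      by (intro vform_cong[OF Kch_eval[of q n "fm \<omega> b"]])
         (simp_all only: theta_apply vsp_add[OF vsp_Kch] vsp_scale[OF vsp_Kch])
  qed
qed (simp_all add: theta_def)

lemma theta_inj: "inj_on (theta q n) (Kc q n)"
proof (rule inj_onI)
  fix z z' assume z: "z \<in> Kc q n" "z' \<in> Kc q n" and eq: "theta q n z = theta q n z'"
  show "z = z'"
    by (rule sepset_eqI[OF sepset_Kch z]) (use eq theta_apply z in \<open>auto, metis\<close>)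
qed

lemma evA_eI: "I \<in> A.wd n \<Longrightarrow> \<omega> \<in> B.W n \<Longrightarrow> evA \<omega> (A.cl n (A.eI I)) = B.cf \<omega> I"
  by (simp add: evA_cl tpair_cf[where m = n] B.W_T A.cf_eI if_distrib[of "(*) _"] cong: if_cong)

text \<open>The preimage of \<open>g\<close> is the sum of the pure tensors \<open>A.eI J\<close>
  (x) \<open>w J\<close>, where \<open>w J\<close> represents the functional
  \<open>g (B.Pj n (B.eI J))\<close> on A^! by \<open>formB\<close>. Since \<open>\<omega>\<close>
  pairs with \<open>A.eI J\<close> to its coefficient, the sum reassembles
  \<open>g \<omega>\<close>.\<close>

lemma theta_surj: "theta q n ` Kc q n = vcar (B.MC n q)"
proof (intro equalityI subsetI)
  fix g assume g: "g \<in> vcar (B.MC n q)"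
  have "\<exists>w. w \<in> A.W q \<and> (\<forall>b\<in>B.alg q. g (B.Pj n (B.eI J)) b = evB b w)" for J
    using formB[OF B.MC_form[OF g B.Pj(2)]] by metis
  then obtain w where w: "\<And>J. w J \<in> A.W q"
    "\<And>J b. b \<in> B.alg q \<Longrightarrow> g (B.Pj n (B.eI J)) b = evB b (w J)" by metis
  let ?K = "\<lambda>J. kpure q n (A.cl n (A.eI J)) (w J)"
  define z where "z = (\<Sum>J\<in>A.wd n. fscale 1 (?K J))"
  have K: "?K J \<in> Kc q n" if "J \<in> A.wd n" for J
    using that w by (intro Kpure_in A.cl_in A.eI_in)
  have S: "fv.subspace (Kc q n)" "fsub (Kc q n) = K q n"
    by (simp_all add: Kch_span)
  have z: "z \<in> Kc q n"
    unfolding z_def by (intro fv.subspace_sum fv.subspace_scale S K)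
  have "theta q n z = g"
  proof (rule B.MC_eqI[OF theta_in[OF z] g])
    fix \<omega> b assume o: "\<omega> \<in> B.W n" and b: "b \<in> B.alg q"
    have "theta q n z \<omega> b = (\<Sum>J\<in>A.wd n. 1 * ?K J (fm \<omega> b))"
      unfolding theta_apply[OF z o b] unfolding z_def
      using vform_fsub_sum[OF S(1), of "\<lambda>z. z (fm \<omega> b)" "A.wd n" ?K "\<lambda>_. 1"] Kch_eval[of q n "fm \<omega> b"] K S(2) by simp
    also have "\<dots> = (\<Sum>J\<in>A.wd n. B.cf \<omega> J * g (B.Pj n (B.eI J)) b)"
      using o b by (intro sum.cong refl) (simp add: Kpure_fm evA_eI w)
    also have "\<dots> = g (\<Sum>J\<in>A.wd n. fscale (B.cf \<omega> J) (B.Pj n (B.eI J))) b"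
      using B.MC_form'[OF g b] by (intro vform_fsub_sum[OF B.subspace_W[of n], symmetric]) (simp_all add: B.Pj)
    also have "\<dots> = g \<omega> b" by (simp flip: B.Pj_sum[OF o])
    finally show "theta q n z \<omega> b = g \<omega> b" .
  qed
  with z show "g \<in> theta q n ` Kc q n" by blast
qed (auto intro: theta_in)

text \<open>Stated for arbitrary maps, so that the pair of generator maps (for the differentials)
  and a cochain with its transpose (for the cap actions) are handled by the same
  computation.\<close>

definition transp where
  "transp p m F \<Phi> \<longleftrightarrow> A.linq p m F \<and> B.linq m p \<Phi> \<and>
    (\<forall>\<omega>\<in>B.W m. \<forall>u\<in>A.W p. evB (\<Phi> \<omega>) u = evA \<omega> (F u))"

lemma transpD:
  assumes "transp p m F \<Phi>"
  shows "u \<in> A.W p \<Longrightarrow> F u \<in> A.alg m" and "\<omega> \<in> B.W m \<Longrightarrow> \<Phi> \<omega> \<in> B.alg p"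
    and "\<omega> \<in> B.W m \<Longrightarrow> u \<in> A.W p \<Longrightarrow> evB (\<Phi> \<omega>) u = evA \<omega> (F u)"
  using assms by (auto simp: transp_def dest: A.linq_in B.linq_in)

lemma transp_gen: "transp 1 1 A.gen B.gen"
  unfolding transp_def using A.linq_qgen B.linq_qgen ev_qgen by blast

text \<open>The product in A splits \<open>\<omega>\<close>, transposition moves both factors to
  A^!, the two sums are exchanged, and the splitting of \<open>w\<close> is read as the product in
  A^!.\<close>

lemma transp_mul:
  assumes F: "transp p m F \<Phi>" and G: "transp p' m' G \<Gamma>" and o: "\<omega> \<in> B.W (m + m')" and w: "w \<in> A.W (p + p')"
  shows "A.Lam p p' (\<lambda>u v. evA \<omega> (A.mul m m' (F u) (G v))) w = B.Lam m m' (\<lambda>s t. evB (B.mul p p' (\<Phi> s) (\<Gamma> t)) w) \<omega>"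
proof -
  have "A.Lam p p' (\<lambda>u v. evA \<omega> (A.mul m m' (F u) (G v))) w
    = B.Lam m m' (\<lambda>s t. A.Lam p p' (\<lambda>u v. evA s (F u) * evA t (G v)) w) \<omega>"
    unfolding Lam_swap[symmetric] by (rule A.Lam_cong[OF w]) (simp only: evA_mul[OF o] transpD[OF F] transpD[OF G])
  also have "\<dots> = B.Lam m m' (\<lambda>s t. evB (B.mul p p' (\<Phi> s) (\<Gamma> t)) w) \<omega>"
  proof (rule B.Lam_cong[OF o])
    fix s t assume s: "s \<in> B.W m" and t: "t \<in> B.W m'"
    show "A.Lam p p' (\<lambda>u v. evA s (F u) * evA t (G v)) w = evB (B.mul p p' (\<Phi> s) (\<Gamma> t)) w"
      unfolding evB_mul[OF w transpD(2)[OF F s] transpD(2)[OF G t]]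
      by (rule A.Lam_cong[OF w]) (simp only: transpD(3)[OF F s] transpD(3)[OF G t])
  qed
  finally show ?thesis .
qed

text \<open>Multiplying the algebra part of a chain on the right while removing an initial piece of
  \<open>w\<close> is dual to multiplying \<open>b\<close> on the left. \<open>transp_left\<close>
  is the mirror image.\<close>

lemma transp_right:
  assumes F: "transp p m F \<Phi>" and a: "a \<in> A.alg n" and b: "b \<in> B.alg k"
    and o: "\<omega> \<in> B.W (n + m)" and w: "w \<in> A.W (p + k)"
  shows "A.Lam p k (\<lambda>u v. evA \<omega> (A.mul n m a (F u)) * evB b v) w
    = B.Lam n m (\<lambda>s t. kpure (p + k) n a w (fm s (B.mul p k (\<Phi> t) b))) \<omega>"
proof -
  have "A.Lam p k (\<lambda>u v. evA \<omega> (A.mul n m a (F u)) * evB b v) w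
    = B.Lam n m (\<lambda>s t. A.Lam p k (\<lambda>u v. evA s a * evA t (F u) * evB b v) w) \<omega>"
    unfolding Lam_swap[symmetric] by (rule A.Lam_cong[OF w]) (simp only: evA_mul[OF o a] transpD[OF F] B.Lam_scaled')
  also have "\<dots> = B.Lam n m (\<lambda>s t. kpure (p + k) n a w (fm s (B.mul p k (\<Phi> t) b))) \<omega>"
  proof (rule B.Lam_cong[OF o])
    fix s t assume s: "s \<in> B.W n" and t: "t \<in> B.W m"
    note T = transpD(2)[OF F t]
    show "A.Lam p k (\<lambda>u v. evA s a * evA t (F u) * evB b v) w = kpure (p + k) n a w (fm s (B.mul p k (\<Phi> t) b))"
      unfolding Kpure_fm[OF s B.qmul_in[OF T b]] evB_mul[OF w T b] A.Lam_scaled[symmetric]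
      by (rule A.Lam_cong[OF w]) (simp only: transpD(3)[OF F t] mult.assoc)
  qed
  finally show ?thesis .
qed

lemma transp_left:
  assumes F: "transp p m F \<Phi>" and a: "a \<in> A.alg n" and b: "b \<in> B.alg k"
    and o: "\<omega> \<in> B.W (m + n)" and w: "w \<in> A.W (k + p)"
  shows "A.Lam k p (\<lambda>u v. evA \<omega> (A.mul m n (F v) a) * evB b u) w
    = B.Lam m n (\<lambda>s t. kpure (k + p) n a w (fm t (B.mul k p b (\<Phi> s)))) \<omega>"
proof -
  have "A.Lam k p (\<lambda>u v. evA \<omega> (A.mul m n (F v) a) * evB b u) w
    = B.Lam m n (\<lambda>s t. A.Lam k p (\<lambda>u v. evA s (F v) * evA t a * evB b u) w) \<omega>"
    unfolding Lam_swap[symmetric] by (rule A.Lam_cong[OF w]) (simp only: evA_mul[OF o _ a] transpD[OF F] B.Lam_scaled')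
  also have "\<dots> = B.Lam m n (\<lambda>s t. kpure (k + p) n a w (fm t (B.mul k p b (\<Phi> s)))) \<omega>"
  proof (rule B.Lam_cong[OF o])
    fix s t assume s: "s \<in> B.W m" and t: "t \<in> B.W n"
    note T = transpD(2)[OF F s]
    show "A.Lam k p (\<lambda>u v. evA s (F v) * evA t a * evB b u) w = kpure (k + p) n a w (fm t (B.mul k p b (\<Phi> s)))"
      unfolding Kpure_fm[OF t B.qmul_in[OF b T]] evB_mul[OF w b T] A.Lam_scaled[symmetric]
      by (rule A.Lam_cong[OF w]) (simp only: transpD(3)[OF F s] mult_ac)
  qed
  finally show ?thesis .
qed

text \<open>The case of generators in \<open>transp_right\<close> and \<open>transp_left\<close>;
  the sign \<open>(-1) ^ Suc q\<close> of homology is the sign found in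
  \<open>bKm_M_Suc\<close>.\<close>

lemma theta_bKh:
  assumes z: "z \<in> Kc (Suc q) n"
  shows "theta q (n + 1) (dK (Suc q) n z) = B.dM n (Suc q) (theta (Suc q) n z)"
proof (rule B.MC_eqI)
  have bz: "dK (Suc q) n z \<in> Kc q (n + 1)" by (rule vhom_in[OF bKh_Suc(1) z])
  show "theta q (n + 1) (dK (Suc q) n z) \<in> vcar (B.MC (n + 1) q)" by (rule theta_in[OF bz])
  note bth = B.bKm_M_Suc[OF theta_in[OF z]]
  show "B.dM n (Suc q) (theta (Suc q) n z) \<in> vcar (B.MC (n + 1) q)" by (rule bth(2))
  fix \<omega> b assume o: "\<omega> \<in> B.W (n + 1)" and b: "b \<in> B.alg q"
  have o': "\<omega> \<in> B.W (1 + n)" using o by simp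
  let ?l = "\<lambda>\<xi>. B.mul 1 q (B.gen \<xi>) b" and ?r = "\<lambda>\<xi>. B.mul q 1 b (B.gen \<xi>)"
  have lr: "?l \<xi> \<in> B.alg (Suc q)" "?r \<xi> \<in> B.alg (Suc q)" if "\<xi> \<in> B.W 1" for \<xi>
    using B.qmul_in[OF B.qgen_in[OF that] b] B.qmul_in[OF b B.qgen_in[OF that]] by simp_all
  have "theta q (n + 1) (dK (Suc q) n z) \<omega> b
    = z (\<lambda>a w. A.Lam 1 q (\<lambda>x u. evA \<omega> (A.mul n 1 a (A.gen x)) * evB b u) w
        + (-1) ^ Suc q * A.Lam q 1 (\<lambda>u x. evA \<omega> (A.mul 1 n (A.gen x) a) * evB b u) w)"
    by (simp only: theta_apply[OF bz o b] bKh_Suc(2)[OF z o b])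
  also have "\<dots> = B.Lam n 1 (\<lambda>\<omega>' \<xi>. z (fm \<omega>' (?l \<xi>))) \<omega> - (-1) ^ q * B.Lam 1 n (\<lambda>\<xi> \<omega>'. z (fm \<omega>' (?r \<xi>))) \<omega>"
  proof (rule Kch_form_eq[OF Kch_eval _ z])
    show "vlinear (K (Suc q) n) vfield (\<lambda>z. B.Lam n 1 (\<lambda>\<omega>' \<xi>. z (fm \<omega>' (?l \<xi>))) \<omega>
        - (-1) ^ q * B.Lam 1 n (\<lambda>\<xi> \<omega>'. z (fm \<omega>' (?r \<xi>))) \<omega>)"
      by (intro A.vform_minus vform_scaled B.Lam_param[OF o] B.Lam_param[OF o'] Kch_eval)
    fix a w assume a: "a \<in> A.alg n" and w: "w \<in> A.W (Suc q)"
    have w1: "w \<in> A.W (1 + q)" and w2: "w \<in> A.W (q + 1)" using w by simp_all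
    have 1: "A.Lam 1 q (\<lambda>x u. evA \<omega> (A.mul n 1 a (A.gen x)) * evB b u) w
      = B.Lam n 1 (\<lambda>\<omega>' \<xi>. kpure (Suc q) n a w (fm \<omega>' (?l \<xi>))) \<omega>"
      using transp_right[OF transp_gen a b o w1] by (simp only: Suc_eq_plus1_left)
    have 2: "A.Lam q 1 (\<lambda>u x. evA \<omega> (A.mul 1 n (A.gen x) a) * evB b u) w
      = B.Lam 1 n (\<lambda>\<xi> \<omega>'. kpure (Suc q) n a w (fm \<omega>' (?r \<xi>))) \<omega>"
      using transp_left[OF transp_gen a b o' w2] by (simp only: Suc_eq_plus1)
    show "kpure (Suc q) n a w (\<lambda>a w. A.Lam 1 q (\<lambda>x u. evA \<omega> (A.mul n 1 a (A.gen x)) * evB b u) w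
        + (-1) ^ Suc q * A.Lam q 1 (\<lambda>u x. evA \<omega> (A.mul 1 n (A.gen x) a) * evB b u) w)
      = B.Lam n 1 (\<lambda>\<omega>' \<xi>. kpure (Suc q) n a w (fm \<omega>' (?l \<xi>))) \<omega>
        - (-1) ^ q * B.Lam 1 n (\<lambda>\<xi> \<omega>'. kpure (Suc q) n a w (fm \<omega>' (?r \<xi>))) \<omega>"
      unfolding Kpure_apply[OF bKh_Suc(3)[OF o b]] 1 2 by simp
  qed
  also have "\<dots> = B.dM n (Suc q) (theta (Suc q) n z) \<omega> b"
  proof -
    have 1: "B.Lam n 1 (\<lambda>\<omega>' \<xi>. z (fm \<omega>' (?l \<xi>))) \<omega> = B.Lam n 1 (\<lambda>\<omega>' \<xi>. theta (Suc q) n z \<omega>' (?l \<xi>)) \<omega>"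
      by (rule B.Lam_cong[OF o]) (simp only: theta_apply[OF z] lr)
    have 2: "B.Lam 1 n (\<lambda>\<xi> \<omega>'. z (fm \<omega>' (?r \<xi>))) \<omega> = B.Lam 1 n (\<lambda>\<xi> \<omega>'. theta (Suc q) n z \<omega>' (?r \<xi>)) \<omega>"
      by (rule B.Lam_cong[OF o']) (simp only: theta_apply[OF z] lr)
    show ?thesis unfolding bth(1)[OF o b] 1 2 ..
  qed
  finally show "theta q (n + 1) (dK (Suc q) n z) \<omega> b = B.dM n (Suc q) (theta (Suc q) n z) \<omega> b" .
qed

section \<open>The transposed cochain\<close>

lemma evB_mem: "b \<in> B.alg m \<Longrightarrow> t \<in> b \<Longrightarrow> w \<in> A.W m \<Longrightarrow> tpair t w = evB b w"
proof -
  assume b: "b \<in> B.alg m" and t: "t \<in> b" and w: "w \<in> A.W m"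
  then obtain t0 where t0: "t0 \<in> B.T m" "b = B.cl m t0" by (auto elim: B.qalgE)
  have "t \<in> B.T m" "t - t0 \<in> B.I m"
    using t unfolding t0(2) by (rule B.mem_cl_T[OF t0(1)], rule B.mem_cl)
  moreover from this have "B.cl m t0 = B.cl m t" by (rule B.cl_eqI[OF t0(1)])
  ultimately show "tpair t w = evB b w" using w t0 by (simp add: evB_cl)
qed

lemma evA_mem: "X \<in> A.alg m \<Longrightarrow> s \<in> X \<Longrightarrow> \<omega> \<in> B.W m \<Longrightarrow> tpair \<omega> s = evA \<omega> X"
proof -
  assume X: "X \<in> A.alg m" and s: "s \<in> X" and w: "\<omega> \<in> B.W m"
  then obtain s0 where s0: "s0 \<in> A.T m" "X = A.cl m s0" by (auto elim: A.qalgE)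
  have "s \<in> A.T m" "s - s0 \<in> A.I m"
    using s unfolding s0(2) by (rule A.mem_cl_T[OF s0(1)], rule A.mem_cl)
  moreover from this have "A.cl m s0 = A.cl m s" by (rule A.cl_eqI[OF s0(1)])
  ultimately show "tpair \<omega> s = evA \<omega> X" using w s0 by (simp add: evA_cl)
qed

text \<open>The description in \<open>phiA\<close> is justified by the perfect pairing:
  \<open>form_W\<close> represents the form \<open>\<lambda>w. evA \<omega> (f w)\<close> by a class
  in A^!, and \<open>evB_eqI\<close> makes it unique.\<close>

lemma phi:
  assumes f: "f \<in> vcar (A.NC p m)"
  shows "\<omega> \<in> B.W m \<Longrightarrow> w \<in> A.W p \<Longrightarrow> evB (ph p m f \<omega>) w = evA \<omega> (f w)"
    and "ph p m f \<in> vcar (B.NC m p)"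
proof -
  have R'': "rperp V R = R'" "vdual V = V'" by (simp_all add: R' V')
  have main: "ph p m f \<omega> \<in> B.alg p \<and> (\<forall>w\<in>A.W p. evB (ph p m f \<omega>) w = evA \<omega> (f w))"
    if o: "\<omega> \<in> B.W m" for \<omega>
  proof -
    have l: "A.wform p (\<lambda>w. evA \<omega> (f w))"
      by (rule vform_vhom[OF evA_linear[OF o] f])
    let ?t = "B.mk p (\<lambda>I. evA \<omega> (f (A.Pj p (A.eI I))))"
    let ?P = "\<lambda>b. b \<in> B.alg p \<and> (\<forall>w\<in>A.W p. \<forall>t\<in>b. \<forall>s\<in>f w. tpair t w = tpair \<omega> s)"
    \<comment> \<open>The condition in \<open>phiA\<close> ranges over all representatives. Cosets
      are nonempty and the pairings do not depend on representatives, so it is a single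
      equation.\<close>
    have eq: "?P b \<longleftrightarrow> b \<in> B.alg p \<and> (\<forall>w\<in>A.W p. evB b w = evA \<omega> (f w))" for b
    proof -
      have "(\<forall>t\<in>b. \<forall>s\<in>f w. tpair t w = tpair \<omega> s) \<longleftrightarrow> evB b w = evA \<omega> (f w)"
        if b: "b \<in> B.alg p" and w: "w \<in> A.W p" for w
      proof -
        have fw: "f w \<in> A.alg m" by (rule vhom_in[OF f w])
        obtain t where t: "t \<in> b" using B.qalgE[OF b] B.cl_self by metis
        obtain s where s: "s \<in> f w" using A.qalgE[OF fw] A.cl_self by metis
        show ?thesis
        proof
          assume "\<forall>t\<in>b. \<forall>s\<in>f w. tpair t w = tpair \<omega> s"
          with t s have "tpair t w = tpair \<omega> s" by blast
          then show "evB b w = evA \<omega> (f w)" by (simp only: evB_mem[OF b t w] evA_mem[OF fw s o])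
        next
          assume "evB b w = evA \<omega> (f w)"
          then show "\<forall>t\<in>b. \<forall>s\<in>f w. tpair t w = tpair \<omega> s"
            by (intro ballI) (simp only: evB_mem[OF b _ w] evA_mem[OF fw _ o])
        qed
      qed
      then show ?thesis by blast
    qed
    have t: "?P (B.cl p ?t)"
      unfolding eq using form_W[OF l] by (simp add: evB_cl)
    have "?P (THE b. ?P b)"
    proof (rule theI[where P = ?P, OF t])
      fix b assume "?P b"
      with t show "b = B.cl p ?t"
        unfolding eq by (elim conjE, intro evB_eqI[of b p]) simp_all
    qed
    then show ?thesis unfolding eq[symmetric] using o by (simp add: phiA_def R'')
  qed
  then show "\<omega> \<in> B.W m \<Longrightarrow> w \<in> A.W p \<Longrightarrow> evB (ph p m f \<omega>) w = evA \<omega> (f w)" by blast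
  show "ph p m f \<in> vcar (B.NC m p)"
  proof (rule vhom_sepI[OF B.vsp_qW B.vsp_qalg sepset_all[OF B.vsp_qalg]])
    fix l :: "('k, 'a \<Rightarrow> 'k) tensor set \<Rightarrow> 'k" assume "l \<in> {l. B.aform p l}"
    then obtain w where w: "w \<in> A.W p" "\<And>b. b \<in> B.alg p \<Longrightarrow> l b = evB b w" by (auto elim: formB)
    have "B.wform m (\<lambda>\<omega>. evA \<omega> (f w))"
      by (rule evA_linear_left[OF vhom_in[OF f w(1)]])
    then show "B.wform m (\<lambda>\<omega>. l (ph p m f \<omega>))"
      by (rule vform_cong) (use main w vsp_add[OF B.vsp_qW] vsp_scale[OF B.vsp_qW] in auto)
  qed (use main in \<open>auto simp: phiA_def R''\<close>)
qed

lemma transp_phi: "f \<in> vcar (A.NC p m) \<Longrightarrow> transp p m f (ph p m f)"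
  unfolding transp_def using A.linq_vhom B.linq_vhom phi by blast

lemma phi_eqI:
  assumes "F \<in> vcar (B.NC m p)" "F' \<in> vcar (B.NC m p)"
    "\<And>\<omega> w. \<omega> \<in> B.W m \<Longrightarrow> w \<in> A.W p \<Longrightarrow> evB (F \<omega>) w = evB (F' \<omega>) w"
  shows "F = F'"
proof (rule vhom_ext[OF assms(1,2)])
  fix \<omega> assume o: "\<omega> \<in> vcar (qW V' R' m)"
  show "F \<omega> = F' \<omega>"
    by (rule evB_eqI[OF vhom_in[OF assms(1) o] vhom_in[OF assms(2) o] assms(3)[OF o]])
qed

lemma phi_add:
  assumes f: "f \<in> vcar (A.NC p m)" and h: "h \<in> vcar (A.NC p m)"
  shows "ph p m (vadd (A.NC p m) f h) = vadd (B.NC m p) (ph p m f) (ph p m h)"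
proof -
  note fh = vsp_add[OF A.vsp_NC f h]
  show ?thesis
  proof (rule phi_eqI[OF phi(2)[OF fh] vsp_add[OF B.vsp_NC phi(2)[OF f] phi(2)[OF h]]])
    fix \<omega> w assume o: "\<omega> \<in> B.W m" and w: "w \<in> A.W p"
    show "evB (ph p m (vadd (A.NC p m) f h) \<omega>) w = evB (vadd (B.NC m p) (ph p m f) (ph p m h) \<omega>) w"
      unfolding phi(1)[OF fh o w] using o w phi(1)[OF f o w] phi(1)[OF h o w]
      by (simp add: vform_add[OF evA_linear[OF o]] vform_add[OF evB_linear[OF w]]
          vhom_in[OF f] vhom_in[OF h] vhom_in[OF phi(2)[OF f]] vhom_in[OF phi(2)[OF h]])
  qed
qed

lemma phi_zero: "ph p m (vzero (A.NC p m)) = vzero (B.NC m p)"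
proof (rule phi_eqI[OF phi(2)[OF vsp_zero[OF A.vsp_NC]] vsp_zero[OF B.vsp_NC]])
  fix \<omega> w assume o: "\<omega> \<in> B.W m" and w: "w \<in> A.W p"
  show "evB (ph p m (vzero (A.NC p m)) \<omega>) w = evB (vzero (B.NC m p) \<omega>) w"
    unfolding phi(1)[OF vsp_zero[OF A.vsp_NC] o w]
    using o w vform_zero[OF A.vsp_qalg evA_linear[OF o]] vform_zero[OF B.vsp_qalg evB_linear[OF w]] by simp
qed

text \<open>Transposition exchanges the two terms' roles only through \<open>transp_mul\<close>, and
  \<open>p\<close> becomes the coefficient weight. The sign \<open>- ((-1) ^ p)\<close> of the
  ordinary differential is therefore the modified sign for A^!.\<close>

lemma phi_bKc:
  assumes f: "f \<in> vcar (A.NC p m)"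
  shows "ph (p + 1) (m + 1) (bKc V R p m f) = B.bK (- ((-1) ^ p)) m p (ph p m f)"
    and "bKc V R p m f \<in> vcar (A.NC (p + 1) (m + 1))"
proof -
  let ?\<phi> = "ph p m f"
  note bf = A.bK_form[OF A.linq_vhom[OF f], folded A.bKc_bK]
  note bf' = A.bK_form[OF A.linq_vhom[OF f], where \<epsilon> = "- ((-1) ^ p)", folded A.bKc_bK]
  note bphi = B.bK_form[OF B.linq_vhom[OF phi(2)[OF f]], where \<epsilon> = "- ((-1) ^ p)"]
  show in1: "bKc V R p m f \<in> vcar (A.NC (p + 1) (m + 1))" by (rule bf'(2))
  show "ph (p + 1) (m + 1) (bKc V R p m f) = B.bK (- ((-1) ^ p)) m p ?\<phi>"
  proof (rule phi_eqI[OF phi(2)[OF in1] bphi(2)])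
    fix \<omega> w assume o: "\<omega> \<in> B.W (m + 1)" and w: "w \<in> A.W (p + 1)"
    have o': "\<omega> \<in> B.W (1 + m)" and w': "w \<in> A.W (1 + p)" using o w by simp_all
    note 1 = transp_mul[OF transp_phi[OF f] transp_gen o w]
    note 2 = transp_mul[OF transp_gen transp_phi[OF f] o' w']
    show "evB (ph (p + 1) (m + 1) (bKc V R p m f) \<omega>) w = evB (B.bK (- ((-1) ^ p)) m p ?\<phi> \<omega>) w"
      unfolding phi(1)[OF in1 o w] bf'(1)[OF w evA_linear[OF o]] bphi(1)[OF o evB_linear[OF w]] 1 2 ..
  qed
qed

lemma theta_zero: "theta q n (vzero (K q n)) = vzero (B.MC n q)"
  by (rule vhom_zero[OF vsp_Kch B.vsp_MC theta_hom])

text \<open>Removing the final piece of \<open>w\<close> and multiplying by \<open>f\<close> on the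
  left is dual to multiplying \<open>b\<close> by the transpose on the right, which is the left
  action on functionals.\<close>

lemma theta_capl:
  assumes f: "f \<in> vcar (A.NC p m)" and z: "z \<in> Kc q n"
  shows "theta (q - p) (m + n) (capl V R p m q n f z) = B.cupl m p n q (ph p m f) (theta q n z)"
    and "capl V R p m q n f z \<in> Kc (q - p) (m + n)"
proof -
  let ?\<phi> = "ph p m f"
  have "theta (q - p) (m + n) (capl V R p m q n f z) = B.cupl m p n q ?\<phi> (theta q n z) \<and>
    capl V R p m q n f z \<in> Kc (q - p) (m + n)"
  proof (cases "q < p")
    \<comment> \<open>Both sides are zero, and truncation puts both into weight
      \<open>q - p = 0\<close>.\<close>
    case True
    then have "capl V R p m q n f z = vzero (K (q - p) (m + n))" by (simp add: capl_def Let_def)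
    moreover have "q - p = 0" using True by simp
    ultimately show ?thesis
      using True vsp_zero[OF vsp_Kch] by (simp only: theta_zero B.mcup_M0 simp_thms)
  next
    case False
    then obtain k where k: "q = k + p" by (metis add.commute le_Suc_ex not_le)
    note fl = A.linq_vhom[OF f]
    have z': "z \<in> Kc (k + p) n" using z k by simp
    have cz: "capl V R p m (k + p) n f z \<in> Kc k (m + n)" by (rule vhom_in[OF capl_form(1)[OF fl] z'])
    have tz: "theta (k + p) n z \<in> vcar (B.MC n (p + k))" using theta_in[OF z'] by (simp add: add.commute)
    note rhs = B.mcupl_M[OF B.linq_vhom[OF phi(2)[OF f]] tz]
    have "theta k (m + n) (capl V R p m (k + p) n f z) = B.cupl m p n (p + k) ?\<phi> (theta (k + p) n z)"
    proof (rule B.MC_eqI[OF theta_in[OF cz] rhs(2)])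
      fix \<omega> b assume o: "\<omega> \<in> B.W (m + n)" and b: "b \<in> B.alg k"
      let ?s = "(-1) ^ (k * p) :: 'k"
      have c: "B.mul k p b (?\<phi> \<omega>1) \<in> B.alg (k + p)" if "\<omega>1 \<in> B.W m" for \<omega>1
        by (rule B.qmul_in[OF b vhom_in[OF phi(2)[OF f] that]])
      \<comment> \<open>The exponents differ by \<open>p * p + p\<close>, which is even. Here the
        sign of the left action on the graded dual is absorbed.\<close>
      have s: "(-1) ^ (p * (p + k) + p) = ?s" by (cases "even p") (simp_all add: minus_one_power_iff)
      have "theta k (m + n) (capl V R p m (k + p) n f z) \<omega> b
        = z (\<lambda>a w. ?s * A.Lam k p (\<lambda>u v. evA \<omega> (A.mul m n (f v) a) * evB b u) w)"
        by (simp only: theta_apply[OF cz o b] capl_form(2)[OF fl z' o b])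
      also have "\<dots> = ?s * B.Lam m n (\<lambda>\<omega>1 \<omega>2. z (fm \<omega>2 (B.mul k p b (?\<phi> \<omega>1)))) \<omega>"
      proof (rule Kch_form_eq[OF Kch_eval vform_scaled[OF B.Lam_param[OF o Kch_eval]] z'])
        fix a w assume a: "a \<in> A.alg n" and w: "w \<in> A.W (k + p)"
        show "kpure (k + p) n a w (\<lambda>a w. ?s * A.Lam k p (\<lambda>u v. evA \<omega> (A.mul m n (f v) a) * evB b u) w)
          = ?s * B.Lam m n (\<lambda>\<omega>1 \<omega>2. kpure (k + p) n a w (fm \<omega>2 (B.mul k p b (?\<phi> \<omega>1)))) \<omega>"
          unfolding Kpure_apply[OF capl_form(3)[OF fl o b]] by (simp only: a w if_True simp_thms transp_left[OF transp_phi[OF f] a b o w])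
      qed
      also have "B.Lam m n (\<lambda>\<omega>1 \<omega>2. z (fm \<omega>2 (B.mul k p b (?\<phi> \<omega>1)))) \<omega>
        = B.Lam m n (\<lambda>\<omega>1 \<omega>2. theta (k + p) n z \<omega>2 (B.mul k p b (?\<phi> \<omega>1))) \<omega>"
        by (rule B.Lam_cong[OF o]) (simp only: theta_apply[OF z'] c)
      finally show "theta k (m + n) (capl V R p m (k + p) n f z) \<omega> b
        = B.cupl m p n (p + k) ?\<phi> (theta (k + p) n z) \<omega> b"
        unfolding rhs(1)[OF o b] s .
    qed
    then show ?thesis using cz k by (simp add: add.commute)
  qed
  then show "theta (q - p) (m + n) (capl V R p m q n f z) = B.cupl m p n q (ph p m f) (theta q n z)"
    and "capl V R p m q n f z \<in> Kc (q - p) (m + n)" by simp_all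
qed

text \<open>The right action on functionals has no sign, so the sign \<open>(-1) ^ (p * q)\<close>
  of the cup product is already that of the cap action.\<close>

lemma theta_capr:
  assumes f: "f \<in> vcar (A.NC p m)" and z: "z \<in> Kc q n"
  shows "theta (q - p) (m + n) (capr V R p m q n z f) = B.cupr m p n q (theta q n z) (ph p m f)"
    and "capr V R p m q n z f \<in> Kc (q - p) (m + n)"
proof -
  let ?\<phi> = "ph p m f"
  have "theta (q - p) (m + n) (capr V R p m q n z f) = B.cupr m p n q (theta q n z) ?\<phi> \<and>
    capr V R p m q n z f \<in> Kc (q - p) (m + n)"
  proof (cases "q < p")
    case True
    then have "capr V R p m q n z f = vzero (K (q - p) (m + n))" by (simp add: capr_def Let_def)
    moreover have "q - p = 0" using True by simp
    ultimately show ?thesis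
      using True vsp_zero[OF vsp_Kch] by (simp only: theta_zero B.mcup_M0 simp_thms add.commute[of n m])
  next
    case False
    then obtain k where k: "q = p + k" by (metis le_Suc_ex not_le)
    note fl = A.linq_vhom[OF f]
    have z': "z \<in> Kc (p + k) n" using z k by simp
    have cz: "capr V R p m (p + k) n z f \<in> Kc k (n + m)"
      using capr_form(1)[OF fl z'] by (simp add: add.commute)
    note rhs = B.mcupr_M[OF B.linq_vhom[OF phi(2)[OF f]] theta_in[OF z']]
    have "theta k (n + m) (capr V R p m (p + k) n z f) = B.cupr m p n (p + k) (theta (p + k) n z) ?\<phi>"
    proof (rule B.MC_eqI[OF theta_in[OF cz] rhs(2)])
      fix \<omega> b assume o: "\<omega> \<in> B.W (n + m)" and b: "b \<in> B.alg k"
      let ?s = "(-1) ^ (p * (p + k)) :: 'k"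
      have c: "B.mul p k (?\<phi> \<omega>2) b \<in> B.alg (p + k)" if "\<omega>2 \<in> B.W m" for \<omega>2
        by (rule B.qmul_in[OF vhom_in[OF phi(2)[OF f] that] b])
      have "theta k (n + m) (capr V R p m (p + k) n z f) \<omega> b
        = z (\<lambda>a w. ?s * A.Lam p k (\<lambda>u v. evA \<omega> (A.mul n m a (f u)) * evB b v) w)"
        by (simp only: theta_apply[OF cz o b] capr_form(2)[OF fl z' o b])
      also have "\<dots> = ?s * B.Lam n m (\<lambda>\<omega>1 \<omega>2. z (fm \<omega>1 (B.mul p k (?\<phi> \<omega>2) b))) \<omega>"
      proof (rule Kch_form_eq[OF Kch_eval vform_scaled[OF B.Lam_param[OF o Kch_eval]] z'])
        fix a w assume a: "a \<in> A.alg n" and w: "w \<in> A.W (p + k)"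
        show "kpure (p + k) n a w (\<lambda>a w. ?s * A.Lam p k (\<lambda>u v. evA \<omega> (A.mul n m a (f u)) * evB b v) w)
          = ?s * B.Lam n m (\<lambda>\<omega>1 \<omega>2. kpure (p + k) n a w (fm \<omega>1 (B.mul p k (?\<phi> \<omega>2) b))) \<omega>"
          unfolding Kpure_apply[OF capr_form(3)[OF fl o b]] by (simp only: a w if_True simp_thms transp_right[OF transp_phi[OF f] a b o w])
      qed
      also have "B.Lam n m (\<lambda>\<omega>1 \<omega>2. z (fm \<omega>1 (B.mul p k (?\<phi> \<omega>2) b))) \<omega>
        = B.Lam n m (\<lambda>\<omega>1 \<omega>2. theta (p + k) n z \<omega>1 (B.mul p k (?\<phi> \<omega>2) b)) \<omega>"
        by (rule B.Lam_cong[OF o]) (simp only: theta_apply[OF z'] c)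
      finally show "theta k (n + m) (capr V R p m (p + k) n z f) \<omega> b
        = B.cupr m p n (p + k) (theta (p + k) n z) ?\<phi> \<omega> b"
        unfolding rhs(1)[OF o b] by (simp only: mult.commute[of "p + k" p])
    qed
    then show ?thesis using cz k by (simp add: add.commute)
  qed
  then show "theta (q - p) (m + n) (capr V R p m q n z f) = B.cupr m p n q (theta q n z) (ph p m f)"
    and "capr V R p m q n z f \<in> Kc (q - p) (m + n)" by simp_all
qed

end

context quad
begin

lemma bK_vlinear: "vlinear (NC p m) (NC (p + 1) (m + 1)) (bK \<epsilon> p m)"
proof (rule vlinear_sepI[OF vsp_NC vsp_NC])
  let ?L = "{\<lambda>F. h (F u) | h u. aform (m + 1) h \<and> u \<in> W (p + 1)}"
  show "sepset (NC (p + 1) (m + 1)) ?L"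
    unfolding sepset_def
  proof (intro conjI ballI impI)
    fix F G assume F: "F \<in> vcar (NC (p + 1) (m + 1))" and G: "G \<in> vcar (NC (p + 1) (m + 1))" and *: "\<forall>l\<in>?L. l F = l G"
    have eq: "h (F u) = h (G u)" if "aform (m + 1) h" "u \<in> W (p + 1)" for h u
      using bspec[OF * CollectI, of "\<lambda>F. h (F u)"] that by blast
    show "F = G"
    proof (rule vhom_ext[OF F G])
      fix u assume u: "u \<in> W (p + 1)"
      show "F u = G u"
        by (rule vsp_eqI[OF vsp_qalg vhom_in[OF F u] vhom_in[OF G u] eq[OF _ u]])
    qed
  qed (auto intro: NC_eval)
  fix l assume "l \<in> ?L"
  then obtain h w where h: "aform (m + 1) h" and w: "w \<in> W (p + 1)" and l: "l = (\<lambda>F. h (F w))"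
    by blast
  have h': "aform (1 + m) h" and w': "w \<in> W (1 + p)" using h w by simp_all
  have "vlinear (NC p m) vfield (\<lambda>f. Lam p 1 (\<lambda>u x. h (mul m 1 (f u) (gen x))) w
      + \<epsilon> * Lam 1 p (\<lambda>x u. h (mul 1 m (gen x) (f u))) w)"
    by (intro vform_plus vform_scaled Lam_param[OF w] Lam_param[OF w'] NC_eval
        qmul_vform_left[OF h] qmul_vform_right[OF h'] qgen_in)
  then have "vlinear (NC p m) vfield (\<lambda>f. h (bK \<epsilon> p m f w))"
    by (rule vform_cong) (simp_all only: bK_form(1)[OF linq_vhom w h] vsp_add[OF vsp_NC] vsp_scale[OF vsp_NC])
  then show "vlinear (NC p m) vfield (\<lambda>f. l (bK \<epsilon> p m f))" by (simp only: l)
qed (rule bK_form(2)[OF linq_vhom])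

text \<open>Coboundaries are defined by a union over possible sources. There is none if
  \<open>p\<close> or \<open>m\<close> is 0; otherwise there is exactly one, and they are the image
  of a linear map.\<close>

lemma vsubsp_Mcobd_N: "vsubsp (NC p m) (BN p m)"
proof (cases "p = 0 \<or> m = 0")
  case True
  then have "BN p m = {vzero (NC p m)}"
    by (auto simp: Mcobd_N simp del: vhom_simps)
  then show ?thesis using vsp_zero[OF vsp_NC, of p m]
    by (simp add: vsubsp_def vsp_zero_add[OF vsp_NC] vsp_scale_zero[OF vsp_NC] del: vhom_simps)
next
  case False
  then obtain p' m' where pm: "p = p' + 1" "m = m' + 1" by (metis Suc_eq_plus1 not0_implies_Suc)
  note im = vsubsp_image[OF vsp_NC vsp_NC bK_vlinear bK_form(2)[OF linq_vhom], of p' m' "- ((-1) ^ m')"]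
  have "BN p m = bK (- ((-1) ^ m')) p' m' ` vcar (NC p' m')"
    unfolding pm using im(1) by (auto simp: Mcobd_N vsubsp_def simp del: vhom_simps)
  then show ?thesis using im(1) by (simp add: pm)
qed

end

section \<open>Passage to homology and comparison of the actions\<close>

context qdual
begin

lemma phi_cocyc:
  assumes "f \<in> Kcocyc V R p m"
  shows "f \<in> vcar (A.NC p m)" and "ph p m f \<in> B.ZN m p"
proof -
  show f: "f \<in> vcar (A.NC p m)" using assms by (simp add: Kcocyc_def Kcoch_def)
  have "bKc V R p m f = vzero (A.NC (p + 1) (m + 1))"
    using assms by (simp add: Kcocyc_def Kcoch_def del: vhom_simps)
  then show "ph p m f \<in> B.ZN m p"
    using phi_bKc(1)[OF f] phi(2)[OF f] by (simp add: B.Mcocyc_N phi_zero del: vhom_simps)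
qed

lemma phi_cobd:
  assumes "h \<in> Kcobd V R p m"
  shows "h \<in> vcar (A.NC p m)" and "ph p m h \<in> B.BN m p"
proof -
  consider "h = vzero (A.NC p m)"
    | p' m' k where "p = p' + 1" "m = m' + 1" "k \<in> vcar (A.NC p' m')" "h = bKc V R p' m' k"
    using assms unfolding Kcobd_def Kcoch_def by blast
  then have "h \<in> vcar (A.NC p m) \<and> ph p m h \<in> B.BN m p"
  proof cases
    case 1
    then show ?thesis using vsp_zero[OF A.vsp_NC] by (simp add: phi_zero B.Mcobd_N del: vhom_simps)
  next
    case 2
    have "ph p m h = B.bK (- ((-1) ^ p')) m' p' (ph p' m' k)"
      unfolding 2 by (rule phi_bKc(1)[OF 2(3)])
    then have "ph p m h \<in> B.BN m p"
      unfolding B.Mcobd_N using phi(2)[OF 2(3)] 2(1,2) by blast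
    moreover have "h \<in> vcar (A.NC p m)" unfolding 2 by (rule phi_bKc(2)[OF 2(3)])
    ultimately show ?thesis by blast
  qed
  then show "h \<in> vcar (A.NC p m)" and "ph p m h \<in> B.BN m p" by simp_all
qed

lemma theta_eq_iff: "z \<in> Kc q n \<Longrightarrow> theta q n z = vzero (B.MC n q) \<longleftrightarrow> z = vzero (K q n)"
  using inj_onD[OF theta_inj, of q n z "vzero (K q n)"] theta_zero vsp_zero[OF vsp_Kch] by auto

text \<open>Injectivity of \<open>theta\<close> lets the vanishing of a differential be tested after
  applying it. For \<open>q = 0\<close> both cycle conditions are empty.\<close>

lemma Kcyc_theta: "Kcyc V R q n = {z \<in> Kc q n. theta q n z \<in> B.ZM n q}"
proof (cases q)
  case 0
  then show ?thesis
    using theta_in[of _ 0 n] by (auto simp: Kcyc_def bKh_def B.Mcocyc_M B.bKm_M_0 simp del: vhom_simps)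
next
  case (Suc k)
  have "dK (Suc k) n z = vzero (K k (n + 1)) \<longleftrightarrow>
    B.dM n (Suc k) (theta (Suc k) n z) = vzero (B.MC (n + 1) k)"
    if "z \<in> Kc (Suc k) n" for z
    using theta_eq_iff[OF vhom_in[OF bKh_Suc(1) that]] theta_bKh[OF that] by simp
  then show ?thesis
    using Suc theta_in[of _ "Suc k" n] by (auto simp: Kcyc_def B.Mcocyc_M simp del: vhom_simps Kch_ops)
qed

text \<open>By surjectivity of \<open>theta\<close> each coboundary is the differential of a
  transported chain, hence \<open>theta\<close> of a boundary; injectivity turns this into a
  preimage. For \<open>n = 0\<close> only zero is left on both sides.\<close>

lemma Kbd_theta: "Kbd V R q n = {z \<in> Kc q n. theta q n z \<in> B.BM n q}"
proof (cases n)
  case 0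
  then show ?thesis
    using theta_eq_iff[of _ q 0] theta_zero[of q 0] vsp_zero[OF vsp_Kch, of q 0]
    by (auto simp: Kbd_def B.Mcobd_M_0 simp del: vhom_simps Kch_ops)
next
  case (Suc k)
  note h = bKh_Suc(1)[of q k]
  have Kbd: "Kbd V R q n = dK (Suc q) k ` Kc (Suc q) k"
  proof -
    have "vzero (K q n) \<in> dK (Suc q) k ` Kc (Suc q) k"
      using vhom_zero[OF vsp_Kch vsp_Kch h]
      by (intro image_eqI[OF _ vsp_zero[OF vsp_Kch]]) (simp add: Suc del: Kch_ops)
    then show ?thesis unfolding Kbd_def using Suc by auto
  qed
  have bd: "B.BM n q = theta q n ` Kbd V R q n"
  proof -
    have "B.BM n q = (\<lambda>z. B.dM k (Suc q) (theta (Suc q) k z)) ` Kc (Suc q) k"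
      unfolding Suc B.Mcobd_M_Suc theta_surj[symmetric] image_image ..
    also have "\<dots> = theta q n ` Kbd V R q n"
      unfolding Kbd image_image using theta_bKh[of _ q k] Suc by (intro image_cong refl) simp
    finally show ?thesis .
  qed
  have sub: "Kbd V R q n \<subseteq> Kc q n"
    unfolding Kbd using vhom_in[OF h] Suc by auto
  show ?thesis
    unfolding bd using sub inj_on_image_mem_iff[OF theta_inj _ sub] by auto
qed

lemma theta_Kcyc: "theta q n ` Kcyc V R q n = B.ZM n q"
  and theta_Kbd: "theta q n ` Kbd V R q n = B.BM n q"
proof -
  have "theta q n ` {z \<in> Kc q n. theta q n z \<in> Z} = Z" if "vsubsp (B.MC n q) Z" for Z
    using that theta_surj[of q n] unfolding vsubsp_def by (auto simp: image_iff)
  then show "theta q n ` Kcyc V R q n = B.ZM n q" "theta q n ` Kbd V R q n = B.BM n q"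
    unfolding Kcyc_theta Kbd_theta by (simp_all add: B.vsubsp_Mcocyc B.vsubsp_Mcobd)
qed

text \<open>Cycles and boundaries are preimages under \<open>theta\<close>, so the subspace
  properties, and below the inclusion of boundaries in cycles, are pulled back from the
  cochains.\<close>

lemma vsubsp_Kcyc: "vsubsp (K q n) (Kcyc V R q n)"
  and vsubsp_Kbd: "vsubsp (K q n) (Kbd V R q n)"
  unfolding Kcyc_theta Kbd_theta
  by (rule vsubsp_preimage[OF vsp_Kch B.vsp_MC theta_hom]; rule B.vsubsp_Mcocyc B.vsubsp_Mcobd)+

lemma Kbd_Kcyc: "Kbd V R q n \<subseteq> Kcyc V R q n"
  unfolding Kcyc_theta Kbd_theta using B.Mcobd_Mcocyc by blast

definition psi where
  "psi q n = (\<lambda>X\<in>vcar (HKhom V R q n). theta q n ` X)"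

lemmas quot = vquot_viso[OF vsp_Kch B.vsp_MC vsubsp_Kcyc vsubsp_Kbd Kbd_Kcyc B.vsubsp_Mcocyc B.vsubsp_Mcobd
  B.Mcobd_Mcocyc theta_hom theta_inj theta_Kcyc theta_Kbd]

lemma psi_viso: "psi q n \<in> viso (HKhom V R q n) (MHK V' R' B.M n q)"
  using quot(1)[of q n] by (simp add: psi_def HKhom_def MHK_def B.MC_Mcoch)

abbreviation clK where "clK q n \<equiv> vclass (Kch V R q n) (Kbd V R q n)"
abbreviation clM where "clM n q \<equiv> vclass (B.MC n q) (Mcobd V' R' B.M n q)"

lemma HKhom_carrier: "vcar (HKhom V R q n) = clK q n ` Kcyc V R q n"
  by (simp add: HKhom_def vquot_def)

lemma psi_class: "z \<in> Kcyc V R q n \<Longrightarrow> psi q n (clK q n z) = clM n q (theta q n z)"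
  using quot(2)[of z q n] by (simp add: psi_def HKhom_carrier Kcyc_theta)

text \<open>Both actions on classes are unions over representatives. On the dual side all terms
  agree by \<open>mcup_class\<close>. On the side of chains this is not proved directly: the terms
  have the same image under \<open>theta\<close>, so they are equal.\<close>

lemma HKcap:
  assumes al: "\<alpha> \<in> vcar (HKcoh V R p m)" and ze: "\<zeta> \<in> vcar (HKhom V R q n)"
  shows "psi (q - p) (m + n) (HKcapl V R p m q n \<alpha> \<zeta>) = MHKcupl V' R' B.M m p n q (HphiA V R p m \<alpha>) (psi q n \<zeta>)"
    and "psi (q - p) (m + n) (HKcapr V R p m q n \<zeta> \<alpha>) = MHKcupr V' R' B.M m p n q (psi q n \<zeta>) (HphiA V R p m \<alpha>)"
proof -
  let ?\<phi> = "ph p m" and ?\<theta> = "theta q n"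
  let ?NC = "A.NC p m" and ?K = "K q n"
  obtain f0 where f0: "f0 \<in> Kcocyc V R p m" "\<alpha> = vadd ?NC f0 ` Kcobd V R p m"
    using al by (auto simp: HKcoh_def vquot_def vclass_def Kcoch_def simp del: vhom_simps)
  obtain z0 where z0: "z0 \<in> Kcyc V R q n" "\<zeta> = clK q n z0" using ze by (auto simp: HKhom_carrier)
  note F0 = phi_cocyc[OF f0(1)]
  have zK: "z0 \<in> vcar ?K" and g0: "?\<theta> z0 \<in> B.ZM n q" using z0(1) by (simp_all add: Kcyc_theta)
  have fN: "f \<in> vcar ?NC" and fphi: "\<exists>F1\<in>B.BN m p. ?\<phi> f = vadd (B.NC m p) (?\<phi> f0) F1" if "f \<in> \<alpha>" for f
  proof -
    obtain h where h: "h \<in> Kcobd V R p m" "f = vadd ?NC f0 h" using \<open>f \<in> \<alpha>\<close> unfolding f0(2) by blast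
    note H = phi_cobd[OF h(1)]
    show "f \<in> vcar ?NC" unfolding h(2) by (rule vsp_add[OF A.vsp_NC F0(1) H(1)])
    show "\<exists>F1\<in>B.BN m p. ?\<phi> f = vadd (B.NC m p) (?\<phi> f0) F1"
      unfolding h(2) phi_add[OF F0(1) H(1)] using H(2) by blast
  qed
  have f0\<alpha>: "f0 \<in> \<alpha>"
    unfolding f0(2) using vsp_add_zero[OF A.vsp_NC F0(1)]
    by (intro image_eqI[of _ _ "vzero ?NC"]) (simp_all add: Kcobd_def Kcoch_def del: vhom_simps)
  have z\<zeta>: "z \<in> vcar ?K" "?\<theta> z \<in> clM n q (?\<theta> z0)" if "z \<in> \<zeta>" for z
    using that vclass_sub[OF vsp_Kch vsubsp_Kbd zK] quot(2)[OF zK] unfolding z0(2) by auto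
  have z0\<zeta>: "z0 \<in> \<zeta>" unfolding z0(2) by (rule vclass_self[OF vsp_Kch vsubsp_Kbd zK])
  have Mclass: "\<exists>g1\<in>B.BM n q. g = vadd (B.MC n q) (?\<theta> z0) g1" if "g \<in> clM n q (?\<theta> z0)" for g
    using that unfolding vclass_def by blast
  have NCs: "vsubsp (B.NC m p) (B.BN m p)"
    by (rule B.vsubsp_Mcobd_N)
  have Hphi: "HphiA V R p m \<alpha> = vclass (B.NC m p) (B.BN m p) (?\<phi> f0)"
  proof -
    have 1: "vclass (B.NC m p) (B.BN m p) (?\<phi> f) = vclass (B.NC m p) (B.BN m p) (?\<phi> f0)" if "f \<in> \<alpha>" for f
      using fphi[OF that] vclass_add[OF B.vsp_NC NCs phi(2)[OF F0(1)]] by auto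
    show ?thesis unfolding HphiA_def R'[symmetric] V'[symmetric] B.NC_Mcoch
    proof (rule SUP_eq_const)
      show "\<alpha> \<noteq> {}" using f0\<alpha> by blast
    qed (rule 1)
  qed
  have psi\<zeta>: "psi q n \<zeta> = clM n q (?\<theta> z0)" unfolding z0(2) by (rule psi_class[OF z0(1)])
  let ?L = "clM (m + n) (q - p) (B.cupl m p n q (?\<phi> f0) (?\<theta> z0))"
  let ?R = "clM (n + m) (q - p) (B.cupr m p n q (?\<theta> z0) (?\<phi> f0))"
  have cl: "clM (m + n) (q - p) (B.cupl m p n q F g) = ?L"
    "clM (n + m) (q - p) (B.cupr m p n q g F) = ?R"
    if "\<exists>F1\<in>B.BN m p. F = vadd (B.NC m p) (?\<phi> f0) F1" "g \<in> clM n q (?\<theta> z0)" for F g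
    using that(1) Mclass[OF that(2)] B.mcup_class[OF F0(2) _ g0] by auto
  have ne: "\<And>x U K. vsp U \<Longrightarrow> vsubsp U K \<Longrightarrow> x \<in> vcar U \<Longrightarrow> vclass U K x \<noteq> {}"
    using vclass_self by fastforce
  have Nclass: "\<exists>F1\<in>B.BN m p. F = vadd (B.NC m p) (?\<phi> f0) F1"
    if "F \<in> vclass (B.NC m p) (B.BN m p) (?\<phi> f0)" for F
    using that unfolding vclass_def by blast
  note neN = ne[OF B.vsp_NC NCs phi(2)[OF F0(1)]] and neM = ne[OF B.vsp_MC B.vsubsp_Mcobd theta_in[OF zK]]
  have rhs: "MHKcupl V' R' B.M m p n q (HphiA V R p m \<alpha>) (psi q n \<zeta>) = ?L"
    "MHKcupr V' R' B.M m p n q (psi q n \<zeta>) (HphiA V R p m \<alpha>) = ?R"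
    unfolding MHKcupl_def MHKcupr_def Hphi psi\<zeta> B.MC_Mcoch B.M_simps
    by (rule UN_const2[OF cl(1)[OF Nclass] neN neM], assumption+)
       (rule UN_const2[OF cl(2)[OF Nclass] neM neN], assumption+)
  show "psi (q - p) (m + n) (HKcapl V R p m q n \<alpha> \<zeta>) = MHKcupl V' R' B.M m p n q (HphiA V R p m \<alpha>) (psi q n \<zeta>)"
  proof -
    let ?c = "\<lambda>f z. clK (q - p) (m + n) (capl V R p m q n f z)"
    have im: "theta (q - p) (m + n) ` ?c f z = ?L" if "f \<in> \<alpha>" "z \<in> \<zeta>" for f z
      unfolding quot(2)[OF theta_capl(2)[OF fN[OF that(1)] z\<zeta>(1)[OF that(2)]]]
        theta_capl(1)[OF fN[OF that(1)] z\<zeta>(1)[OF that(2)]]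
      by (rule cl(1)[OF fphi[OF that(1)] z\<zeta>(2)[OF that(2)]])
    \<comment> \<open>Both cosets lie in the carrier and have the image \<open>?L\<close>;
      injectivity of \<open>theta\<close> identifies them.\<close>
    have "?c f z = ?c f0 z0" if "f \<in> \<alpha>" "z \<in> \<zeta>" for f z
      using inj_on_image_eq_iff[OF theta_inj, of "?c f z" "q - p" "m + n" "?c f0 z0"] im[OF that] im[OF f0\<alpha> z0\<zeta>]
        vclass_sub[OF vsp_Kch vsubsp_Kbd theta_capl(2)] fN that z\<zeta>(1) zK F0(1) by simp
    note 1 = this
    have H: "HKcapl V R p m q n \<alpha> \<zeta> = ?c f0 z0"
      unfolding HKcapl_def by (rule UN_const2[OF 1]) (use f0\<alpha> z0\<zeta> in blast)+
    have "capl V R p m q n f0 z0 \<in> Kcyc V R (q - p) (m + n)"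
      unfolding Kcyc_theta using B.mcup_cocyc(1)[OF F0(2) g0] theta_capl[OF F0(1) zK] by simp
    from psi_class[OF this] show ?thesis
      unfolding H rhs theta_capl(1)[OF F0(1) zK] .
  qed
  show "psi (q - p) (m + n) (HKcapr V R p m q n \<zeta> \<alpha>) = MHKcupr V' R' B.M m p n q (psi q n \<zeta>) (HphiA V R p m \<alpha>)"
  proof -
    let ?c = "\<lambda>f z. clK (q - p) (m + n) (capr V R p m q n z f)"
    have im: "theta (q - p) (m + n) ` ?c f z = ?R" if "f \<in> \<alpha>" "z \<in> \<zeta>" for f z
      unfolding quot(2)[OF theta_capr(2)[OF fN[OF that(1)] z\<zeta>(1)[OF that(2)]]]
        theta_capr(1)[OF fN[OF that(1)] z\<zeta>(1)[OF that(2)]]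
      using cl(2)[OF fphi[OF that(1)] z\<zeta>(2)[OF that(2)]] by (simp only: add.commute[of n m])
    have "?c f z = ?c f0 z0" if "f \<in> \<alpha>" "z \<in> \<zeta>" for f z
      using inj_on_image_eq_iff[OF theta_inj, of "?c f z" "q - p" "m + n" "?c f0 z0"] im[OF that] im[OF f0\<alpha> z0\<zeta>]
        vclass_sub[OF vsp_Kch vsubsp_Kbd theta_capr(2)] fN that z\<zeta>(1) zK F0(1) by simp
    note 1 = this
    have H: "HKcapr V R p m q n \<zeta> \<alpha> = ?c f0 z0"
      unfolding HKcapr_def by (rule UN_const2[OF 1]) (use f0\<alpha> z0\<zeta> in blast)+
    have "capr V R p m q n z0 f0 \<in> Kcyc V R (q - p) (m + n)"
      unfolding Kcyc_theta using B.mcup_cocyc(2)[OF F0(2) g0] theta_capr[OF F0(1) zK] by (simp add: add.commute)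
    from psi_class[OF this] show ?thesis
      unfolding H rhs theta_capr(1)[OF F0(1) zK] by (simp only: add.commute[of n m])
  qed
qed

end

section \<open>Coordinates on \<open>V\<close> and its dual, and the final assembly\<close>

text \<open>When the carrier is the whole type, restriction to it changes nothing, so the operations
  of the dual are the pointwise ones and the results on \<open>fsub\<close> apply.\<close>

lemma vdual_vtype: "vdual (vtype sc) = fsub (vcar (vdual (vtype sc)))"
  by (simp add: vdual_def vhom_def fsub_def fun_eq_iff fscale_def)

lemma (in finite_dimensional_vector_space) vtype_form_sum:
  assumes l: "vlinear (vtype scale) vfield l"
  shows "l (\<Sum>b\<in>B. scale (k b) b) = (\<Sum>b\<in>B. k b * l b)"
proof -
  have 0: "l 0 = 0" using vform_scale[OF l, of 0 0] by simp
  show ?thesis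
    by (cases "finite B", induction B rule: finite_induct)
       (use vform_add[OF l] vform_scale[OF l] in \<open>auto simp: 0\<close>)
qed

theorem theorem8p8:
  fixes scale :: "'k::field \<Rightarrow> 'v::ab_group_add \<Rightarrow> 'v"
    and Basis :: "'v set"
    and V :: "('k, 'v) vspace"
    and R :: "('k, 'v) tensor set"
    and V' :: "('k, 'v \<Rightarrow> 'k) vspace"
    and R' :: "('k, 'v \<Rightarrow> 'k) tensor set"
    and M :: "('k, ('k, 'v \<Rightarrow> 'k) tensor set, ('k, 'v \<Rightarrow> 'k) tensor set \<Rightarrow> 'k) gbimod"
  assumes "finite_dimensional_vector_space scale Basis"
    and "V = vtype scale"
    and "R \<subseteq> vcar (tpow V 2)" and "module.subspace fscale R"
    and "V' = vdual V" and "R' = rperp V R" and "M = dual_bimod V' R'"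
  shows "(\<exists>\<Psi>.
      (\<forall>q n. \<Psi> q n \<in> viso (HKhom V R q n) (MHK V' R' M n q)) \<and>
      (\<forall>p m q n. \<forall>\<alpha>\<in>vcar (HKcoh V R p m). \<forall>\<zeta>\<in>vcar (HKhom V R q n).
         \<Psi> (q - p) (m + n) (HKcapl V R p m q n \<alpha> \<zeta>)
           = MHKcupl V' R' M m p n q (HphiA V R p m \<alpha>) (\<Psi> q n \<zeta>) \<and>
         \<Psi> (q - p) (m + n) (HKcapr V R p m q n \<zeta> \<alpha>)
           = MHKcupr V' R' M m p n q (\<Psi> q n \<zeta>) (HphiA V R p m \<alpha>)))
    \<and> (\<forall>p m. \<exists>h. h \<in> viso (HKhom V R p m) (MHK V' R' M m p))"
proof -
  interpret fin: finite_dimensional_vector_space scale Basis by fact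
  define d where "d = card Basis"
  obtain e where e: "bij_betw e {..<d} Basis"
    using ex_bij_betw_nat_finite[OF fin.finite_Basis] by (auto simp: d_def lessThan_atLeast0)
  define c where "c = (\<lambda>i x. fin.representation Basis x (e i))"
  have eB: "e i \<in> Basis" if "i < d" for i using e that by (auto simp: bij_betw_def)
  have cl: "vlinear V vfield (c i)" for i
    unfolding assms(2) c_def
    by (intro vlinear_formI) (simp_all add: fin.representation_add fin.representation_scale fin.independent_Basis fin.span_Basis)
  have ce: "c i (e j) = (if i = j then 1 else 0)" if "i < d" "j < d" for i j
    using that e eB fin.independent_Basis
    by (auto simp: c_def fin.representation_basis bij_betw_def inj_on_def)
  have x: "x = (\<Sum>b\<in>Basis. scale (fin.representation Basis x b) b)" for x
    using fin.sum_representation_eq[of Basis x Basis] fin.span_Basis fin.independent_Basis fin.finite_Basis by simp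
  have expand: "l x = (\<Sum>i<d. c i x * l (e i))" if "vlinear V vfield l" for l x
  proof -
    have "l x = (\<Sum>b\<in>Basis. fin.representation Basis x b * l b)"
      using fin.vtype_form_sum[of l "fin.representation Basis x" Basis] that x[of x] assms(2) by simp
    also have "\<dots> = (\<Sum>i<d. c i x * l (e i))"
      unfolding c_def by (rule sum.reindex_bij_betw[OF e, symmetric])
    finally show ?thesis .
  qed
  have vspV: "vsp V"
  proof (rule vspI)
    fix x y assume eq: "\<And>l. vlinear V vfield l \<Longrightarrow> l x = l y"
    have "fin.representation Basis x b = fin.representation Basis y b" if b: "b \<in> Basis" for b
    proof -
      obtain i where "b = e i" using b bij_betw_imp_surj_on[OF e] by blast
      then show ?thesis using eq[OF cl[of i]] by (simp add: c_def)
    qed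
    then show "x = y" by (subst x[of x], subst x[of y]) simp
  qed (simp_all add: assms(2))
  \<comment> \<open>Closure of the carrier, already contained in \<open>vsp\<close>, is read back as
    a subspace property so that \<open>vform_fsub_sum\<close> can be used in the dual.\<close>
  have S: "V' = fsub (vcar V')" "fv.subspace (vcar V')"
  proof -
    show 1: "V' = fsub (vcar V')" unfolding assms(2,5) by (rule vdual_vtype)
    have "vsp V'" unfolding assms(5) by (rule vsp_vdual[OF vspV])
    then have "vsp (fsub (vcar V'))" using 1 by simp
    then show "fv.subspace (vcar V')" by (auto simp: vsp_def fv.subspace_def)
  qed
  have V'_car: "\<xi> \<in> vcar V' \<longleftrightarrow> vlinear V vfield \<xi>" for \<xi>
    by (simp add: assms(2,5) vcar_vdual)
  \<comment> \<open>In the basis of coordinate forms \<open>c i\<close>, the coordinates of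
    \<open>\<xi>\<close> are its values at the vectors \<open>e i\<close>.\<close>
  have expand': "l \<xi> = (\<Sum>i<d. \<xi> (e i) * l (c i))" if l: "vlinear V' vfield l" and xi: "\<xi> \<in> vcar V'" for l \<xi>
  proof -
    have "\<xi> = (\<Sum>i<d. fscale (\<xi> (e i)) (c i))"
    proof
      fix x
      have "vlinear (fsub (vcar V')) vfield (\<lambda>f. f x)" by (simp add: vlinear_def fscale_def)
      from vform_fsub_sum[OF S(2) this, of "{..<d}" c "\<lambda>i. \<xi> (e i)"]
      show "\<xi> x = (\<Sum>i<d. fscale (\<xi> (e i)) (c i)) x"
        using expand[of \<xi> x] xi cl by (simp add: V'_car mult.commute)
    qed
    then have "l \<xi> = l (\<Sum>i<d. fscale (\<xi> (e i)) (c i))" by simp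
    also have "\<dots> = (\<Sum>i<d. \<xi> (e i) * l (c i))"
      using l S(1) cl by (intro vform_fsub_sum[OF S(2)]) (simp_all add: V'_car)
    finally show ?thesis .
  qed
  have sub': "fv.subspace R'" "R' \<subseteq> vcar (tpow V' 2)"
    unfolding assms(6) rperp_def assms(5)
    by (auto simp: fv.subspace_def tpair_def fscale_def intro: fv.subspace_0[OF subspace_tpow]
        fv.subspace_add[OF subspace_tpow] fv.subspace_scale[OF subspace_tpow, unfolded fscale_def])
  interpret qdual V d e c R V' c "\<lambda>i \<xi>. \<xi> (e i)" R'
  proof unfold_locales
    show "vsp V'" unfolding assms(5) by (rule vsp_vdual[OF vspV])
    show "vlinear V' vfield (\<lambda>\<xi>. \<xi> (e i))" for i
      unfolding assms(5) by (rule vdual_eval) (simp add: assms(2))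
    show "c i \<in> vcar V'" for i by (simp add: V'_car cl)
  qed (use vspV cl ce expand expand' sub' assms in \<open>auto simp: V'_car\<close>)
  have iso: "psi q n \<in> viso (HKhom V R q n) (MHK V' R' M n q)" for q n
    unfolding assms(7) by (rule psi_viso)
  moreover have "psi (q - p) (m + n) (HKcapl V R p m q n \<alpha> \<zeta>) = MHKcupl V' R' M m p n q (HphiA V R p m \<alpha>) (psi q n \<zeta>)"
    "psi (q - p) (m + n) (HKcapr V R p m q n \<zeta> \<alpha>) = MHKcupr V' R' M m p n q (psi q n \<zeta>) (HphiA V R p m \<alpha>)"
    if "\<alpha> \<in> vcar (HKcoh V R p m)" "\<zeta> \<in> vcar (HKhom V R q n)" for p m q n \<alpha> \<zeta>
    unfolding assms(7) by (rule HKcap[OF that])+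
  ultimately show ?thesis by blast
qed

end
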